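(* Let $V$ be a complex vector space of complex dimension $2$ with a Hermitian inner product. Let $P=P(V\times\mathbf C)\approx\mathbf{CP}^2$, so that $P=V\cup H$ with $H\approx\mathbf{CP}^1$ the projective line at infinity, let $S=V\cup\{\infty\}\approx S^4$, and let $\mathrm{pr}:P\to S$ be the projection that sends $H$ to $\infty$ and equals the identity on $V$. Then, for any oriented real surface $\Sigma$ (not necessarily closed), the pseudoholomorphic immersions $f:\Sigma\to S$ are precisely the composites $\mathrm{pr}\circ\hat f$, where $\hat f$ runs through all pseudoholomorphic immersions $\Sigma\to P$ transverse to $H$.
   Context: **Compactifications of $V$.** $P$ is the complex projective space of all complex lines through $0$ in $V\times\mathbf C$; $[y,z]\in P$ denotes the line spanned by $(y,z)\ne(0,0)$. $V$ is treated as a subset of $P$ by identifying $y\in V$ with $[y,1]$, and $H=\{[y,0]:y\in V\smallsetminus\{0\}\}$. The projection is given by $\mathrm{pr}([y,z])=y/z$ if $z\ne0$ and $\mathrm{pr}([y,0])=\infty$. The set $S=V\cup\{\infty\}$ is a $C^\infty$ manifold (diffeomorphic to $S^4$) with the atlas of two $V$-valued charts: $\mathrm{Id}:S\smallsetminus\{\infty\}=V\to V$ and $\Phi:S\smallsetminus\{0\}\to V$, where $\Phi(y)=y/|y|^2$ for $y\in V\smallsetminus\{0\}$ and $\Phi(\infty)=0$. The map $\mathrm{pr}:P\to S$ is $C^\infty$. **Pseudoholomorphic immersions.** An immersion $f:\Sigma\to N$ of an oriented real surface in an almost complex manifold $N$ of real dimension $4$ is pseudoholomorphic if, for every $x\in\Sigma$,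 $df_x(T_x\Sigma)$ is a complex line in $T_{f(x)}N$ and $df_x$ maps the orientation of $T_x\Sigma$ to the complex-line orientation (the one in which $(e,ie)$ is positive). An immersion $f:\Sigma\to S$ of an oriented real surface $\Sigma$ is called pseudoholomorphic if its restriction to $\Sigma\smallsetminus f^{-1}(\infty)$ is a pseudoholomorphic immersion in the complex plane $V=S\smallsetminus\{\infty\}$. All manifolds are smooth and connected. *)

theory Defs
  imports "HOL-Analysis.Analysis"
begin

section \<open>Smooth maps between open subsets of Euclidean spaces\<close>

text \<open>For open \<open>U\<close>, \<open>Ck_on n U f\<close> says that \<open>f\<close> is of class \<open>C^n\<close> on \<open>U\<close>. In finite dimension it is
  enough to iterate directional derivatives in constant directions.\<close>

fun Ck_on :: "nat \<Rightarrow> 'e::euclidean_space set \<Rightarrow> ('e \<Rightarrow> 'f::euclidean_space) \<Rightarrow> bool" where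
  "Ck_on 0 U f \<longleftrightarrow> continuous_on U f"
| "Ck_on (Suc n) U f \<longleftrightarrow> (\<forall>x\<in>U. f differentiable (at x)) \<and>
     (\<forall>v. Ck_on n U (\<lambda>x. frechet_derivative f (at x) v))"

definition smooth_on :: "'e::euclidean_space set \<Rightarrow> ('e \<Rightarrow> 'f::euclidean_space) \<Rightarrow> bool" where
  "smooth_on U f \<longleftrightarrow> (\<forall>n. Ck_on n U f)"

section \<open>Smooth manifolds\<close>

text \<open>A chart is a pair of its domain and its coordinate map; the values of the coordinate map
  outside the domain are irrelevant. A manifold is given by an atlas; its underlying set is the
  union of the chart domains, and it carries the topology determined by the atlas.\<close>

type_synonym ('a, 'e) chart = "'a set \<times> ('a \<Rightarrow> 'e)"

definition points :: "('a, 'e) chart set \<Rightarrow> 'a set" where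
  "points A = (\<Union>c\<in>A. fst c)"

definition chart_inv :: "('a, 'e) chart \<Rightarrow> 'e \<Rightarrow> 'a" where
  "chart_inv c = inv_into (fst c) (snd c)"

definition in_charts :: "('a \<Rightarrow> 'b) \<Rightarrow> ('a, 'e) chart \<Rightarrow> ('b, 'f) chart \<Rightarrow> 'e \<Rightarrow> 'f" where
  "in_charts f c d = snd d \<circ> f \<circ> chart_inv c"

definition transition :: "('a, 'e) chart \<Rightarrow> ('a, 'e) chart \<Rightarrow> 'e \<Rightarrow> 'e" where
  "transition c d = snd d \<circ> chart_inv c"

definition smooth_atlas :: "('a, 'e::euclidean_space) chart set \<Rightarrow> bool" where
  "smooth_atlas A \<longleftrightarrow>
     (\<forall>c\<in>A. inj_on (snd c) (fst c) \<and> open (snd c ` fst c)) \<and>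
     (\<forall>c\<in>A. \<forall>d\<in>A. open (snd c ` (fst c \<inter> fst d)) \<and>
        smooth_on (snd c ` (fst c \<inter> fst d)) (transition c d))"

definition atlas_topology :: "('a, 'e::euclidean_space) chart set \<Rightarrow> 'a topology" where
  "atlas_topology A = topology (\<lambda>W. W \<subseteq> points A \<and> (\<forall>c\<in>A. open (snd c ` (W \<inter> fst c))))"

definition smooth_manifold :: "('a, 'e::euclidean_space) chart set \<Rightarrow> bool" where
  "smooth_manifold A \<longleftrightarrow> smooth_atlas A \<and> Hausdorff_space (atlas_topology A) \<and>
     second_countable (atlas_topology A) \<and> connected_space (atlas_topology A)"

text \<open>The open submanifold with underlying set \<open>W \<inter> points A\<close>, for open \<open>W\<close>.\<close>

definition restrict_atlas :: "('a, 'e) chart set \<Rightarrow> 'a set \<Rightarrow> ('a, 'e) chart set" where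
  "restrict_atlas A W = (\<lambda>c. (fst c \<inter> W, snd c)) ` A"

text \<open>Openness of the domains on which \<open>f\<close> is read in charts amounts to continuity of \<open>f\<close>.\<close>

definition smooth_map ::
  "('a, 'e::euclidean_space) chart set \<Rightarrow> ('b, 'f::euclidean_space) chart set \<Rightarrow> ('a \<Rightarrow> 'b) \<Rightarrow> bool" where
  "smooth_map A B f \<longleftrightarrow> f ` points A \<subseteq> points B \<and>
     (\<forall>c\<in>A. \<forall>d\<in>B. open (snd c ` {x \<in> fst c. f x \<in> fst d}) \<and>
        smooth_on (snd c ` {x \<in> fst c. f x \<in> fst d}) (in_charts f c d))"

section \<open>Tangent spaces and differentials\<close>

text \<open>A tangent vector at \<open>x\<close> assigns to every chart around \<open>x\<close> a vector of the model space (its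
  coordinates in that chart), compatibly with the derivatives of the transition maps. The value at
  all other arguments is \<open>0\<close>, so that tangent vectors are determined by their coordinates. Linear
  operations are pointwise.\<close>

type_synonym ('a, 'e) tangent = "('a, 'e) chart \<Rightarrow> 'e"

definition charts_at :: "('a, 'e) chart set \<Rightarrow> 'a \<Rightarrow> ('a, 'e) chart set" where
  "charts_at A x = {c \<in> A. x \<in> fst c}"

definition tangent_space :: "('a, 'e::euclidean_space) chart set \<Rightarrow> 'a \<Rightarrow> ('a, 'e) tangent set" where
  "tangent_space A x = {t.
     (\<forall>c\<in>charts_at A x. \<forall>d\<in>charts_at A x.
        t d = frechet_derivative (transition c d) (at (snd c x)) (t c)) \<and>
     (\<forall>c. c \<notin> charts_at A x \<longrightarrow> t c = 0)}"

definition lincomb :: "real \<Rightarrow> ('a, 'e::real_vector) tangent \<Rightarrow> real \<Rightarrow> ('a, 'e) tangent \<Rightarrow> ('a, 'e) tangent"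
  where "lincomb a t b u = (\<lambda>c. a *\<^sub>R t c + b *\<^sub>R u c)"

text \<open>By the chain rule the choice of the chart \<open>c\<close> around \<open>x\<close> does not matter.\<close>

definition differential ::
  "('a, 'e::euclidean_space) chart set \<Rightarrow> ('b, 'f::euclidean_space) chart set \<Rightarrow> ('a \<Rightarrow> 'b) \<Rightarrow> 'a \<Rightarrow>
     ('a, 'e) tangent \<Rightarrow> ('b, 'f) tangent" where
  "differential A B f x t = (\<lambda>d. if d \<in> charts_at B (f x)
     then (let c = SOME c. c \<in> charts_at A x
           in frechet_derivative (in_charts f c d) (at (snd c x)) (t c))
     else 0)"

definition immersion ::
  "('a, 'e::euclidean_space) chart set \<Rightarrow> ('b, 'f::euclidean_space) chart set \<Rightarrow> ('a \<Rightarrow> 'b) \<Rightarrow> bool" where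
  "immersion A B f \<longleftrightarrow> smooth_map A B f \<and>
     (\<forall>x\<in>points A. inj_on (differential A B f x) (tangent_space A x))"

text \<open>The tangent space at \<open>p\<close> of a submanifold \<open>K\<close>: the velocities at \<open>p\<close> of smooth curves in the
  ambient manifold that run in \<open>K\<close>.\<close>

definition sub_tangent_space ::
  "('b, 'f::euclidean_space) chart set \<Rightarrow> 'b set \<Rightarrow> 'b \<Rightarrow> ('b, 'f) tangent set" where
  "sub_tangent_space B K p = {t \<in> tangent_space B p. \<exists>\<epsilon>>0. \<exists>\<gamma>::real \<Rightarrow> 'b.
     smooth_map {({-\<epsilon><..<\<epsilon>}, \<lambda>s. s)} B \<gamma> \<and> \<gamma> ` {-\<epsilon><..<\<epsilon>} \<subseteq> K \<and> \<gamma> 0 = p \<and>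
     (\<forall>d\<in>charts_at B p. ((snd d \<circ> \<gamma>) has_vector_derivative t d) (at 0))}"

definition transverse ::
  "('a, 'e::euclidean_space) chart set \<Rightarrow> ('b, 'f::euclidean_space) chart set \<Rightarrow> ('a \<Rightarrow> 'b) \<Rightarrow> 'b set \<Rightarrow> bool"
  where
  "transverse A B f K \<longleftrightarrow> (\<forall>x\<in>points A. f x \<in> K \<longrightarrow>
     tangent_space B (f x) = {lincomb 1 (differential A B f x u) 1 h | u h.
        u \<in> tangent_space A x \<and> h \<in> sub_tangent_space B K (f x)})"

section \<open>Oriented surfaces and pseudoholomorphic immersions\<close>

definition oriented_surface :: "('a, real^2) chart set \<Rightarrow> bool" where
  "oriented_surface A \<longleftrightarrow> smooth_manifold A \<and>
     (\<forall>c\<in>A. \<forall>d\<in>A. \<forall>x \<in> fst c \<inter> fst d.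
        det (matrix (frechet_derivative (transition c d) (at (snd c x)))) > 0)"

text \<open>\<open>(u, v)\<close> is a positive basis of the tangent space at \<open>x\<close>.\<close>

definition positive_basis :: "('a, real^2) chart set \<Rightarrow> 'a \<Rightarrow> ('a, real^2) tangent \<Rightarrow> ('a, real^2) tangent \<Rightarrow> bool"
  where
  "positive_basis A x u v \<longleftrightarrow> u \<in> tangent_space A x \<and> v \<in> tangent_space A x \<and>
     (\<exists>c\<in>charts_at A x. det (vector [u c, v c] :: real^2^2) > 0)"

text \<open>In the following, \<open>J p\<close> is the almost complex structure (multiplication by \<open>i\<close>) on the tangent
  space at \<open>p\<close>.\<close>

definition complex_line_in ::
  "('b, 'f::euclidean_space) chart set \<Rightarrow> ('b \<Rightarrow> ('b, 'f) tangent \<Rightarrow> ('b, 'f) tangent) \<Rightarrow> 'b \<Rightarrow>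
     ('b, 'f) tangent set \<Rightarrow> bool" where
  "complex_line_in B J p L \<longleftrightarrow> (\<exists>e\<in>tangent_space B p. e \<noteq> (\<lambda>_. 0) \<and>
     L = {lincomb a e b (J p e) | a b. True})"

text \<open>\<open>(u, v)\<close> is a basis of the complex line \<open>L\<close> with the same orientation as \<open>(e, ie)\<close>.\<close>

definition complex_positive_basis ::
  "('b \<Rightarrow> ('b, 'f::euclidean_space) tangent \<Rightarrow> ('b, 'f) tangent) \<Rightarrow> 'b \<Rightarrow>
     ('b, 'f) tangent set \<Rightarrow> ('b, 'f) tangent \<Rightarrow> ('b, 'f) tangent \<Rightarrow> bool" where
  "complex_positive_basis J p L u v \<longleftrightarrow> (\<exists>e\<in>L. e \<noteq> (\<lambda>_. 0) \<and>
     (\<exists>a b c d. u = lincomb a e b (J p e) \<and> v = lincomb c e d (J p e) \<and> a * d - b * c > 0))"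

definition pseudoholomorphic_immersion ::
  "('a, real^2) chart set \<Rightarrow> ('b, 'f::euclidean_space) chart set \<Rightarrow>
     ('b \<Rightarrow> ('b, 'f) tangent \<Rightarrow> ('b, 'f) tangent) \<Rightarrow> ('a \<Rightarrow> 'b) \<Rightarrow> bool" where
  "pseudoholomorphic_immersion A B J f \<longleftrightarrow> immersion A B f \<and>
     (\<forall>x\<in>points A.
        let L = differential A B f x ` tangent_space A x in
          complex_line_in B J (f x) L \<and>
          (\<forall>u v. positive_basis A x u v \<longrightarrow>
             complex_positive_basis J (f x) L (differential A B f x u) (differential A B f x v)))"

section \<open>The Hermitian plane and its two compactifications\<close>

text \<open>The norm and the topology of the type \<open>'v\<close> are required to be those of the Hermitian inner
  product; the real inner product of \<open>'v\<close> is then its real part, by polarization.\<close>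

locale hermitian_plane =
  fixes sc :: "complex \<Rightarrow> 'v::euclidean_space \<Rightarrow> 'v"
    and herm :: "'v \<Rightarrow> 'v \<Rightarrow> complex"
  assumes vector_space: "vector_space sc"
    and sc_of_real: "sc (of_real r) x = r *\<^sub>R x"
    and complex_dim: "vector_space.dim sc UNIV = 2"
    and herm_add: "herm (x + y) z = herm x z + herm y z"
    and herm_sc: "herm (sc a x) y = a * herm x y"
    and herm_cnj: "herm y x = cnj (herm x y)"
    and herm_norm: "herm x x = of_real ((norm x)\<^sup>2)"

subsection \<open>The complex projective plane of \<open>V \<times> C\<close>\<close>

definition sc_prod :: "(complex \<Rightarrow> 'v \<Rightarrow> 'v) \<Rightarrow> complex \<Rightarrow> 'v \<times> complex \<Rightarrow> 'v \<times> complex" where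
  "sc_prod sc a w = (sc a (fst w), a * snd w)"

text \<open>\<open>pline sc w\<close> is the line \<open>[y, z]\<close> spanned by \<open>w = (y, z)\<close>.\<close>

definition pline :: "(complex \<Rightarrow> 'v \<Rightarrow> 'v) \<Rightarrow> 'v \<times> complex \<Rightarrow> ('v \<times> complex) set" where
  "pline sc w = range (\<lambda>a. sc_prod sc a w)"

definition proj_plane :: "(complex \<Rightarrow> 'v::euclidean_space \<Rightarrow> 'v) \<Rightarrow> ('v \<times> complex) set set" where
  "proj_plane sc = {pline sc w | w. w \<noteq> 0}"

definition line_at_infinity :: "(complex \<Rightarrow> 'v::euclidean_space \<Rightarrow> 'v) \<Rightarrow> ('v \<times> complex) set set" where
  "line_at_infinity sc = {pline sc (y, 0) | y. y \<noteq> 0}"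

text \<open>The affine charts of the projective plane: every complex linear automorphism \<open>T\<close> of \<open>V \<times> C\<close>
  provides the chart whose inverse is \<open>y \<mapsto> T [y, 1]\<close>. For \<open>T = id\<close> this is the inclusion of \<open>V\<close>.
  Transition maps are linear fractional, hence holomorphic.\<close>

definition proj_chart ::
  "(complex \<Rightarrow> 'v::euclidean_space \<Rightarrow> 'v) \<Rightarrow> ('v \<times> complex \<Rightarrow> 'v \<times> complex) \<Rightarrow> (('v \<times> complex) set, 'v) chart"
  where
  "proj_chart sc T = (range (\<lambda>y. pline sc (T (y, 1))), \<lambda>l. THE y. l = pline sc (T (y, 1)))"

definition proj_atlas :: "(complex \<Rightarrow> 'v::euclidean_space \<Rightarrow> 'v) \<Rightarrow> (('v \<times> complex) set, 'v) chart set" where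
  "proj_atlas sc = {proj_chart sc T | T. Vector_Spaces.linear (sc_prod sc) (sc_prod sc) T \<and> bij T}"

text \<open>Multiplication by \<open>i\<close> on the tangent spaces of a manifold whose atlas is modelled on \<open>V\<close> with
  holomorphic transition maps.\<close>

definition mult_i :: "(complex \<Rightarrow> 'v \<Rightarrow> 'v) \<Rightarrow> 'b \<Rightarrow> ('b, 'v) tangent \<Rightarrow> ('b, 'v) tangent" where
  "mult_i sc p t = (\<lambda>c. sc \<i> (t c))"

subsection \<open>The four-sphere \<open>S = V \<union> {\<infinity>}\<close>\<close>

datatype 'v one_point = Pt (the_pt: 'v) | Infty

definition inversion_chart :: "'v::euclidean_space one_point \<Rightarrow> 'v" where
  "inversion_chart s = (case s of Pt y \<Rightarrow> y /\<^sub>R (norm y)\<^sup>2 | Infty \<Rightarrow> 0)"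

definition sphere_atlas :: "('v::euclidean_space one_point, 'v) chart set" where
  "sphere_atlas = {(UNIV - {Infty}, the_pt), (UNIV - {Pt 0}, inversion_chart)}"

text \<open>The complex plane \<open>V\<close>, as the complement of \<open>\<infinity>\<close> in \<open>S\<close>.\<close>

definition plane_atlas :: "('v::euclidean_space one_point, 'v) chart set" where
  "plane_atlas = {(UNIV - {Infty}, the_pt)}"

definition pseudoholomorphic_immersion_sphere ::
  "(complex \<Rightarrow> 'v::euclidean_space \<Rightarrow> 'v) \<Rightarrow> ('a, real^2) chart set \<Rightarrow> ('a \<Rightarrow> 'v one_point) \<Rightarrow> bool" where
  "pseudoholomorphic_immersion_sphere sc A f \<longleftrightarrow> immersion A sphere_atlas f \<and>
     pseudoholomorphic_immersion (restrict_atlas A {x. f x \<noteq> Infty}) plane_atlas (mult_i sc) f"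

subsection \<open>The projection\<close>

definition pr :: "(complex \<Rightarrow> 'v::euclidean_space \<Rightarrow> 'v) \<Rightarrow> ('v \<times> complex) set \<Rightarrow> 'v one_point" where
  "pr sc l = (THE s. \<exists>y z. (y, z) \<noteq> 0 \<and> l = pline sc (y, z) \<and>
     s = (if z \<noteq> 0 then Pt (sc (1 / z) y) else Infty))"

end

theory Submission
  imports Defs "HOL-Complex_Analysis.Cauchy_Integral_Formula"
begin

text \<open>A map to \<open>P\<close> is given locally by a lift \<open>w\<close> to \<open>V \<times> C\<close>, unique up to a scalar factor, and in the
  charts of \<open>P\<close> its differential is that of \<open>w\<close> modulo \<open>C w\<close>. If \<open>w = (y, \<zeta>)\<close> with \<open>\<zeta>(x) = 0\<close>, then the
  composite with the projection is \<open>cnj \<zeta> y / |y|\<^sup>2\<close> in the chart of \<open>S\<close> at \<open>\<infinity>\<close>, so that it is an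
  immersion at \<open>x\<close> if and only if \<open>d\<zeta>\<close> is bijective at \<open>x\<close>, which is transversality to \<open>H\<close>.

  Conversely, let \<open>u\<close> be an immersion to \<open>S\<close>, in the chart at \<open>\<infinity>\<close>, with \<open>u(x) = 0\<close>. Away from \<open>x\<close> the map
  \<open>u/|u|\<^sup>2\<close> is holomorphic, so the conformality of the inversion forces the image of \<open>du\<close> at \<open>x\<close> to be a
  complex line. The inverse \<open>\<zeta>\<close> of the component of \<open>u/|u|\<^sup>2\<close> along this line is then a holomorphic
  coordinate near \<open>x\<close>, and \<open>(\<zeta> u/|u|\<^sup>2, \<zeta>)\<close> is the lift.\<close>

section \<open>Calculus of smooth maps\<close>

text \<open>The surface has no complex structure of its own; the immersion induces one. Holomorphy
  is therefore a pointwise condition on a real derivative \<open>D\<close> of the plane: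
  \<open>D\<close> of the second basis vector is omega times \<open>D\<close> of the first, with Im
  omega > 0 and omega depending on the point. Two functions on the surface are holomorphic in each
  other when they share the same omega. The obstacle is the point at infinity. The complex structure
  of \<open>V\<close> does not extend to \<open>S\<close>, and at a point sent to infinity only
  injectivity of the derivative is assumed. What holds there must be found as a limit from nearby
  points, where omega is not known to converge. Moreover, this limit is a first-order statement,
  while the lift must be C^infinity, although its coordinate \<open>\<zeta>\<close> is a quotient of
  smooth functions that both vanish at the point. Orientations explain the conjugates: since the
  composite is \<open>cnj \<zeta>\<close> times a vector, its derivative at such a point has a
  complex line as image but reverses the orientation, whereas the lift preserves it.\<close>

lemma Ck_on_cong:
  assumes "open U" "\<And>x. x \<in> U \<Longrightarrow> f x = g x"
  shows "Ck_on n U f \<longleftrightarrow> Ck_on n U g"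
  using assms(2)
proof (induction n arbitrary: f g)
  case 0
  then show ?case by (simp cong: continuous_on_cong)
next
  case (Suc n)
  have 1: "(f has_derivative D) (at x) \<longleftrightarrow> (g has_derivative D) (at x)" if "x \<in> U" for x D
    using has_derivative_transform_within_open[OF _ assms(1) that] Suc.prems by metis
  \<comment> \<open>\<open>frechet_derivative\<close> is a choice, so points without a derivative
    count as well: the choice is made from the same set for \<open>f\<close> and
    \<open>g\<close>.\<close>
  have 2: "frechet_derivative f (at x) = frechet_derivative g (at x)" if "x \<in> U" for x
    unfolding frechet_derivative_def using 1[OF that] by presburger
  have "Ck_on n U (\<lambda>x. frechet_derivative f (at x) v) \<longleftrightarrow>
        Ck_on n U (\<lambda>x. frechet_derivative g (at x) v)" for v
    using 2 by (intro Suc.IH) auto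
  moreover have "f differentiable at x \<longleftrightarrow> g differentiable at x" if "x \<in> U" for x
    unfolding differentiable_def using 1[OF that] by blast
  ultimately show ?case by simp
qed

text \<open>Lets a smoothness proof supply its own formula \<open>f'\<close> in place of the chosen
  \<open>frechet_derivative\<close>.\<close>

lemma Ck_on_Suc_I:
  assumes "open U" "\<And>x. x \<in> U \<Longrightarrow> (f has_derivative f' x) (at x)"
    and "\<And>v. Ck_on n U (\<lambda>x. f' x v)"
  shows "Ck_on (Suc n) U f"
proof -
  have "frechet_derivative f (at x) = f' x" if "x \<in> U" for x
    using assms(2)[OF that] by (metis frechet_derivative_at)
  then have "Ck_on n U (\<lambda>x. frechet_derivative f (at x) v)" for v
    using assms(3)[of v] Ck_on_cong[OF assms(1), of "\<lambda>x. frechet_derivative f (at x) v" "\<lambda>x. f' x v"] by auto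
  then show ?thesis using assms(2) by (auto simp: differentiable_def)
qed

lemma Ck_on_Suc_D:
  assumes "Ck_on (Suc n) U f" "x \<in> U"
  shows "(f has_derivative frechet_derivative f (at x)) (at x)"
  using assms by (auto simp: frechet_derivative_works)

lemma Ck_on_SucD: "Ck_on (Suc n) U f \<Longrightarrow> Ck_on n U f"
proof (induction n arbitrary: f)
  case 0
  then show ?case
    by (auto intro!: differentiable_imp_continuous_on simp: differentiable_on_def
        differentiable_at_withinI)
next
  case (Suc n)
  have "Ck_on n U (\<lambda>x. frechet_derivative f (at x) v)" for v
    using Suc.prems by (intro Suc.IH) simp
  then show ?case using Suc.prems by simp
qed

lemma Ck_on_subset: "Ck_on n U f \<Longrightarrow> V \<subseteq> U \<Longrightarrow> Ck_on n V f"
  by (induction n arbitrary: f) (auto intro: continuous_on_subset)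

lemma Ck_on_local:
  assumes "open U" "\<And>x. x \<in> U \<Longrightarrow> \<exists>N. open N \<and> x \<in> N \<and> Ck_on n N f"
  shows "Ck_on n U f"
  using assms(2)
proof (induction n arbitrary: f)
  case 0
  show ?case
    unfolding Ck_on.simps continuous_on_eq_continuous_at[OF assms(1)]
  proof
    fix x assume "x \<in> U"
    then obtain N where "open N" "x \<in> N" "continuous_on N f"
      using "0.prems" by auto
    then show "isCont f x"
      by (simp add: continuous_on_eq_continuous_at)
  qed
next
  case (Suc n)
  then show ?case by (simp; metis)
qed

lemma Ck_on_const [simp, intro]: "Ck_on n U (\<lambda>x. c)"
  by (induction n arbitrary: c) auto

lemma Ck_on_id: "open U \<Longrightarrow> Ck_on n U (\<lambda>x. x)"
proof (cases n)
  case (Suc m)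
  assume "open U"
  then show ?thesis unfolding Suc by (intro Ck_on_Suc_I[where f'="\<lambda>x v. v"]) auto
qed (auto)

lemma Ck_on_add:
  assumes "open U" "Ck_on n U f" "Ck_on n U g"
  shows "Ck_on n U (\<lambda>x. f x + g x)"
  using assms(2,3)
proof (induction n arbitrary: f g)
  case (Suc n)
  show ?case
    using Ck_on_Suc_D[OF Suc.prems(1)] Ck_on_Suc_D[OF Suc.prems(2)] Suc.prems
    by (intro Ck_on_Suc_I[OF assms(1), where f'="\<lambda>x v. frechet_derivative f (at x) v + frechet_derivative g (at x) v"]
        has_derivative_add Suc.IH) auto
qed (auto intro: continuous_on_add)

lemma Ck_on_sum:
  assumes "open U" "\<And>i. i \<in> I \<Longrightarrow> Ck_on n U (f i)"
  shows "Ck_on n U (\<lambda>x. \<Sum>i\<in>I. f i x)"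
  using assms(2) by (induction I rule: infinite_finite_induct) (auto intro!: Ck_on_add assms(1))

lemma Ck_on_bounded_linear:
  assumes "open U" "bounded_linear L" "Ck_on n U f"
  shows "Ck_on n U (\<lambda>x. L (f x))"
  using assms(3)
proof (induction n arbitrary: f)
  case 0
  then show ?case using assms(2) by (auto intro: bounded_linear.continuous_on)
next
  case (Suc n)
  show ?case
    using Ck_on_Suc_D[OF Suc.prems] Suc.prems
    by (intro Ck_on_Suc_I[OF assms(1), where f'="\<lambda>x v. L (frechet_derivative f (at x) v)"]
        bounded_linear.has_derivative[OF assms(2)] Suc.IH) auto
qed

text \<open>By the Leibniz rule each summand of the derivative contains one undifferentiated factor,
  so the induction also needs \<open>f\<close> and \<open>g\<close> at the lower order, which
  \<open>Ck_on_SucD\<close> provides.\<close>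

lemma Ck_on_bilinear:
  assumes "open U" "bounded_bilinear B" "Ck_on n U f" "Ck_on n U g"
  shows "Ck_on n U (\<lambda>x. B (f x) (g x))"
  using assms(3,4)
proof (induction n arbitrary: f g)
  case 0
  then show ?case using assms(2) by (auto intro: bounded_bilinear.continuous_on)
next
  case (Suc n)
  show ?case
    using Ck_on_Suc_D[OF Suc.prems(1)] Ck_on_Suc_D[OF Suc.prems(2)] Suc.prems
      Suc.prems[THEN Ck_on_SucD]
    by (intro Ck_on_Suc_I[OF assms(1), where f'="\<lambda>x v. B (f x) (frechet_derivative g (at x) v) + B (frechet_derivative f (at x) v) (g x)"]
        bounded_bilinear.FDERIV[OF assms(2)] Ck_on_add Suc.IH assms(1)) auto
qed

lemma Ck_on_Pair:
  assumes "open U" "Ck_on n U f" "Ck_on n U g"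
  shows "Ck_on n U (\<lambda>x. (f x, g x))"
  using assms(2,3)
proof (induction n arbitrary: f g)
  case (Suc n)
  show ?case
    using Ck_on_Suc_D[OF Suc.prems(1)] Ck_on_Suc_D[OF Suc.prems(2)] Suc.prems
    by (intro Ck_on_Suc_I[OF assms(1), where f'="\<lambda>x v. (frechet_derivative f (at x) v, frechet_derivative g (at x) v)"]
        has_derivative_Pair Suc.IH) auto
qed (auto intro: continuous_on_Pair)

lemma linear_euclidean_sum:
  fixes L :: "'e::euclidean_space \<Rightarrow> 'f::real_vector"
  assumes "linear L"
  shows "L x = (\<Sum>b\<in>Basis. (x \<bullet> b) *\<^sub>R L b)"
proof -
  have "L x = L (\<Sum>b\<in>Basis. (x \<bullet> b) *\<^sub>R b)" by (simp add: euclidean_representation)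
  also have "\<dots> = (\<Sum>b\<in>Basis. (x \<bullet> b) *\<^sub>R L b)"
    by (simp add: linear_sum[OF assms] linear_cmul[OF assms])
  finally show ?thesis .
qed

text \<open>\<open>Ck_on\<close> controls derivatives in constant directions only, but in the chain
  rule the direction fed to the derivative of \<open>g\<close> varies with \<open>x\<close>.
  Expanding it in \<open>Basis\<close> leaves products of coordinates of the derivative of
  \<open>f\<close> with constant-direction derivatives of \<open>g\<close> composed with
  \<open>f\<close>, and these fall under the induction hypothesis.\<close>

lemma Ck_on_compose:
  assumes "open U" "open V" "Ck_on n V g" "Ck_on n U f" "f ` U \<subseteq> V"
  shows "Ck_on n U (\<lambda>x. g (f x))"
  using assms(3,4)
proof (induction n arbitrary: g)
  case 0
  then show ?case using assms(5) by (auto intro: continuous_on_compose2)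
next
  case (Suc n)
  let ?D = "\<lambda>x v. frechet_derivative g (at (f x)) (frechet_derivative f (at x) v)"
  have fx: "f x \<in> V" if "x \<in> U" for x using assms(5) that by auto
  have lin: "linear (frechet_derivative g (at (f x)))" if "x \<in> U" for x
    using Ck_on_Suc_D[OF Suc.prems(1) fx[OF that]] has_derivative_linear by blast
  have "Ck_on n U (\<lambda>x. ?D x v)" for v
  proof -
    have eq: "?D x v = (\<Sum>b\<in>Basis. (frechet_derivative f (at x) v \<bullet> b) *\<^sub>R frechet_derivative g (at (f x)) b)"
      if "x \<in> U" for x using linear_euclidean_sum[OF lin[OF that]] by blast
    have "Ck_on n U (\<lambda>x. \<Sum>b\<in>Basis. (frechet_derivative f (at x) v \<bullet> b) *\<^sub>R frechet_derivative g (at (f x)) b)"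
      using Suc.prems Ck_on_SucD[OF Suc.prems(2)]
      by (intro Ck_on_sum assms(1) Ck_on_bilinear[OF _ bounded_bilinear_scaleR]
          Ck_on_bounded_linear[OF _ bounded_linear_inner_left] Suc.IH) auto
    moreover have "Ck_on n U (\<lambda>x. ?D x v) \<longleftrightarrow> Ck_on n U (\<lambda>x. \<Sum>b\<in>Basis. (frechet_derivative f (at x) v \<bullet> b) *\<^sub>R frechet_derivative g (at (f x)) b)"
      using eq by (rule Ck_on_cong[OF assms(1)])
    ultimately show ?thesis by blast
  qed
  moreover have "((\<lambda>x. g (f x)) has_derivative ?D x) (at x)" if "x \<in> U" for x
    using Ck_on_Suc_D[OF Suc.prems(1) fx[OF that]] Ck_on_Suc_D[OF Suc.prems(2) that]
    by (rule has_derivative_compose[rotated])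
  ultimately show ?case by (intro Ck_on_Suc_I[OF assms(1), where f'="?D"])
qed

lemma Ck_on_inverse:
  fixes U :: "'a::{euclidean_space, real_normed_field} set"
  assumes "open U" "0 \<notin> U"
  shows "Ck_on n U inverse"
proof (induction n)
  case 0
  show ?case using assms by (auto intro!: continuous_on_inverse continuous_on_id)
next
  case (Suc n)
  have "Ck_on n U (\<lambda>x. - (inverse x * v * inverse x))" for v :: 'a
    using Suc.IH
    by (intro Ck_on_bounded_linear[OF _ bounded_linear_minus[OF bounded_linear_ident]]
       Ck_on_bilinear[OF _ bounded_bilinear_mult] assms(1)) auto
  then show ?case
    using assms by (intro Ck_on_Suc_I[OF assms(1), where f'="\<lambda>x v. - (inverse x * v * inverse x)"] has_derivative_inverse') auto
qed

text \<open>Cauchy's theory makes \<open>deriv h\<close> holomorphic again, so one complex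
  derivative yields all orders. This is the only source of regularity in the removable-singularity
  argument of \<open>lift_at_infinity\<close>.\<close>

lemma Ck_on_holomorphic:
  assumes "open U" "h holomorphic_on U"
  shows "Ck_on n U h"
  using assms(2)
proof (induction n arbitrary: h)
  case 0
  then show ?case by (simp add: holomorphic_on_imp_continuous_on)
next
  case (Suc n)
  show ?case
  proof (rule Ck_on_Suc_I[OF assms(1), where f'="\<lambda>x v. deriv h x * v"])
    show "(h has_derivative (\<lambda>v. deriv h x * v)) (at x)" if "x \<in> U" for x
      using holomorphic_derivI[OF Suc.prems assms(1) that] unfolding has_field_derivative_def .
    show "Ck_on n U (\<lambda>x. deriv h x * v)" for v
      by (rule Suc.IH, rule holomorphic_on_mult[OF holomorphic_deriv[OF Suc.prems assms(1)] holomorphic_on_const])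
  qed
qed

section \<open>Closure properties of C^infinity maps\<close>

named_theorems smooth_intros

lemma smooth_on_cong:
  assumes "open U" "\<And>x. x \<in> U \<Longrightarrow> f x = g x"
  shows "smooth_on U f \<longleftrightarrow> smooth_on U g"
  using Ck_on_cong[OF assms] by (simp add: smooth_on_def)

lemma smooth_on_subset: "smooth_on U f \<Longrightarrow> V \<subseteq> U \<Longrightarrow> smooth_on V f"
  unfolding smooth_on_def by (metis Ck_on_subset)

lemma smooth_on_local:
  assumes "open U" "\<And>x. x \<in> U \<Longrightarrow> \<exists>N. open N \<and> x \<in> N \<and> smooth_on N f"
  shows "smooth_on U f"
  unfolding smooth_on_def
proof
  fix n show "Ck_on n U f"
    using assms(2) by (intro Ck_on_local[OF assms(1)]) (auto simp: smooth_on_def)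
qed

lemma smooth_on_has_derivative:
  "smooth_on U f \<Longrightarrow> x \<in> U \<Longrightarrow> (f has_derivative frechet_derivative f (at x)) (at x)"
  by (rule Ck_on_Suc_D[of 0]) (simp_all only: smooth_on_def)

lemma smooth_on_frechet_derivative:
  assumes "smooth_on U f"
  shows "smooth_on U (\<lambda>x. frechet_derivative f (at x) v)"
  unfolding smooth_on_def
proof
  fix n
  have "Ck_on (Suc n) U f" using assms by (simp only: smooth_on_def)
  then show "Ck_on n U (\<lambda>x. frechet_derivative f (at x) v)" by simp
qed

lemma smooth_on_imp_continuous_on: "smooth_on U f \<Longrightarrow> continuous_on U f"
  using smooth_on_def[of U f] Ck_on.simps(1)[of U f] by metis

lemma smooth_on_const [smooth_intros]: "smooth_on U (\<lambda>x. c)"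
  by (simp add: smooth_on_def)

lemma smooth_on_id [smooth_intros]: "open U \<Longrightarrow> smooth_on U (\<lambda>x. x)"
  by (simp add: smooth_on_def Ck_on_id)

lemma smooth_on_add [smooth_intros]:
  "open U \<Longrightarrow> smooth_on U f \<Longrightarrow> smooth_on U g \<Longrightarrow> smooth_on U (\<lambda>x. f x + g x)"
  by (simp add: smooth_on_def Ck_on_add)

lemma smooth_on_sum [smooth_intros]:
  "open U \<Longrightarrow> (\<And>i. i \<in> I \<Longrightarrow> smooth_on U (f i)) \<Longrightarrow> smooth_on U (\<lambda>x. \<Sum>i\<in>I. f i x)"
  by (simp add: smooth_on_def Ck_on_sum)

lemma smooth_on_bounded_linear:
  "open U \<Longrightarrow> bounded_linear L \<Longrightarrow> smooth_on U f \<Longrightarrow> smooth_on U (\<lambda>x. L (f x))"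
  by (simp add: smooth_on_def Ck_on_bounded_linear)

lemma smooth_on_bilinear:
  "open U \<Longrightarrow> bounded_bilinear B \<Longrightarrow> smooth_on U f \<Longrightarrow> smooth_on U g \<Longrightarrow> smooth_on U (\<lambda>x. B (f x) (g x))"
  by (simp add: smooth_on_def Ck_on_bilinear)

lemma smooth_on_Pair [smooth_intros]:
  "open U \<Longrightarrow> smooth_on U f \<Longrightarrow> smooth_on U g \<Longrightarrow> smooth_on U (\<lambda>x. (f x, g x))"
  by (simp add: smooth_on_def Ck_on_Pair)

lemma smooth_on_compose:
  "open U \<Longrightarrow> open V \<Longrightarrow> smooth_on V g \<Longrightarrow> smooth_on U f \<Longrightarrow> f ` U \<subseteq> V \<Longrightarrow> smooth_on U (\<lambda>x. g (f x))"
  by (simp add: smooth_on_def Ck_on_compose)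

lemma smooth_on_holomorphic: "open U \<Longrightarrow> h holomorphic_on U \<Longrightarrow> smooth_on U h"
  by (simp add: smooth_on_def Ck_on_holomorphic)

lemma smooth_on_inverse [smooth_intros]:
  fixes f :: "'e::euclidean_space \<Rightarrow> 'a::{euclidean_space, real_normed_field}"
  assumes "open U" "smooth_on U f" "\<And>x. x \<in> U \<Longrightarrow> f x \<noteq> 0"
  shows "smooth_on U (\<lambda>x. inverse (f x))"
  using assms by (intro smooth_on_compose[of U "- {0}" inverse])
    (auto simp: smooth_on_def intro: Ck_on_inverse)

lemmas smooth_on_scaleR [smooth_intros] = smooth_on_bilinear[OF _ bounded_bilinear_scaleR]
lemmas smooth_on_mult [smooth_intros] = smooth_on_bilinear[OF _ bounded_bilinear_mult]
lemmas smooth_on_inner [smooth_intros] = smooth_on_bilinear[OF _ bounded_bilinear_inner]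
lemmas smooth_on_minus [smooth_intros] = smooth_on_bounded_linear[OF _ bounded_linear_minus[OF bounded_linear_ident]]
lemmas smooth_on_fst [smooth_intros] = smooth_on_bounded_linear[OF _ bounded_linear_fst]
lemmas smooth_on_snd [smooth_intros] = smooth_on_bounded_linear[OF _ bounded_linear_snd]
lemmas smooth_on_Re [smooth_intros] = smooth_on_bounded_linear[OF _ bounded_linear_Re]
lemmas smooth_on_Im [smooth_intros] = smooth_on_bounded_linear[OF _ bounded_linear_Im]
lemmas smooth_on_cnj [smooth_intros] = smooth_on_bounded_linear[OF _ bounded_linear_cnj]
lemmas smooth_on_of_real [smooth_intros] = smooth_on_bounded_linear[OF _ bounded_linear_of_real]

lemma smooth_on_divide [smooth_intros]:
  fixes f g :: "'e::euclidean_space \<Rightarrow> 'a::{euclidean_space, real_normed_field}"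
  shows "open U \<Longrightarrow> smooth_on U f \<Longrightarrow> smooth_on U g \<Longrightarrow> (\<And>x. x \<in> U \<Longrightarrow> g x \<noteq> 0) \<Longrightarrow> smooth_on U (\<lambda>x. f x / g x)"
  unfolding divide_inverse by (intro smooth_on_mult smooth_on_inverse)

lemma smooth_on_norm_sq [smooth_intros]:
  "open U \<Longrightarrow> smooth_on U f \<Longrightarrow> smooth_on U (\<lambda>x. (norm (f x))\<^sup>2)"
  unfolding power2_norm_eq_inner by (intro smooth_on_inner)

section \<open>Local inverses and hermitian algebra\<close>

lemma linear_complex_eq:
  fixes L :: "complex \<Rightarrow> 'f::real_vector"
  assumes "linear L"
  shows "L v = Re v *\<^sub>R L 1 + Im v *\<^sub>R L \<i>"
proof -
  have "L v = L (Re v *\<^sub>R 1 + Im v *\<^sub>R \<i>)"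
    by (rule arg_cong[of _ _ L]) (simp add: complex_eq_iff)
  then show ?thesis by (simp only: linear_add[OF assms] linear_cmul[OF assms])
qed

lemma tendsto_difference_quotient:
  fixes f :: "'e::real_normed_vector \<Rightarrow> 'f::real_normed_vector"
  assumes "(f has_derivative D) (at x)"
  shows "((\<lambda>t. (f (x + t *\<^sub>R h) - f x) /\<^sub>R t) \<longlongrightarrow> D h) (at 0)"
proof -
  interpret D: bounded_linear D using assms by (rule has_derivative_bounded_linear)
  have "((\<lambda>t::real. x + t *\<^sub>R h) has_derivative (\<lambda>t. t *\<^sub>R h)) (at 0)"
    by (auto intro!: derivative_eq_intros)
  moreover have "(f has_derivative D) (at (x + 0 *\<^sub>R h))" using assms by simp
  ultimately have "((\<lambda>t. f (x + t *\<^sub>R h)) has_derivative (\<lambda>t. D (t *\<^sub>R h))) (at 0)"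
    by (rule has_derivative_compose)
  then have "((\<lambda>t. norm (f (x + (0 + t) *\<^sub>R h) - f (x + 0 *\<^sub>R h) - D (t *\<^sub>R h)) / norm t) \<longlongrightarrow> 0) (at 0)"
    unfolding has_derivative_at by blast
  then have *: "((\<lambda>t. norm (f (x + t *\<^sub>R h) - f x - t *\<^sub>R D h) / norm t) \<longlongrightarrow> 0) (at 0)"
    by (simp add: D.scaleR)
  have "((\<lambda>t. norm ((f (x + t *\<^sub>R h) - f x) /\<^sub>R t - D h)) \<longlongrightarrow> 0) (at 0)"
  proof (rule Lim_transform_eventually[OF *])
    have "norm ((f (x + t *\<^sub>R h) - f x) /\<^sub>R t - D h) = norm (f (x + t *\<^sub>R h) - f x - t *\<^sub>R D h) / norm t"
      if "t \<noteq> 0" for t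
    proof -
      have "(f (x + t *\<^sub>R h) - f x) /\<^sub>R t - D h = (f (x + t *\<^sub>R h) - f x - t *\<^sub>R D h) /\<^sub>R t"
        using that by (simp add: algebra_simps)
      then show ?thesis by (simp add: divide_inverse mult.commute)
    qed
    then show "\<forall>\<^sub>F t in at 0. norm (f (x + t *\<^sub>R h) - f x - t *\<^sub>R D h) / norm t = norm ((f (x + t *\<^sub>R h) - f x) /\<^sub>R t - D h)"
      by (auto simp: eventually_at_filter)
  qed
  then show ?thesis
    by (rule Lim_null[THEN iffD2, OF tendsto_norm_zero_cancel])
qed

text \<open>The inverse function theorem for a derivative given as a plain function: in finite
  dimension, continuity in each fixed direction gives continuity in operator norm, and an injective
  linear endomorphism has a left inverse. The last conclusion keeps exactly what is needed to solve
  for \<open>g'\<close>.\<close>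

lemma inverse_function_theorem_pointwise:
  fixes f :: "'a::euclidean_space \<Rightarrow> 'a"
  assumes "open U" "\<And>x. x \<in> U \<Longrightarrow> (f has_derivative f' x) (at x)"
    and "\<And>v. continuous_on U (\<lambda>x. f' x v)" "x0 \<in> U" "\<And>v. f' x0 v = 0 \<Longrightarrow> v = 0"
  obtains U' V g g' where "open U'" "U' \<subseteq> U" "x0 \<in> U'" "open V" "f x0 \<in> V" "homeomorphism U' V f g"
    "\<And>y. y \<in> V \<Longrightarrow> (g has_derivative g' y) (at y)"
    "\<And>y v. y \<in> V \<Longrightarrow> f' (g y) (g' y v) = v"
proof -
  define F where "F x = Blinfun (f' x)" for x
  have F: "blinfun_apply (F x) = f' x" if "x \<in> U" for x
    unfolding F_def using assms(2)[OF that] has_derivative_bounded_linear bounded_linear_Blinfun_apply by blast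
  have lin: "linear (f' x0)" using assms(2)[OF assms(4)] has_derivative_linear by blast
  then have "inj (f' x0)"
    using assms(5) by (metis linear_injective_0)
  then obtain G where G: "linear G" "G \<circ> f' x0 = id"
    using linear_injective_left_inverse[OF lin] by auto
  have G1: "Blinfun G o\<^sub>L F x0 = id_blinfun"
    using G by (intro blinfun_eqI)
      (simp add: F[OF assms(4)] bounded_linear_Blinfun_apply linear_conv_bounded_linear[symmetric] pointfree_idE)
  have c: "continuous_on U F"
    by (rule continuous_on_blinfun_componentwise)
      (use assms(3) F in \<open>simp cong: continuous_on_cong\<close>)
  obtain U' V g g' where *: "open U'" "U' \<subseteq> U" "x0 \<in> U'" "open V" "f x0 \<in> V" "homeomorphism U' V f g"
    "\<And>y. y \<in> V \<Longrightarrow> (g has_derivative g' y) (at y)"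
    "\<And>y. y \<in> V \<Longrightarrow> g' y = inv (blinfun_apply (F (g y)))"
    "\<And>y. y \<in> V \<Longrightarrow> bij (blinfun_apply (F (g y)))"
    using inverse_function_theorem[OF assms(1) _ c assms(4) G1, of f] F assms(2) by metis
  have gU: "g y \<in> U" if "y \<in> V" for y using *(2,6) that unfolding homeomorphism_def by blast
  show thesis
  proof (rule that[OF *(1-7)])
    fix y v assume y: "y \<in> V"
    show "f' (g y) (g' y v) = v"
      using *(8,9)[OF y] F[OF gU[OF y]] by (simp add: bij_is_surj surj_f_inv_f)
  qed
qed

text \<open>Bootstrapping: by Cramer's rule the derivative of \<open>g\<close> at \<open>y\<close>
  is \<open>F v (g y)\<close> with \<open>F v\<close> smooth, so \<open>g\<close> of class C^n makes
  its derivative of class C^n.\<close>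

lemma smooth_on_local_inverse:
  fixes f :: "complex \<Rightarrow> complex"
  assumes "open U" "open V" "smooth_on U f" and hom: "homeomorphism U V f g"
    and der: "\<And>y. y \<in> V \<Longrightarrow> (g has_derivative g' y) (at y)"
    and inv: "\<And>y v. y \<in> V \<Longrightarrow> frechet_derivative f (at (g y)) (g' y v) = v"
  shows "smooth_on V g"
proof -
  define p where "p z = frechet_derivative f (at z) 1" for z
  define q where "q z = frechet_derivative f (at z) \<i>" for z
  \<comment> \<open>The Jacobian determinant of \<open>f\<close>, since Im (cnj p q) is the
    determinant of the pair (p, q) of plane vectors; \<open>F\<close> is Cramer's solution of v = s
    p + t q.\<close>
  define \<Delta> where "\<Delta> z = Im (cnj (p z) * q z)" for z
  define F where "F v z = complex_of_real (- Im (cnj (q z) * v) / \<Delta> z) + complex_of_real (Im (cnj (p z) * v) / \<Delta> z) * \<i>" for v z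
  have gV: "g ` V = U" and contg: "continuous_on V g"
    using hom by (auto simp: homeomorphism_def)
  have eq: "v = Re (g' y v) *\<^sub>R p (g y) + Im (g' y v) *\<^sub>R q (g y)" if "y \<in> V" for y v
  proof -
    have "linear (frechet_derivative f (at (g y)))"
      using smooth_on_has_derivative[OF assms(3)] gV that has_derivative_linear by blast
    then show ?thesis using inv[OF that, of v] linear_complex_eq unfolding p_def q_def by metis
  qed
  have t: "Im (cnj (p (g y)) * v) = Im (g' y v) * \<Delta> (g y)" if "y \<in> V" for y v
    by (subst eq[OF that, of v]) (simp add: \<Delta>_def algebra_simps)
  have s: "Im (cnj (q (g y)) * v) = - Re (g' y v) * \<Delta> (g y)" if "y \<in> V" for y v
    by (subst eq[OF that, of v]) (simp add: \<Delta>_def algebra_simps)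
  \<comment> \<open>If the determinant vanished, \<open>t\<close> and \<open>s\<close> for v = 1 and
    v = \<i> would force p = q = 0, and then 1 could not be a combination of them.\<close>
  have nz: "\<Delta> z \<noteq> 0" if z: "z \<in> U" for z
  proof
    assume 0: "\<Delta> z = 0"
    obtain y where y: "y \<in> V" "z = g y" using gV z by blast
    have "p z = 0" "q z = 0"
      using t[OF y(1), of 1] t[OF y(1), of \<i>] s[OF y(1), of 1] s[OF y(1), of \<i>] 0
      unfolding y(2) by (auto intro!: complex_eqI)
    then show False using eq[OF y(1), of 1] y(2) by simp
  qed
  have g'F: "g' y v = F v (g y)" if "y \<in> V" for y v
    using t[OF that, of v] s[OF that, of v] nz[of "g y"] gV that unfolding F_def
    by (auto simp: complex_eq_iff)
  have pq: "smooth_on U p" "smooth_on U q"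
    unfolding p_def q_def using assms(3) by (auto intro: smooth_on_frechet_derivative)
  then have d: "smooth_on U \<Delta>"
    unfolding \<Delta>_def by (intro smooth_intros assms(1))
  have F: "smooth_on U (F v)" for v
    unfolding F_def using nz by (intro smooth_intros assms(1) pq d) auto
  have "Ck_on n V g" for n
  proof (induction n)
    case (Suc n)
    have "Ck_on n V (\<lambda>y. F v (g y))" for v
      using F[of v] gV by (intro Ck_on_compose[OF assms(2,1) _ Suc, of "F v"]) (simp_all add: smooth_on_def)
    moreover have "(g has_derivative (\<lambda>v. F v (g y))) (at y)" if "y \<in> V" for y
    proof -
      have "g' y = (\<lambda>v. F v (g y))" using g'F[OF that] by auto
      then show ?thesis using der[OF that] by simp
    qed
    ultimately show ?case by (intro Ck_on_Suc_I[OF assms(2), where f'="\<lambda>y v. F v (g y)"])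
  qed (simp add: contg)
  then show ?thesis by (simp add: smooth_on_def)
qed

context hermitian_plane
begin

section \<open>Complex scalars and the Hermitian form\<close>

lemma sc_add_right: "sc a (x + y) = sc a x + sc a y"
  and sc_add_left: "sc (a + b) x = sc a x + sc b x"
  and sc_sc: "sc a (sc b x) = sc (a * b) x"
  and sc_1: "sc 1 x = x"
  using vector_space.vector_space_assms[OF vector_space] by auto

lemma sc_0_left: "sc 0 x = 0" using sc_add_left[of 0 0 x] by simp
lemma sc_0_right: "sc a 0 = 0" using sc_add_right[of a 0 0] by simp
lemma sc_minus_right: "sc a (- x) = - sc a x"
  by (rule minus_unique[symmetric]) (simp add: sc_add_right[symmetric] sc_0_right)
lemma sc_minus_left: "sc (- a) x = - sc a x"
  by (rule minus_unique[symmetric]) (simp add: sc_add_left[symmetric] sc_0_left)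
lemma sc_diff_right: "sc a (x - y) = sc a x - sc a y"
  using sc_add_right[of a x "- y"] by (simp add: sc_minus_right)
lemma sc_diff_left: "sc (a - b) x = sc a x - sc b x"
  using sc_add_left[of a "- b" x] by (simp add: sc_minus_left)
lemma sc_scaleR_right: "sc a (r *\<^sub>R x) = r *\<^sub>R sc a x"
  by (simp add: sc_of_real[symmetric] sc_sc mult.commute)
lemma sc_scaleR_left: "sc (r *\<^sub>R a) x = r *\<^sub>R sc a x"
  by (simp add: sc_of_real[symmetric] sc_sc scaleR_conv_of_real)

lemma herm_add_right: "herm x (y + z) = herm x y + herm x z"
  by (metis herm_add herm_cnj complex_cnj_add)
lemma herm_sc_right: "herm x (sc a y) = cnj a * herm x y"
  by (metis herm_sc herm_cnj complex_cnj_mult)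
lemma herm_scaleR_left: "herm (r *\<^sub>R x) y = of_real r * herm x y"
  by (simp add: sc_of_real[symmetric] herm_sc)
lemma herm_scaleR_right: "herm x (r *\<^sub>R y) = of_real r * herm x y"
  by (simp add: sc_of_real[symmetric] herm_sc_right)
lemma herm_minus_left: "herm (- x) y = - herm x y"
  using herm_scaleR_left[of "-1"] by simp
lemma herm_minus_right: "herm x (- y) = - herm x y"
  using herm_scaleR_right[of _ "-1"] by simp
lemma herm_diff: "herm (x - y) z = herm x z - herm y z"
  using herm_add[of x "- y" z] by (simp add: herm_minus_left)

lemma herm_0_left: "herm 0 y = 0" using herm_scaleR_left[of 0 0 y] by simp

lemma norm_sc: "norm (sc a x) = norm a * norm x"
proof -
  have "complex_of_real ((norm (sc a x))\<^sup>2) = a * cnj a * complex_of_real ((norm x)\<^sup>2)"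
    by (simp only: herm_norm[symmetric] herm_sc herm_sc_right) simp
  also have "\<dots> = complex_of_real ((norm a * norm x)\<^sup>2)"
    by (simp add: complex_norm_square[symmetric] power_mult_distrib)
  finally have "(norm (sc a x))\<^sup>2 = (norm a * norm x)\<^sup>2" by (simp only: of_real_eq_iff)
  then show ?thesis by (rule power2_eq_imp_eq) simp_all
qed

lemma bounded_bilinear_sc: "bounded_bilinear sc"
proof
  show "\<exists>K. \<forall>a b. norm (sc a b) \<le> norm a * norm b * K"
    by (rule exI[of _ 1]) (simp add: norm_sc)
qed (simp_all only: sc_add_left sc_add_right sc_scaleR_left sc_scaleR_right)

lemma bounded_bilinear_herm: "bounded_bilinear herm"
  unfolding bilinear_conv_bounded_bilinear[symmetric] bilinear_def
  by (auto intro!: linearI simp: herm_add herm_add_right herm_scaleR_left herm_scaleR_right scaleR_conv_of_real)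

lemma inner_eq_Re_herm: "x \<bullet> y = Re (herm x y)"
proof -
  have "herm (x + y) (x + y) = of_real ((norm x)\<^sup>2) + of_real ((norm y)\<^sup>2) + herm x y + cnj (herm x y)"
    by (simp only: herm_add herm_add_right herm_norm[of x] herm_norm[of y] herm_cnj[of y x]) simp
  then have "complex_of_real ((norm (x + y))\<^sup>2) = of_real ((norm x)\<^sup>2) + of_real ((norm y)\<^sup>2) + herm x y + cnj (herm x y)"
    by (simp only: herm_norm)
  then have "(norm (x + y))\<^sup>2 = (norm x)\<^sup>2 + (norm y)\<^sup>2 + 2 * Re (herm x y)"
    by (simp add: complex_eq_iff)
  moreover have "(norm (x + y))\<^sup>2 = (norm x)\<^sup>2 + (norm y)\<^sup>2 + 2 * (x \<bullet> y)"
    by (simp add: power2_norm_eq_inner algebra_simps inner_commute)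
  ultimately show ?thesis by simp
qed

lemma sc_eq_0_iff: "sc a x = 0 \<longleftrightarrow> a = 0 \<or> x = 0"
  using norm_sc[of a x] by (metis mult_eq_0_iff norm_eq_zero)

lemma herm_self_eq: "herm x x = of_real (x \<bullet> x)"
  by (simp add: herm_norm power2_norm_eq_inner)

lemmas smooth_on_sc = smooth_on_bilinear[OF _ bounded_bilinear_sc]
lemmas smooth_on_herm = smooth_on_bilinear[OF _ bounded_bilinear_herm]

text \<open>The derivative at \<open>u\<close> of the inversion is, up to a positive factor, the reflection in the
  hyperplane orthogonal to \<open>u\<close>. In the limit along a curve with velocity \<open>a = D 1\<close> the reflection
  maps the image of \<open>D\<close> to itself and reverses its orientation; hence that image is a complex line
  with the opposite orientation.\<close>

lemma antilinear_at_zero: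
  fixes u :: "complex \<Rightarrow> 'v"
  assumes "open U" "x0 \<in> U" "smooth_on U u" "u x0 = 0"
    and inj: "\<And>v. frechet_derivative u (at x0) v = 0 \<Longrightarrow> v = 0"
    and hol: "\<And>x. x \<in> U \<Longrightarrow> u x \<noteq> 0 \<Longrightarrow>
      \<exists>D \<omega>. ((\<lambda>x. u x /\<^sub>R (norm (u x))\<^sup>2) has_derivative D) (at x) \<and> 0 < Im \<omega> \<and> D \<i> = sc \<omega> (D 1)"
  obtains \<beta> where "Im \<beta> < 0"
    "frechet_derivative u (at x0) \<i> = sc \<beta> (frechet_derivative u (at x0) 1)"
proof -
  define Du where "Du x = frechet_derivative u (at x)" for x
  define R where "R q v = v - (2 * (q \<bullet> v) / (q \<bullet> q)) *\<^sub>R q" for q v :: 'v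
  have du: "(u has_derivative Du x) (at x)" if "x \<in> U" for x
    unfolding Du_def using smooth_on_has_derivative[OF assms(3) that] .
  \<comment> \<open>Nothing is known about how \<open>\<omega>\<close> depends on \<open>x\<close>.
    Pairing with \<open>R (u x) (Du x 1)\<close> eliminates it and leaves division-free relations
    that pass to the limit; the strict sign of Im \<open>\<omega>\<close> survives as a weak
    inequality.\<close>
  have key: "(R (u x) (Du x 1) \<bullet> R (u x) (Du x 1)) *\<^sub>R R (u x) (Du x \<i>)
        = sc (herm (R (u x) (Du x \<i>)) (R (u x) (Du x 1))) (R (u x) (Du x 1))
      \<and> 0 \<le> Im (herm (R (u x) (Du x \<i>)) (R (u x) (Du x 1)))" if x: "x \<in> U" "u x \<noteq> 0" for x
  proof -
    obtain D \<omega> where D: "((\<lambda>x. u x /\<^sub>R (norm (u x))\<^sup>2) has_derivative D) (at x)" "0 < Im \<omega>" "D \<i> = sc \<omega> (D 1)"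
      using hol[OF x] by blast
    have n: "u x \<bullet> u x \<noteq> 0" using x(2) by simp
    have "((\<lambda>x. inverse (u x \<bullet> u x) *\<^sub>R u x) has_derivative
       (\<lambda>v. inverse (u x \<bullet> u x) *\<^sub>R Du x v + (- (inverse (u x \<bullet> u x) * (u x \<bullet> Du x v + Du x v \<bullet> u x) * inverse (u x \<bullet> u x))) *\<^sub>R u x)) (at x)"
      using n by (intro has_derivative_scaleR Deriv.has_derivative_inverse has_derivative_inner du x(1))
    then have "D = (\<lambda>v. inverse (u x \<bullet> u x) *\<^sub>R Du x v + (- (inverse (u x \<bullet> u x) * (u x \<bullet> Du x v + Du x v \<bullet> u x) * inverse (u x \<bullet> u x))) *\<^sub>R u x)"
      using has_derivative_unique D(1) unfolding power2_norm_eq_inner by blast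
    \<comment> \<open>The derivative of the inversion at \<open>u x\<close> is the reflection
      \<open>R (u x)\<close> divided by |u x|^2.\<close>
    then have R: "R (u x) (Du x v) = (u x \<bullet> u x) *\<^sub>R D v" for v
      using n by (simp add: R_def scaleR_diff_right inner_commute[of "Du x v"] divide_inverse)
    have Ri: "R (u x) (Du x \<i>) = sc \<omega> (R (u x) (Du x 1))"
      unfolding R D(3) by (simp add: sc_scaleR_right)
    show ?thesis
      unfolding Ri herm_sc herm_self_eq using D(2)
      by (simp add: sc_of_real[symmetric] sc_sc mult.commute)
  qed
  define a where "a = Du x0 1"
  define b where "b = Du x0 \<i>"
  have a0: "a \<noteq> 0" using inj[of 1] by (auto simp: a_def Du_def)
  \<comment> \<open>The vector \<open>u (c t)\<close> tends to 0, where \<open>R\<close> has no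
    limit. But \<open>R\<close> is homogeneous of degree 0 in its first argument, so it may be
    evaluated at the difference quotient \<open>q t\<close>, which tends to \<open>a\<close>, and
    \<open>a\<close> is nonzero.\<close>
  define c where "c t = x0 + complex_of_real t" for t
  define q where "q t = u (c t) /\<^sub>R t" for t
  have q: "(q \<longlongrightarrow> a) (at_right 0)"
    using tendsto_difference_quotient[OF du[OF assms(2)], of 1] assms(4)
    unfolding q_def c_def a_def
    by (intro tendsto_mono[OF at_le[of "{0<..}" UNIV]]) (auto simp: scaleR_conv_of_real)
  have c: "(c \<longlongrightarrow> x0) (at_right 0)"
    unfolding c_def by (auto intro!: tendsto_eq_intros)
  have Du: "((\<lambda>t. Du (c t) v) \<longlongrightarrow> Du x0 v) (at_right 0)" for v
  proof -
    have "continuous_on U (\<lambda>x. Du x v)"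
      unfolding Du_def using assms(3) by (intro smooth_on_imp_continuous_on smooth_on_frechet_derivative)
    then have "isCont (\<lambda>x. Du x v) x0" using assms(1,2) by (simp add: continuous_on_eq_continuous_at)
    then show ?thesis using c isCont_tendsto_compose by blast
  qed
  have Rq: "((\<lambda>t. R (q t) (Du (c t) v)) \<longlongrightarrow> R a (Du x0 v)) (at_right 0)" for v
    unfolding R_def using a0 by (intro tendsto_intros q Du) auto
  have ev: "\<forall>\<^sub>F t in at_right 0. c t \<in> U \<and> u (c t) \<noteq> 0 \<and> t > 0"
  proof -
    have "\<forall>\<^sub>F t in at_right 0. q t \<noteq> 0" using tendsto_imp_eventually_ne[OF q a0] .
    moreover have "\<forall>\<^sub>F t in at_right 0. c t \<in> U" using topological_tendstoD[OF c assms(1,2)] .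
    moreover have "\<forall>\<^sub>F t in at_right 0. (0::real) < t" by (simp add: eventually_at_filter)
    ultimately show ?thesis by eventually_elim (auto simp: q_def)
  qed
  have Rscale: "R (u (c t)) v = R (q t) v" if "t > 0" for t v
    using that unfolding R_def q_def by (simp add: field_simps)
  have key': "(R (q t) (Du (c t) 1) \<bullet> R (q t) (Du (c t) 1)) *\<^sub>R R (q t) (Du (c t) \<i>)
        = sc (herm (R (q t) (Du (c t) \<i>)) (R (q t) (Du (c t) 1))) (R (q t) (Du (c t) 1))"
      "0 \<le> Im (herm (R (q t) (Du (c t) \<i>)) (R (q t) (Du (c t) 1)))"
    if "c t \<in> U \<and> u (c t) \<noteq> 0 \<and> t > 0" for t
    using key[of "c t"] that by (simp_all add: Rscale)
  note ev' = eventually_mono[OF ev key'(1)] eventually_mono[OF ev key'(2)]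
  note sc_lim = bounded_bilinear.tendsto[OF bounded_bilinear_sc]
    and herm_lim = bounded_bilinear.tendsto[OF bounded_bilinear_herm]
  have l1: "((\<lambda>t. (R (q t) (Du (c t) 1) \<bullet> R (q t) (Du (c t) 1)) *\<^sub>R R (q t) (Du (c t) \<i>)) \<longlongrightarrow>
    (R a a \<bullet> R a a) *\<^sub>R R a b) (at_right 0)"
    unfolding a_def b_def by (intro tendsto_intros Rq[unfolded a_def])
  have l2: "((\<lambda>t. sc (herm (R (q t) (Du (c t) \<i>)) (R (q t) (Du (c t) 1))) (R (q t) (Du (c t) 1))) \<longlongrightarrow>
     sc (herm (R a b) (R a a)) (R a a)) (at_right 0)"
    unfolding a_def b_def by (intro sc_lim herm_lim Rq[unfolded a_def])
  have E1: "(R a a \<bullet> R a a) *\<^sub>R R a b = sc (herm (R a b) (R a a)) (R a a)"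
    using tendsto_unique[OF _ Lim_transform_eventually[OF l1 ev'(1)] l2] by simp
  have E2: "0 \<le> Im (herm (R a b) (R a a))"
  proof (rule tendsto_lowerbound[OF _ ev'(2)])
    show "((\<lambda>t. Im (herm (R (q t) (Du (c t) \<i>)) (R (q t) (Du (c t) 1)))) \<longlongrightarrow> Im (herm (R a b) (R a a))) (at_right 0)"
      unfolding a_def b_def by (intro tendsto_Im herm_lim Rq[unfolded a_def])
  qed (auto simp: trivial_limit_at_right_real)
  \<comment> \<open>A reflection sends its own normal to the negative. This sign is what reverses
    the orientation.\<close>
  have Raa: "R a a = - a" using a0 by (simp add: R_def scaleR_2)
  define \<gamma> where "\<gamma> = (herm (R a b) a) / of_real (a \<bullet> a)"
  have aa: "a \<bullet> a \<noteq> 0" using a0 by simp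
  have "R a b = inverse (a \<bullet> a) *\<^sub>R ((a \<bullet> a) *\<^sub>R R a b)"
    by (simp only: scaleR_scaleR left_inverse[OF aa] scaleR_one)
  also have "(a \<bullet> a) *\<^sub>R R a b = sc (herm (R a b) a) a"
    using E1 unfolding Raa herm_minus_right sc_minus_left sc_minus_right inner_minus_left
      inner_minus_right minus_minus .
  also have "inverse (a \<bullet> a) *\<^sub>R sc (herm (R a b) a) a = sc \<gamma> a"
    unfolding \<gamma>_def by (simp only: sc_scaleR_left[symmetric] scaleR_conv_of_real divide_inverse of_real_inverse mult.commute)
  finally have "R a b = sc \<gamma> a" .
  \<comment> \<open>Undoing the reflection changes \<open>R a b\<close> only by a real multiple of
    \<open>a\<close>, so \<open>b\<close> lies in the complex line of \<open>a\<close>, and the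
    imaginary part of the factor is unchanged.\<close>
  moreover define r where "r = 2 * (a \<bullet> b) / (a \<bullet> a)"
  ultimately have "b - r *\<^sub>R a = sc \<gamma> a" by (simp add: R_def)
  then have "b = sc \<gamma> a + r *\<^sub>R a" by (simp add: diff_eq_eq)
  moreover define \<beta> where "\<beta> = \<gamma> + of_real r"
  ultimately have \<beta>: "b = sc \<beta> a" by (simp add: sc_add_left sc_of_real)
  have "a \<bullet> b = Re (herm b a)" using inner_commute inner_eq_Re_herm by metis
  also have "\<dots> = Re \<beta> * (a \<bullet> a)" unfolding \<beta> herm_sc herm_self_eq by simp
  finally have r: "r = 2 * Re \<beta>" using aa by (simp add: r_def)
  have "R a b = b - r *\<^sub>R a" by (simp only: R_def r_def)
  also have "\<dots> = sc (\<beta> - of_real r) a" by (simp only: \<beta> sc_diff_left sc_of_real)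
  finally have "herm (R a b) (R a a) = - (\<beta> - of_real r) * of_real (a \<bullet> a)"
    unfolding Raa by (simp only: herm_sc herm_minus_right herm_self_eq) (simp add: left_diff_distrib)
  then have "Im (herm (R a b) (R a a)) = - Im \<beta> * (a \<bullet> a)" by simp
  then have "Im \<beta> * (a \<bullet> a) \<le> 0" using E2 by linarith
  moreover have "a \<bullet> a > 0" using a0 by simp
  ultimately have "Im \<beta> \<le> 0" by (simp add: mult_le_0_iff)
  \<comment> \<open>The limit gave only a weak inequality. Equality would make \<open>b\<close> a
    real multiple of \<open>a\<close>, against the injectivity of the derivative at
    \<open>x0\<close>.\<close>
  moreover have "Im \<beta> \<noteq> 0"
  proof
    assume "Im \<beta> = 0"
    then have "sc \<beta> a = sc (of_real (Re \<beta>)) a"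
      by (intro arg_cong[of _ _ "\<lambda>z. sc z a"]) (simp add: complex_eq_iff)
    then have "b = Re \<beta> *\<^sub>R a" by (simp only: \<beta> sc_of_real)
    then have dep: "b - Re \<beta> *\<^sub>R a = 0" by (simp only: diff_self)
    have "linear (Du x0)" using du[OF assms(2)] has_derivative_linear by blast
    then have "Du x0 (\<i> - of_real (Re \<beta>)) = b - Re \<beta> *\<^sub>R a"
      by (subst linear_complex_eq) (simp_all add: a_def b_def)
    then have "frechet_derivative u (at x0) (\<i> - of_real (Re \<beta>)) = 0"
      unfolding dep Du_def .
    then have "\<i> - of_real (Re \<beta>) = 0" by (rule inj)
    then have "Im (\<i> - of_real (Re \<beta>)) = Im 0" by (rule arg_cong)
    then show False by simp
  qed
  ultimately have "Im \<beta> < 0" by linarith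
  then show thesis using \<beta> unfolding a_def b_def Du_def by (rule that)
qed

end

section \<open>Local lifts at a pole\<close>

context hermitian_plane
begin

lemma bounded_linear_herm_left: "bounded_linear (\<lambda>x. herm x k)"
  by (rule bounded_bilinear.bounded_linear_left[OF bounded_bilinear_herm])

lemma bounded_linear_sc_left: "bounded_linear (\<lambda>a. sc a k)"
  by (rule bounded_bilinear.bounded_linear_left[OF bounded_bilinear_sc])

lemma herm_orthogonal_decomposition:
  assumes "norm e = 1"
  shows "herm (x - sc (herm x e) e) e = 0"
    and "(norm x)\<^sup>2 = (norm (herm x e))\<^sup>2 + (norm (x - sc (herm x e) e))\<^sup>2"
proof -
  have ee: "herm e e = 1" using assms by (simp add: herm_norm)
  show 1: "herm (x - sc (herm x e) e) e = 0"
    by (simp add: herm_diff herm_sc ee)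
  have "(x - sc (herm x e) e) \<bullet> sc (herm x e) e = 0"
    by (simp only: inner_eq_Re_herm herm_sc_right 1) simp
  then have "orthogonal (x - sc (herm x e) e) (sc (herm x e) e)" by (simp add: orthogonal_def)
  from norm_add_Pythagorean[OF this] have "(norm x)\<^sup>2 = (norm (x - sc (herm x e) e))\<^sup>2 + (norm (sc (herm x e) e))\<^sup>2"
    by simp
  then show "(norm x)\<^sup>2 = (norm (herm x e))\<^sup>2 + (norm (x - sc (herm x e) e))\<^sup>2"
    by (simp add: norm_sc assms)
qed

text \<open>Reduces vector-valued holomorphy to scalar functions: real coordinates of
  \<open>h\<close> are real parts of its Hermitian components, and the defect of complex linearity
  of the derivative vanishes when paired with itself.\<close>

lemma holomorphic_components:
  fixes h :: "complex \<Rightarrow> 'v"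
  assumes "open U" "\<And>k. (\<lambda>z. herm (h z) k) holomorphic_on U"
  shows "smooth_on U h"
    and "z \<in> U \<Longrightarrow> frechet_derivative h (at z) (c * v) = sc c (frechet_derivative h (at z) v)"
proof -
  have "h z = (\<Sum>k\<in>Basis. Re (herm (h z) k) *\<^sub>R k)" for z
    by (simp add: inner_eq_Re_herm[symmetric] euclidean_representation)
  moreover have "smooth_on U (\<lambda>z. \<Sum>k\<in>Basis. Re (herm (h z) k) *\<^sub>R k)"
    using assms by (intro smooth_intros smooth_on_holomorphic)
  ultimately show sm: "smooth_on U h" by simp
  assume z: "z \<in> U"
  define D where "D = frechet_derivative h (at z)"
  have hD: "(h has_derivative D) (at z)"
    unfolding D_def by (rule smooth_on_has_derivative[OF sm z])
  have comp: "herm (D v) k = deriv (\<lambda>z. herm (h z) k) z * v" for v k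
  proof -
    have "((\<lambda>z. herm (h z) k) has_derivative (\<lambda>v. herm (D v) k)) (at z)"
      by (rule bounded_linear.has_derivative[OF bounded_linear_herm_left hD])
    moreover have "((\<lambda>z. herm (h z) k) has_derivative (*) (deriv (\<lambda>z. herm (h z) k) z)) (at z)"
      using holomorphic_derivI[OF assms(2) assms(1) z] by (simp only: has_field_derivative_def)
    ultimately show ?thesis by (metis has_derivative_unique)
  qed
  have "herm (D (c * v) - sc c (D v)) k = 0" for k
    by (simp add: herm_diff herm_sc comp)
  from this[of "D (c * v) - sc c (D v)"] have "D (c * v) - sc c (D v) = 0"
    by (simp add: herm_self_eq)
  then show "frechet_derivative h (at z) (c * v) = sc c (frechet_derivative h (at z) v)"
    by (simp add: D_def)
qed

text \<open>Let \<open>a = Du 1\<close> at \<open>x0\<close>, and decompose \<open>u = u1 e + up\<close> along the unit vector \<open>e = a/|a|\<close>.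
  As \<open>u/|u|\<^sup>2\<close> is holomorphic, \<open>\<zeta> = |u|\<^sup>2/u1\<close> is a holomorphic function; it is a local coordinate
  that is at first only of class \<open>C\<^sup>1\<close>. The function \<open>h = up/u1\<close> depends holomorphically on \<open>\<zeta>\<close>
  (removable singularity), so that \<open>cnj u1 = \<zeta>/(1 + |h(\<zeta>)|\<^sup>2)\<close> is a smooth invertible function of
  \<open>\<zeta>\<close>. Hence \<open>\<zeta>\<close> is smooth, without recourse to elliptic regularity.\<close>

lemma lift_at_infinity:
  fixes u :: "complex \<Rightarrow> 'v"
  assumes "open U" "x0 \<in> U" and smu: "smooth_on U u" and "u x0 = 0"
    and inj: "\<And>v. frechet_derivative u (at x0) v = 0 \<Longrightarrow> v = 0"
    and hol: "\<And>x. x \<in> U \<Longrightarrow> u x \<noteq> 0 \<Longrightarrow>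
      \<exists>D \<omega>. ((\<lambda>x. u x /\<^sub>R (norm (u x))\<^sup>2) has_derivative D) (at x) \<and> 0 < Im \<omega> \<and> D \<i> = sc \<omega> (D 1)"
  obtains N w Dw \<omega> where "open N" "x0 \<in> N" "N \<subseteq> U" "smooth_on N w"
    "\<And>x. x \<in> N \<Longrightarrow> x \<noteq> x0 \<Longrightarrow> u x \<noteq> 0 \<and> snd (w x) \<noteq> 0 \<and> w x = sc_prod sc (snd (w x)) (u x /\<^sub>R (norm (u x))\<^sup>2, 1)"
    "snd (w x0) = 0" "norm (fst (w x0)) = 1"
    "(w has_derivative Dw) (at x0)" "0 < Im \<omega>" "Dw \<i> = sc_prod sc \<omega> (Dw 1)" "snd (Dw 1) \<noteq> 0"
proof -
  define Du where "Du x = frechet_derivative u (at x)" for x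
  have du: "(u has_derivative Du x) (at x)" if "x \<in> U" for x
    unfolding Du_def using smooth_on_has_derivative[OF smu that] .
  have Ducont: "continuous_on U (\<lambda>x. Du x v)" for v
    unfolding Du_def using smu by (rule smooth_on_imp_continuous_on[OF smooth_on_frechet_derivative])
  obtain \<beta> where \<beta>: "Im \<beta> < 0" "Du x0 \<i> = sc \<beta> (Du x0 1)"
    using antilinear_at_zero[OF assms] unfolding Du_def by metis
  define a where "a = Du x0 1"
  have a0: "a \<noteq> 0" using inj[of 1] by (auto simp: a_def Du_def)
  define e where "e = a /\<^sub>R norm a"
  have ne: "norm e = 1" using a0 by (simp add: e_def)
  have ee: "herm e e = 1" using ne by (simp add: herm_norm)
  have ae: "a = norm a *\<^sub>R e" using a0 by (simp add: e_def)
  define u1 where "u1 x = herm (u x) e" for x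
  define up where "up x = u x - sc (u1 x) e" for x
  define D1 where "D1 x v = herm (Du x v) e" for x v
  define Dp where "Dp x v = Du x v - sc (D1 x v) e" for x v
  have u1_0: "u1 x0 = 0" using assms(4) by (simp add: u1_def herm_0_left)
  have up_0: "up x0 = 0" using assms(4) by (simp add: up_def u1_0 sc_0_left)
  have d1: "(u1 has_derivative D1 x) (at x)" if "x \<in> U" for x
    unfolding u1_def D1_def by (rule bounded_linear.has_derivative[OF bounded_linear_herm_left du[OF that]])
  have dp: "(up has_derivative Dp x) (at x)" if "x \<in> U" for x
    unfolding up_def Dp_def
    by (intro has_derivative_diff du that bounded_linear.has_derivative[OF bounded_linear_sc_left] d1)
  have smu1: "smooth_on U u1" unfolding u1_def by (intro smooth_on_herm assms smooth_on_const)
  have norm_u: "(norm (u x))\<^sup>2 = (norm (u1 x))\<^sup>2 + (norm (up x))\<^sup>2" for x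
    unfolding u1_def up_def using herm_orthogonal_decomposition(2)[OF ne] .

  \<comment> \<open>The component of \<open>Du x0\<close> along \<open>e\<close>. It is a
    real-linear bijection because Im \<open>\<beta>\<close> is nonzero.\<close>
  define l where "l v = norm a * (complex_of_real (Re v) + complex_of_real (Im v) * \<beta>)" for v
  have Dux0: "Du x0 v = sc (l v) e" for v
  proof -
    have "linear (Du x0)" using du[OF assms(2)] has_derivative_linear by blast
    then have "Du x0 v = Re v *\<^sub>R a + Im v *\<^sub>R sc \<beta> a"
      using linear_complex_eq[of "Du x0" v] by (simp only: a_def \<beta>(2))
    also have "\<dots> = sc (complex_of_real (Re v) + complex_of_real (Im v) * \<beta>) a"
      by (simp only: sc_add_left sc_of_real sc_sc[symmetric])
    also have "\<dots> = sc (l v) e"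
      by (subst ae) (simp only: sc_of_real[symmetric] sc_sc l_def mult.commute)
    finally show ?thesis .
  qed
  have D1x0: "D1 x0 v = l v" for v by (simp add: D1_def Dux0 herm_sc ee)
  \<comment> \<open>The image of \<open>Du x0\<close> is the complex line of \<open>e\<close>, so
    the orthogonal part \<open>up\<close> is o(|x - x0|). All estimates at \<open>x0\<close> rest on
    this.\<close>
  have Dpx0: "Dp x0 v = 0" for v by (simp add: Dp_def D1x0) (simp add: Dux0)
  have l_inj: "v = 0" if "l v = 0" for v
  proof -
    from that have "complex_of_real (Re v) + complex_of_real (Im v) * \<beta> = 0" using a0 by (simp add: l_def)
    then show ?thesis using \<beta>(1) by (auto simp: complex_eq_iff)
  qed
  have "linear l" using d1[OF assms(2)] has_derivative_linear[of u1 "D1 x0"] D1x0 by (metis ext)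
  moreover have "inj l" using l_inj \<open>linear l\<close> by (metis linear_injective_0)
  ultimately obtain B where B: "B > 0" "\<And>v. B * norm v \<le> norm (l v)"
    using linear_inj_bounded_below_pos[of l] by blast

  \<comment> \<open>Half of the lower bound of \<open>l\<close> absorbs the error of the linear
    approximation; the other half remains as a lower bound for \<open>u1\<close>, which therefore
    vanishes only at \<open>x0\<close>.\<close>
  define c where "c = B / 2"
  have c: "c > 0" using B by (simp add: c_def)
  obtain d where d: "d > 0" "\<And>y. norm (y - x0) < d \<Longrightarrow> norm (u1 y - u1 x0 - D1 x0 (y - x0)) \<le> c * norm (y - x0)"
    using d1[OF assms(2)] c unfolding has_derivative_at_alt by metis
  obtain d' where d': "d' > 0" "ball x0 d' \<subseteq> U" using assms(1,2) open_contains_ball by blast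
  define N0 where "N0 = ball x0 (min d d')"
  have N0: "open N0" "x0 \<in> N0" "N0 \<subseteq> U" using d d' by (auto simp: N0_def)
  have u1_low: "c * norm (y - x0) \<le> norm (u1 y)" if "y \<in> N0" for y
  proof -
    have "norm (y - x0) < d" using that by (simp add: N0_def dist_norm norm_minus_commute)
    then have "norm (u1 y - l (y - x0)) \<le> c * norm (y - x0)" using d(2)[of y] by (simp add: u1_0 D1x0)
    moreover have "2 * c * norm (y - x0) \<le> norm (l (y - x0))" using B(2) by (simp add: c_def)
    moreover have "norm (l (y - x0)) \<le> norm (u1 y) + norm (u1 y - l (y - x0))"
      by (metis norm_minus_commute norm_triangle_sub)
    ultimately show ?thesis by linarith
  qed
  have u1_nz: "u1 y \<noteq> 0" if "y \<in> N0" "y \<noteq> x0" for y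
    using u1_low[OF that(1)] c that(2) by (auto simp: mult_le_0_iff)
  have up_small: "\<exists>d>0. \<forall>y. norm (y - x0) < d \<longrightarrow> norm (up y) \<le> \<epsilon> * norm (y - x0)" if "\<epsilon> > 0" for \<epsilon>
    using dp[OF assms(2)] that unfolding has_derivative_at_alt by (simp add: up_0 Dpx0)

  \<comment> \<open>Division by zero gives \<open>H x0 = 0\<close>, which is also the limit:
    \<open>up\<close> is o(|x - x0|), while |u1| is at least c |x - x0|.\<close>
  define H where "H x = sc (1 / u1 x) (up x)" for x
  have nH: "norm (H x) = norm (up x) / norm (u1 x)" for x by (simp add: H_def norm_sc norm_divide)
  have H0: "H x0 = 0" by (simp add: H_def up_0 sc_0_right)
  have H_lim: "isCont H x0"
    unfolding continuous_at_eps_delta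
  proof (intro allI impI)
    fix \<epsilon> :: real assume \<epsilon>: "\<epsilon> > 0"
    then have "\<epsilon> * c / 2 > 0" using c by simp
    then obtain d2 where d2: "d2 > 0" "\<And>y. norm (y - x0) < d2 \<Longrightarrow> norm (up y) \<le> \<epsilon> * c / 2 * norm (y - x0)"
      using up_small by blast
    obtain d3 where d3: "d3 > 0" "ball x0 d3 \<subseteq> N0" using N0 open_contains_ball by blast
    have "dist (H y) (H x0) < \<epsilon>" if y: "dist y x0 < min d2 d3" for y
    proof (cases "y = x0")
      case False
      have yN: "y \<in> N0" using d3 y by (auto simp: dist_commute)
      have p: "norm (u1 y) > 0" using u1_nz[OF yN False] by simp
      have "norm (up y) \<le> \<epsilon> / 2 * (c * norm (y - x0))" using d2(2)[of y] y by (simp add: dist_norm mult.assoc)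
      also have "\<dots> \<le> \<epsilon> / 2 * norm (u1 y)" using u1_low[OF yN] \<epsilon> by (intro mult_left_mono) auto
      finally have "norm (H y) \<le> \<epsilon> / 2" unfolding nH using p by (simp add: field_simps)
      then show ?thesis using \<epsilon> by (simp add: H0)
    qed (use \<epsilon> in simp)
    then show "\<exists>s>0. \<forall>y. dist y x0 < s \<longrightarrow> dist (H y) (H x0) < \<epsilon>"
      using d2(1) d3(1) by (intro exI[of _ "min d2 d3"]) auto
  qed
  have contU: "isCont u1 x" "isCont up x" "isCont (\<lambda>x. D1 x v) x" "isCont (\<lambda>x. Dp x v) x" if "x \<in> U" for x v
  proof -
    have 1: "isCont (\<lambda>x. Du x v) x" using Ducont assms(1) that by (simp add: continuous_on_eq_continuous_at)
    show "isCont u1 x" "isCont up x" using d1 dp that has_derivative_continuous by blast+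
    show 2: "isCont (\<lambda>x. D1 x v) x"
      unfolding D1_def by (rule bounded_linear.isCont[OF bounded_linear_herm_left 1])
    show "isCont (\<lambda>x. Dp x v) x"
      unfolding Dp_def by (intro continuous_diff 1 bounded_linear.isCont[OF bounded_linear_sc_left 2])
  qed
  have contH: "isCont H x" if "x \<in> N0" for x
  proof (cases "x = x0")
    case False
    have "x \<in> U" using that N0 by blast
    then show ?thesis
      unfolding H_def using u1_nz[OF that False] contU
      by (intro bounded_bilinear.isCont[OF bounded_bilinear_sc] isCont_divide) auto
  qed (use H_lim in simp)

  \<comment> \<open>The inverse of the component u1/|u|^2 of u/|u|^2 along \<open>e\<close>.
    Division by zero gives the value 0 at \<open>x0\<close>, as continuity requires.\<close>
  define \<zeta> where "\<zeta> x = complex_of_real ((norm (u x))\<^sup>2) / u1 x" for x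
  define Z where "Z x v = cnj (D1 x v) + complex_of_real (2 * (up x \<bullet> Dp x v)) / u1 x
      - complex_of_real ((norm (up x))\<^sup>2) * D1 x v / (u1 x)\<^sup>2" for x v
  \<comment> \<open>This separates a smooth term from a remainder that is o(|x - x0|), so
    \<open>\<zeta>\<close> is differentiable at \<open>x0\<close> with the derivative of
    \<open>cnj u1\<close>.\<close>
  have \<zeta>_eq: "\<zeta> x = cnj (u1 x) + complex_of_real ((norm (up x))\<^sup>2) / u1 x" if "x \<in> N0" for x
  proof (cases "x = x0")
    case True then show ?thesis by (simp add: \<zeta>_def u1_0)
  next
    case False
    then have "u1 x \<noteq> 0" using u1_nz that by blast
    then show ?thesis by (simp add: \<zeta>_def norm_u complex_norm_square add_divide_distrib flip: of_real_power)
  qed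
  have \<zeta>x0: "\<zeta> x0 = 0" by (simp add: \<zeta>_def u1_0)
  have d\<zeta>: "(\<zeta> has_derivative Z x) (at x)" if x: "x \<in> N0" for x
  proof -
    have xU: "x \<in> U" using x N0 by blast
    have "((\<lambda>x. complex_of_real ((norm (up x))\<^sup>2) / u1 x) has_derivative
        (\<lambda>v. complex_of_real (2 * (up x \<bullet> Dp x v)) / u1 x - complex_of_real ((norm (up x))\<^sup>2) * D1 x v / (u1 x)\<^sup>2)) (at x)"
    proof (cases "x = x0")
      case False
      have nz: "u1 x \<noteq> 0" using u1_nz x False by blast
      have "((\<lambda>x. complex_of_real (up x \<bullet> up x) / u1 x) has_derivative
        (\<lambda>v. (complex_of_real (up x \<bullet> Dp x v + Dp x v \<bullet> up x) * u1 x - complex_of_real (up x \<bullet> up x) * D1 x v) / (u1 x * u1 x))) (at x)"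
        using nz by (intro has_derivative_divide' has_derivative_of_real has_derivative_inner d1 dp xU)
      then show ?thesis
        unfolding power2_norm_eq_inner
        by (rule has_derivative_eq_rhs) (use nz in \<open>simp add: fun_eq_iff inner_commute power2_eq_square diff_divide_distrib\<close>)
    next
      case True
      have "((\<lambda>x. complex_of_real ((norm (up x))\<^sup>2) / u1 x) has_derivative (\<lambda>v. 0)) (at x0)"
        unfolding has_derivative_at_alt
      proof (intro conjI allI impI)
        fix \<epsilon> :: real assume \<epsilon>: "\<epsilon> > 0"
        \<comment> \<open>Chosen so that \<open>\<delta>\<close> squared is at most
          \<open>\<epsilon> * c\<close>: the square comes from |up|^2 and the factor
          \<open>c\<close> from the lower bound for \<open>u1\<close>.\<close>
        define \<delta> where "\<delta> = min 1 (\<epsilon> * c)"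
        have \<delta>: "\<delta> > 0" "\<delta> * \<delta> \<le> \<epsilon> * c" using \<epsilon> c by (auto simp: \<delta>_def min_def intro: mult_mono[of _ 1 _ "\<epsilon> * c", simplified] order_trans[of _ 1])
        obtain d2 where d2: "d2 > 0" "\<And>y. norm (y - x0) < d2 \<Longrightarrow> norm (up y) \<le> \<delta> * norm (y - x0)"
          using up_small \<delta>(1) by blast
        obtain d3 where d3: "d3 > 0" "ball x0 d3 \<subseteq> N0" using N0 open_contains_ball by blast
        have "norm (complex_of_real ((norm (up y))\<^sup>2) / u1 y) \<le> \<epsilon> * norm (y - x0)"
          if y: "norm (y - x0) < min d2 d3" for y
        proof (cases "y = x0")
          case False
          have yN: "y \<in> N0" using d3 y by (auto simp: dist_norm norm_minus_commute)
          have p: "norm (u1 y) > 0" using u1_nz[OF yN False] by simp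
          have "(norm (up y))\<^sup>2 \<le> (\<delta> * norm (y - x0))\<^sup>2" using d2(2)[of y] y by (intro power_mono) auto
          also have "\<dots> = \<delta> * \<delta> * (norm (y - x0) * norm (y - x0))" by (simp add: power2_eq_square)
          also have "\<dots> \<le> \<epsilon> * c * (norm (y - x0) * norm (y - x0))" using \<delta>(2) by (intro mult_right_mono) auto
          also have "\<dots> = \<epsilon> * norm (y - x0) * (c * norm (y - x0))" by simp
          also have "\<dots> \<le> \<epsilon> * norm (y - x0) * norm (u1 y)" using u1_low[OF yN] \<epsilon> by (intro mult_left_mono) auto
          finally show ?thesis using p by (simp add: norm_divide norm_power divide_le_eq)
        qed (simp add: u1_0)
        then show "\<exists>d>0. \<forall>y. norm (y - x0) < d \<longrightarrow>
          norm (complex_of_real ((norm (up y))\<^sup>2) / u1 y - complex_of_real ((norm (up x0))\<^sup>2) / u1 x0 - 0) \<le> \<epsilon> * norm (y - x0)"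
          using d2(1) d3(1) by (intro exI[of _ "min d2 d3"]) (auto simp: up_0)
      qed (rule bounded_linear_zero)
      then show ?thesis unfolding True by (simp add: u1_0)
    qed
    then have "((\<lambda>x. cnj (u1 x) + complex_of_real ((norm (up x))\<^sup>2) / u1 x) has_derivative
       (\<lambda>v. cnj (D1 x v) + (complex_of_real (2 * (up x \<bullet> Dp x v)) / u1 x - complex_of_real ((norm (up x))\<^sup>2) * D1 x v / (u1 x)\<^sup>2))) (at x)"
      by (intro has_derivative_add bounded_linear.has_derivative[OF bounded_linear_cnj d1[OF xU]])
    then have "(\<zeta> has_derivative
       (\<lambda>v. cnj (D1 x v) + (complex_of_real (2 * (up x \<bullet> Dp x v)) / u1 x - complex_of_real ((norm (up x))\<^sup>2) * D1 x v / (u1 x)\<^sup>2))) (at x)"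
      by (rule has_derivative_transform_within_open[OF _ N0(1) x]) (simp add: \<zeta>_eq)
    then show ?thesis by (rule has_derivative_eq_rhs) (simp add: Z_def fun_eq_iff)
  qed
  have Zx0: "Z x0 v = cnj (l v)" for v by (simp add: Z_def u1_0 D1x0)
  have Zcont: "continuous_on N0 (\<lambda>x. Z x v)" for v
  proof -
    have "isCont (\<lambda>x. Z x v) x" if x: "x \<in> N0" for x
    proof -
      have xU: "x \<in> U" using x N0 by blast
      have i1: "isCont (\<lambda>x. cnj (D1 x v)) x"
        by (rule bounded_linear.isCont[OF bounded_linear_cnj contU(3)[OF xU]])
      show ?thesis
      proof (cases "x = x0")
        case False
        then have "u1 x \<noteq> 0" using u1_nz x by blast
        then show ?thesis
          unfolding Z_def by (intro continuous_intros i1 contU xU) auto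
      next
        case True
        \<comment> \<open>Both correction terms in \<open>Z\<close> carry a factor |H|, which tends
          to 0 at \<open>x0\<close>.\<close>
        have l1: "((\<lambda>x. 2 * norm (H x) * norm (Dp x v)) \<longlongrightarrow> 0) (at x0)"
          using H_lim[unfolded isCont_def H0] contU(4)[OF assms(2), of v, unfolded isCont_def]
          by (auto intro!: tendsto_eq_intros)
        have l2: "((\<lambda>x. (norm (H x))\<^sup>2 * norm (D1 x v)) \<longlongrightarrow> 0) (at x0)"
          using H_lim[unfolded isCont_def H0] contU(3)[OF assms(2), of v, unfolded isCont_def]
          by (auto intro!: tendsto_eq_intros)
        have "((\<lambda>x. complex_of_real (2 * (up x \<bullet> Dp x v)) / u1 x) \<longlongrightarrow> 0) (at x0)"
        proof (rule Lim_null_comparison[OF always_eventually l1], intro allI)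
          fix x
          have "\<bar>up x \<bullet> Dp x v\<bar> / norm (u1 x) \<le> norm (up x) * norm (Dp x v) / norm (u1 x)"
            by (intro divide_right_mono Cauchy_Schwarz_ineq2) auto
          then show "norm (complex_of_real (2 * (up x \<bullet> Dp x v)) / u1 x) \<le> 2 * norm (H x) * norm (Dp x v)"
            by (simp add: norm_divide nH abs_mult)
        qed
        moreover have "((\<lambda>x. complex_of_real ((norm (up x))\<^sup>2) * D1 x v / (u1 x)\<^sup>2) \<longlongrightarrow> 0) (at x0)"
          by (rule Lim_null_comparison[OF always_eventually l2], intro allI)
             (simp add: norm_divide norm_mult norm_power nH power_divide)
        moreover have "((\<lambda>x. cnj (D1 x v)) \<longlongrightarrow> cnj (D1 x0 v)) (at x0)"
          using i1 unfolding True isCont_def .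
        ultimately have "((\<lambda>x. Z x v) \<longlongrightarrow> cnj (D1 x0 v) + 0 - 0) (at x0)"
          unfolding Z_def by (intro tendsto_diff tendsto_add)
        then show ?thesis unfolding True isCont_def by (simp add: Zx0 D1x0)
      qed
    qed
    then show ?thesis using N0(1) by (simp add: continuous_on_eq_continuous_at)
  qed
  obtain U1 V1 g g' where U1: "open U1" "U1 \<subseteq> N0" "x0 \<in> U1" and V1: "open V1" "\<zeta> x0 \<in> V1"
    and hom1: "homeomorphism U1 V1 \<zeta> g"
    and dg: "\<And>y. y \<in> V1 \<Longrightarrow> (g has_derivative g' y) (at y)"
    and Zg': "\<And>y v. y \<in> V1 \<Longrightarrow> Z (g y) (g' y v) = v"
    using inverse_function_theorem_pointwise[OF N0(1) d\<zeta> Zcont N0(2)] l_inj unfolding Zx0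
    by (metis complex_cnj_zero_iff)
  have gV: "g y \<in> U1" if "y \<in> V1" for y using hom1 that by (auto simp: homeomorphism_def)
  have \<zeta>U: "\<zeta> x \<in> V1" if "x \<in> U1" for x using hom1 that by (auto simp: homeomorphism_def)
  have g\<zeta>: "g (\<zeta> x) = x" if "x \<in> U1" for x using hom1 that by (auto simp: homeomorphism_def)
  have \<zeta>g: "\<zeta> (g y) = y" if "y \<in> V1" for y using hom1 that by (auto simp: homeomorphism_def)
  have V10: "0 \<in> V1" using V1(2) \<zeta>x0 by simp
  have g0: "g 0 = x0" using g\<zeta>[OF U1(3)] \<zeta>x0 by simp

  have H_eq: "e + H x = sc (1 / u1 x) (u x)" if "u1 x \<noteq> 0" for x
    using that by (simp add: H_def up_def sc_diff_right sc_sc sc_1)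

  \<comment> \<open>The direction of \<open>u\<close> as a function of the coordinate
    \<open>\<zeta>\<close>. It is continuous at 0 by \<open>contH\<close>, so holomorphy needs to be
    shown only away from 0.\<close>
  define h where "h z = H (g z)" for z
  have hhol: "(\<lambda>z. herm (h z) k) holomorphic_on V1" for k
  proof (rule no_isolated_singularity[OF _ _ V1(1), of _ "{0}"])
    have "continuous_on N0 H" using contH N0(1) by (simp add: continuous_on_eq_continuous_at)
    moreover have "continuous_on V1 g" using hom1 by (simp add: homeomorphism_def)
    moreover have "g ` V1 \<subseteq> N0" using gV U1(2) by blast
    ultimately have "continuous_on V1 h"
      unfolding h_def by (rule continuous_on_compose2)
    then show "continuous_on V1 (\<lambda>z. herm (h z) k)"
      by (rule bounded_linear.continuous_on[OF bounded_linear_herm_left])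
    have "(\<lambda>z. herm (h z) k) field_differentiable (at z)" if z: "z \<in> V1" "z \<noteq> 0" for z
    proof -
      define x where "x = g z"
      have x: "x \<in> U1" "x \<in> N0" "x \<in> U" using gV[OF z(1)] U1(2) N0(3) by (auto simp: x_def)
      have xne: "x \<noteq> x0" using \<zeta>g[OF z(1)] z(2) \<zeta>x0 by (auto simp: x_def)
      have nz: "u1 x \<noteq> 0" using u1_nz x(2) xne by blast
      have unz: "u x \<noteq> 0" using nz by (auto simp: u1_def herm_0_left)
      define Y where "Y x = u x /\<^sub>R (norm (u x))\<^sup>2" for x
      obtain D \<omega> where D: "(Y has_derivative D) (at x)" "D \<i> = sc \<omega> (D 1)"
        using hol[OF x(3) unz] unfolding Y_def by metis
      have Ye: "herm (Y y) e = inverse (\<zeta> y)" for y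
        by (simp add: Y_def herm_scaleR_left \<zeta>_def u1_def divide_inverse)
      have \<zeta>Y: "\<zeta> y = inverse (herm (Y y) e)" for y by (simp add: Ye)
      have Yenz: "herm (Y x) e \<noteq> 0" using nz unz by (simp add: Ye \<zeta>_def)
      have dYe: "((\<lambda>y. herm (Y y) j) has_derivative (\<lambda>v. herm (D v) j)) (at x)" for j
        by (rule bounded_linear.has_derivative[OF bounded_linear_herm_left D(1)])
      have "(\<zeta> has_derivative (\<lambda>v. - (inverse (herm (Y x) e) * herm (D v) e * inverse (herm (Y x) e)))) (at x)"
        unfolding \<zeta>Y by (rule Deriv.has_derivative_inverse[OF Yenz dYe])
      then have Zx: "Z x v = - (inverse (herm (Y x) e) * herm (D v) e * inverse (herm (Y x) e))" for v
        using has_derivative_unique d\<zeta>[OF x(2)] by metis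
      have Zi: "Z x \<i> = \<omega> * Z x 1" by (simp add: Zx D(2) herm_sc)
      have Zlin: "linear (Z x)" using d\<zeta>[OF x(2)] has_derivative_linear by blast
      have Z1: "Z x 1 \<noteq> 0"
      proof
        assume "Z x 1 = 0"
        then have "Z x v = 0" for v using linear_complex_eq[OF Zlin, of v] Zi by simp
        then show False using Zg'[OF z(1), of 1] by (simp add: x_def)
      qed
      \<comment> \<open>Since e + H = u/u1, which is \<open>Y\<close> divided by its component along
        \<open>e\<close>, each component of \<open>H\<close> is, up to a constant, a quotient of two
        components of the holomorphic map \<open>Y\<close>; \<open>C\<close> is the derivative of
        this quotient.\<close>
      define C where "C v = herm (Y x) k * (- (inverse (herm (Y x) e) * herm (D v) e * inverse (herm (Y x) e)))
          + herm (D v) k * inverse (herm (Y x) e)" for v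
      have "((\<lambda>y. herm (Y y) k * inverse (herm (Y y) e)) has_derivative C) (at x)"
        unfolding C_def by (intro has_derivative_mult Deriv.has_derivative_inverse dYe Yenz)
      then have "((\<lambda>y. herm (Y y) k * inverse (herm (Y y) e) - herm e k) has_derivative (\<lambda>v. C v - 0)) (at x)"
        by (intro has_derivative_diff has_derivative_const)
      then have "((\<lambda>y. herm (H y) k) has_derivative (\<lambda>v. C v - 0)) (at x)"
      proof (rule has_derivative_transform_within_open)
        show "open (N0 - {x0})" "x \<in> N0 - {x0}" using N0(1) x xne by auto
        fix y assume y: "y \<in> N0 - {x0}"
        have n: "u1 y \<noteq> 0" using u1_nz y by blast
        have "herm (H y) k = herm (sc (1 / u1 y) (u y)) k - herm e k"
          by (simp only: H_eq[OF n, symmetric] herm_add) simp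
        moreover have "u y \<noteq> 0" using n by (auto simp: u1_def herm_0_left)
        ultimately show "herm (Y y) k * inverse (herm (Y y) e) - herm e k = herm (H y) k"
          using n by (simp add: Y_def herm_scaleR_left herm_sc u1_def[symmetric] field_simps)
      qed
      then have dH: "((\<lambda>y. herm (H y) k) has_derivative C) (at (g z))" by (simp add: x_def)
      \<comment> \<open>\<open>C\<close> and \<open>Z x\<close> share the same
        \<open>\<omega>\<close>, so \<open>C\<close> is a complex multiple of \<open>Z x\<close>. In
        the coordinate \<open>\<zeta>\<close> the derivative is then multiplication by a complex
        number.\<close>
      have Ci: "C \<i> = \<omega> * C 1" by (simp add: C_def D(2) herm_sc algebra_simps)
      have Clin: "linear C" using dH has_derivative_linear by blast
      have CZ: "C v = C 1 / Z x 1 * Z x v" for v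
        using linear_complex_eq[OF Clin, of v] linear_complex_eq[OF Zlin, of v] Z1
        by (simp add: Ci Zi field_simps scaleR_conv_of_real)
      have "((\<lambda>z. herm (h z) k) has_derivative (\<lambda>v. C (g' z v))) (at z)"
        unfolding h_def by (rule has_derivative_compose[OF dg[OF z(1)] dH])
      moreover have "C (g' z v) = C 1 / Z x 1 * v" for v
        using CZ[of "g' z v"] Zg'[OF z(1), of v] by (simp add: x_def)
      ultimately have "((\<lambda>z. herm (h z) k) has_field_derivative (C 1 / Z x 1)) (at z)"
        unfolding has_field_derivative_def by (simp only:)
      then show ?thesis by (auto simp: field_differentiable_def)
    qed
    then show "(\<lambda>z. herm (h z) k) holomorphic_on V1 - {0}"
      by (auto simp: holomorphic_on_def intro: field_differentiable_at_within)
  qed simp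
  note smh = holomorphic_components(1)[OF V1(1) hhol]
    and hlin = holomorphic_components(2)[OF V1(1) hhol]
  have h0: "h 0 = 0" by (simp add: h_def g0 H0)

  \<comment> \<open>From |u|^2 = |u1|^2 (1 + |H|^2) one gets \<open>\<zeta>\<close> = (1 + |h|^2)
    cnj u1. Thus \<open>K\<close> recovers the smooth function \<open>cnj u1\<close> from
    \<open>\<zeta>\<close>.\<close>
  define K where "K z = (1 / (1 + (norm (h z))\<^sup>2)) *\<^sub>R z" for z
  have pos: "1 + (norm (h z))\<^sup>2 \<noteq> 0" for z by (smt (verit) zero_le_power2)
  have smK: "smooth_on V1 K"
    unfolding K_def using pos by (intro smooth_intros V1(1) smh)
  have Ku1: "K (\<zeta> x) = cnj (u1 x)" if x: "x \<in> U1" for x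
  proof (cases "x = x0")
    case True then show ?thesis by (simp add: K_def \<zeta>x0 u1_0)
  next
    case False
    have n: "u1 x \<noteq> 0" using u1_nz x U1(2) False by blast
    have "1 + (norm (h (\<zeta> x)))\<^sup>2 = (norm (u x))\<^sup>2 / (norm (u1 x))\<^sup>2"
      using n by (simp add: h_def g\<zeta>[OF x] nH norm_u power_divide add_divide_distrib)
    moreover have "(norm (u x))\<^sup>2 \<noteq> 0" using n norm_u[of x] by (smt (verit) zero_less_norm_iff zero_less_power zero_le_power2)
    ultimately have "K (\<zeta> x) = complex_of_real ((norm (u1 x))\<^sup>2) / u1 x"
      by (simp add: K_def \<zeta>_def scaleR_conv_of_real)
    also have "\<dots> = cnj (u1 x)" using n by (simp add: complex_norm_square del: of_real_power)
    finally show ?thesis .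
  qed
  define DK where "DK z = frechet_derivative K (at z)" for z
  have dK: "(K has_derivative DK z) (at z)" if "z \<in> V1" for z
    unfolding DK_def by (rule smooth_on_has_derivative[OF smK that])
  have DKcont: "continuous_on V1 (\<lambda>z. DK z v)" for v
    unfolding DK_def by (intro smooth_on_imp_continuous_on smooth_on_frechet_derivative smK)
  \<comment> \<open>At 0 the coefficient in \<open>K\<close> is 1, as \<open>h 0 = 0\<close>, and
    the derivative of the coefficient is multiplied by z = 0.\<close>
  have DK0: "DK 0 v = v" for v
  proof -
    have "smooth_on V1 (\<lambda>z. 1 / (1 + (norm (h z))\<^sup>2))"
      using pos by (intro smooth_intros V1(1) smh)
    then obtain M where M: "((\<lambda>z. 1 / (1 + (norm (h z))\<^sup>2)) has_derivative M) (at 0)"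
      using smooth_on_has_derivative V10 by blast
    have "(K has_derivative (\<lambda>v. (1 / (1 + (norm (h 0))\<^sup>2)) *\<^sub>R v + M v *\<^sub>R 0)) (at 0)"
      unfolding K_def by (intro has_derivative_scaleR M has_derivative_ident)
    then have "DK 0 = (\<lambda>v. (1 / (1 + (norm (h 0))\<^sup>2)) *\<^sub>R v + M v *\<^sub>R 0)"
      using has_derivative_unique dK[OF V10] by blast
    then show ?thesis by (simp add: h0)
  qed
  obtain U2 V2 k k' where U2: "open U2" "U2 \<subseteq> V1" "0 \<in> U2" and V2: "open V2" "K 0 \<in> V2"
    and hom2: "homeomorphism U2 V2 K k"
    and dk: "\<And>y. y \<in> V2 \<Longrightarrow> (k has_derivative k' y) (at y)"
    and DKk: "\<And>y v. y \<in> V2 \<Longrightarrow> DK (k y) (k' y v) = v"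
    using inverse_function_theorem_pointwise[OF V1(1) dK DKcont V10] DK0 by metis
  have smk: "smooth_on V2 k"
    using smooth_on_local_inverse[OF U2(1) V2(1) smooth_on_subset[OF smK U2(2)] hom2 dk] DKk unfolding DK_def by blast

  define N where "N = {x \<in> U1. \<zeta> x \<in> U2}"
  have Nopen: "open N"
  proof -
    have "continuous_on U1 \<zeta>" using hom1 by (simp add: homeomorphism_def)
    then have "open (U1 \<inter> \<zeta> -` U2)" using U1(1) U2(1) continuous_open_preimage by blast
    moreover have "N = U1 \<inter> \<zeta> -` U2" by (auto simp: N_def)
    ultimately show ?thesis by simp
  qed
  have NU1: "N \<subseteq> U1" by (auto simp: N_def)
  have NU: "N \<subseteq> U" using NU1 U1(2) N0(3) by blast
  have x0N: "x0 \<in> N" by (simp add: N_def U1(3) \<zeta>x0 U2(3))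
  \<comment> \<open>Inverting \<open>K\<close> gives \<open>\<zeta> = k (cnj u1)\<close>, a
    composite of smooth maps; this raises \<open>\<zeta>\<close> from class C^1 to
    C^infinity.\<close>
  have sm\<zeta>: "smooth_on N \<zeta>"
  proof -
    have 1: "K (\<zeta> x) = cnj (u1 x)" "\<zeta> x \<in> U2" if "x \<in> N" for x using that Ku1 by (auto simp: N_def)
    have kK: "k (K z) = z" "K z \<in> V2" if "z \<in> U2" for z using hom2 that by (auto simp: homeomorphism_def)
    have "smooth_on N (\<lambda>x. k (cnj (u1 x)))"
    proof (rule smooth_on_compose[OF Nopen V2(1) smk])
      show "smooth_on N (\<lambda>x. cnj (u1 x))"
        using smooth_on_subset[OF smu1 NU] by (intro smooth_on_cnj Nopen)
      show "(\<lambda>x. cnj (u1 x)) ` N \<subseteq> V2" using 1 kK by (metis image_subsetI)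
    qed
    moreover have "k (cnj (u1 x)) = \<zeta> x" if "x \<in> N" for x using 1[OF that] kK by metis
    ultimately show ?thesis using smooth_on_cong[OF Nopen] by metis
  qed
  \<comment> \<open>Away from \<open>x0\<close> this equals \<open>\<zeta>\<close> times (u/|u|^2,
    1), because e + H = u/u1. In this form it is smooth at \<open>x0\<close> too, with the nonzero
    value (e, 0).\<close>
  define w where "w x = (e + h (\<zeta> x), \<zeta> x)" for x
  have smw: "smooth_on N w"
  proof -
    have "smooth_on N (\<lambda>x. h (\<zeta> x))"
      using \<zeta>U NU1 by (intro smooth_on_compose[OF Nopen V1(1) smh sm\<zeta>]) auto
    then show ?thesis unfolding w_def by (intro smooth_intros Nopen sm\<zeta>)
  qed
  define Dh where "Dh = frechet_derivative h (at 0)"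
  have dh: "(h has_derivative Dh) (at (\<zeta> x0))"
    unfolding Dh_def \<zeta>x0 by (rule smooth_on_has_derivative[OF smh V10])
  define Dw where "Dw v = (0 + Dh (Z x0 v), Z x0 v)" for v
  have dw: "(w has_derivative Dw) (at x0)"
    unfolding w_def Dw_def
    by (intro has_derivative_Pair has_derivative_add has_derivative_const d\<zeta> N0(2)
        has_derivative_compose[OF d\<zeta>[OF N0(2)] dh])
  have Z1: "Z x0 1 = norm a" "Z x0 \<i> = cnj \<beta> * Z x0 1" by (simp_all add: Zx0 l_def)
  have wx: "u x \<noteq> 0 \<and> snd (w x) \<noteq> 0 \<and> w x = sc_prod sc (snd (w x)) (u x /\<^sub>R (norm (u x))\<^sup>2, 1)"
    if "x \<in> N" "x \<noteq> x0" for x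
  proof -
    have xU1: "x \<in> U1" using that NU1 by blast
    have n: "u1 x \<noteq> 0" using u1_nz xU1 U1(2) that by blast
    then have un: "u x \<noteq> 0" by (auto simp: u1_def herm_0_left)
    have "e + h (\<zeta> x) = sc (1 / u1 x) (u x)" by (simp add: h_def g\<zeta>[OF xU1] H_eq[OF n])
    also have "\<dots> = sc (\<zeta> x) (u x /\<^sub>R (norm (u x))\<^sup>2)"
      using un by (simp only: sc_of_real[symmetric] sc_sc \<zeta>_def) (simp add: field_simps)
    finally show ?thesis using n un by (simp add: w_def sc_prod_def) (simp add: \<zeta>_def)
  qed
  show thesis
  proof (rule that[OF Nopen x0N NU smw wx _ _ dw, of "cnj \<beta>"])
    show "snd (w x0) = 0" "norm (fst (w x0)) = 1" by (simp_all add: w_def \<zeta>x0 h0 ne)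
    show "0 < Im (cnj \<beta>)" using \<beta>(1) by simp
    show "Dw \<i> = sc_prod sc (cnj \<beta>) (Dw 1)"
      unfolding Dw_def Z1(2) Dh_def hlin[OF V10] by (simp add: sc_prod_def)
    show "snd (Dw 1) \<noteq> 0" using a0 by (simp add: Dw_def Z1)
  qed
qed

end

section \<open>Maps between manifolds in charts\<close>

definition deriv_in_charts ::
  "('a \<Rightarrow> 'b) \<Rightarrow> ('a, 'e::euclidean_space) chart \<Rightarrow> ('b, 'f::euclidean_space) chart \<Rightarrow> 'a \<Rightarrow> 'e \<Rightarrow> 'f" where
  "deriv_in_charts f c d x = frechet_derivative (in_charts f c d) (at (snd c x))"

text \<open>The part of \<open>smooth_atlas\<close> that makes \<open>chart_inv\<close> an inverse,
  kept separate so that it can be checked directly for the one-chart atlas of an interval that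
  carries a curve.\<close>

definition inj_charts :: "('a, 'e) chart set \<Rightarrow> bool" where
  "inj_charts A \<longleftrightarrow> (\<forall>c\<in>A. inj_on (snd c) (fst c))"

lemma smooth_atlas_inj_charts: "smooth_atlas A \<Longrightarrow> inj_charts A"
  by (simp add: smooth_atlas_def inj_charts_def)

lemma chart_inv_chart:
  assumes "inj_charts A" "c \<in> charts_at A x"
  shows "chart_inv c (snd c x) = x"
  using assms unfolding chart_inv_def inj_charts_def charts_at_def by (auto intro: inv_into_f_f)

lemma in_charts_chart:
  assumes "inj_charts A" "c \<in> charts_at A x"
  shows "in_charts f c d (snd c x) = snd d (f x)"
  by (simp add: in_charts_def chart_inv_chart[OF assms])

lemma in_charts_transition: "in_charts (\<lambda>x. x) c d = transition c d"
  by (auto simp: in_charts_def transition_def)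

lemma charts_at_points: "x \<in> points A \<longleftrightarrow> charts_at A x \<noteq> {}"
  unfolding points_def charts_at_def by blast

lemma smooth_map_chart_open:
  assumes "smooth_map A B f" "c \<in> A" "d \<in> B"
  shows "open (snd c ` {x \<in> fst c. f x \<in> fst d})"
  using assms by (simp add: smooth_map_def)

lemma smooth_map_chart_smooth:
  assumes "smooth_map A B f" "c \<in> A" "d \<in> B"
  shows "smooth_on (snd c ` {x \<in> fst c. f x \<in> fst d}) (in_charts f c d)"
  using assms by (simp add: smooth_map_def)

lemma has_derivative_in_charts:
  assumes "smooth_map A B f" "c \<in> charts_at A x" "d \<in> charts_at B (f x)"
  shows "(in_charts f c d has_derivative deriv_in_charts f c d x) (at (snd c x))"
proof -
  have c: "c \<in> A" and d: "d \<in> B" and x: "snd c x \<in> snd c ` {x \<in> fst c. f x \<in> fst d}"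
    using assms by (auto simp: charts_at_def)
  show ?thesis
    unfolding deriv_in_charts_def
    by (rule smooth_on_has_derivative[OF smooth_map_chart_smooth[OF assms(1) c d] x])
qed

lemma linear_deriv_in_charts:
  assumes "smooth_map A B f" "c \<in> charts_at A x" "d \<in> charts_at B (f x)"
  shows "linear (deriv_in_charts f c d x)"
  using has_derivative_in_charts[OF assms] has_derivative_linear by blast

lemma deriv_in_charts_eq:
  assumes "open N" "snd c x \<in> N" "\<And>z. z \<in> N \<Longrightarrow> in_charts f c d z = g z"
    and "(g has_derivative D) (at (snd c x))"
  shows "deriv_in_charts f c d x = D"
proof -
  have "(in_charts f c d has_derivative D) (at (snd c x))"
    by (rule has_derivative_transform_within_open[OF assms(4,1,2)]) (simp add: assms(3))
  then show ?thesis unfolding deriv_in_charts_def by (metis frechet_derivative_at)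
qed

lemma smooth_mapI:
  assumes A: "inj_charts A" and pts: "\<And>x. x \<in> points A \<Longrightarrow> f x \<in> points B"
    and loc: "\<And>x c d. c \<in> charts_at A x \<Longrightarrow> d \<in> charts_at B (f x) \<Longrightarrow>
      \<exists>N g. open N \<and> snd c x \<in> N \<and> N \<subseteq> snd c ` {y \<in> fst c. f y \<in> fst d} \<and> smooth_on N g \<and>
        (\<forall>z\<in>N. snd d (f (chart_inv c z)) = g z)"
  shows "smooth_map A B f"
  unfolding smooth_map_def
proof (intro conjI ballI)
  show "f ` points A \<subseteq> points B" using pts by blast
  fix c d assume cd: "c \<in> A" "d \<in> B"
  let ?O = "snd c ` {x \<in> fst c. f x \<in> fst d}"
  have loc': "\<exists>N g. open N \<and> z \<in> N \<and> N \<subseteq> ?O \<and> smooth_on N g \<and> (\<forall>z\<in>N. snd d (f (chart_inv c z)) = g z)"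
    if z: "z \<in> ?O" for z
  proof -
    obtain x where "z = snd c x" "x \<in> fst c" "f x \<in> fst d" using z by blast
    then show ?thesis using loc[of c x d] cd by (simp add: charts_at_def)
  qed
  show o: "open ?O"
    by (subst open_subopen) (use loc' in meson)
  show "smooth_on ?O (in_charts f c d)"
  proof (rule smooth_on_local[OF o])
    fix z assume "z \<in> ?O"
    then obtain N g where N: "open N" "z \<in> N" "smooth_on N g" "\<And>z. z \<in> N \<Longrightarrow> snd d (f (chart_inv c z)) = g z"
      using loc' by meson
    have "smooth_on N (in_charts f c d)"
      using smooth_on_cong[OF N(1), of "in_charts f c d" g] N(3,4) by (simp add: in_charts_def)
    then show "\<exists>N. open N \<and> z \<in> N \<and> smooth_on N (in_charts f c d)" using N(1,2) by blast
  qed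
qed

text \<open>Transition maps are the identity map read in charts
  (\<open>in_charts_transition\<close>), so this one chain rule also yields the cocycle condition
  and the chart independence of differentials.\<close>

lemma deriv_in_charts_compose:
  assumes "inj_charts A" "inj_charts B" "smooth_map A B f" "smooth_map B C g"
    and c: "c \<in> charts_at A x" and d: "d \<in> charts_at B (f x)" and e: "e \<in> charts_at C (g (f x))"
  shows "deriv_in_charts (\<lambda>x. g (f x)) c e x v = deriv_in_charts g d e (f x) (deriv_in_charts f c d x v)"
proof -
  let ?N = "snd c ` {y \<in> fst c. f y \<in> fst d}"
  have N: "open ?N" "snd c x \<in> ?N"
    using smooth_map_chart_open[OF assms(3)] c d by (simp_all add: charts_at_def)
  have D2: "(in_charts g d e has_derivative deriv_in_charts g d e (f x)) (at (in_charts f c d (snd c x)))"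
    using has_derivative_in_charts[OF assms(4) d e] by (simp add: in_charts_chart[OF assms(1) c])
  have D: "((\<lambda>z. in_charts g d e (in_charts f c d z)) has_derivative
     (\<lambda>v. deriv_in_charts g d e (f x) (deriv_in_charts f c d x v))) (at (snd c x))"
    by (rule has_derivative_compose[OF has_derivative_in_charts[OF assms(3) c d] D2])
  have eq: "in_charts (\<lambda>x. g (f x)) c e z = in_charts g d e (in_charts f c d z)" if z: "z \<in> ?N" for z
  proof -
    obtain y where y: "z = snd c y" "c \<in> charts_at A y" "d \<in> charts_at B (f y)"
      using z c d by (auto simp: charts_at_def)
    show ?thesis using in_charts_chart[OF assms(1) y(2)] in_charts_chart[OF assms(2) y(3)] y(1) by metis
  qed
  show ?thesis using deriv_in_charts_eq[OF N eq D] by simp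
qed

lemma smooth_map_ident: "smooth_atlas A \<Longrightarrow> smooth_map A A (\<lambda>x. x)"
  by (simp add: smooth_map_def smooth_atlas_def in_charts_transition Int_def)

lemma deriv_in_charts_ident:
  assumes "smooth_atlas A" "c \<in> charts_at A x"
  shows "deriv_in_charts (\<lambda>x. x) c c x = (\<lambda>v. v)"
proof (rule deriv_in_charts_eq[where N="snd c ` fst c" and g="\<lambda>z. z"])
  show "open (snd c ` fst c)" "snd c x \<in> snd c ` fst c"
    using assms by (auto simp: smooth_atlas_def charts_at_def)
  fix z assume "z \<in> snd c ` fst c"
  then obtain y where "z = snd c y" "c \<in> charts_at A y" using assms by (auto simp: charts_at_def)
  then show "in_charts (\<lambda>x. x) c c z = z"
    using in_charts_chart[OF smooth_atlas_inj_charts[OF assms(1)]] by metis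
qed (rule has_derivative_ident)

section \<open>Tangent vectors, differentials and orientation\<close>

lemma tangent_space_iff:
  "t \<in> tangent_space A x \<longleftrightarrow>
     (\<forall>c\<in>charts_at A x. \<forall>d\<in>charts_at A x. t d = deriv_in_charts (\<lambda>x. x) c d x (t c)) \<and>
     (\<forall>c. c \<notin> charts_at A x \<longrightarrow> t c = 0)"
  by (simp add: tangent_space_def deriv_in_charts_def in_charts_transition)

lemma tangent_space_eqI:
  assumes "t \<in> tangent_space A x" "t' \<in> tangent_space A x" "c \<in> charts_at A x" "t c = t' c"
  shows "t = t'"
  using assms unfolding tangent_space_iff by (metis ext)

text \<open>The vector is carried to the other charts by the derivatives of the transition maps; the
  chain rule makes the result compatible.\<close>

lemma tangent_space_ex:
  assumes "smooth_atlas A" "c \<in> charts_at A x"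
  obtains t where "t \<in> tangent_space A x" "t c = v"
proof -
  define t where "t d = (if d \<in> charts_at A x then deriv_in_charts (\<lambda>x. x) c d x v else 0)" for d
  note i = smooth_atlas_inj_charts[OF assms(1)] and s = smooth_map_ident[OF assms(1)]
  have "t \<in> tangent_space A x"
    unfolding tangent_space_iff
  proof (intro conjI ballI allI impI)
    fix d d' assume d: "d \<in> charts_at A x" "d' \<in> charts_at A x"
    show "t d' = deriv_in_charts (\<lambda>x. x) d d' x (t d)"
      using deriv_in_charts_compose[OF i i s s assms(2) d] d by (simp only: t_def if_True)
  qed (simp add: t_def)
  moreover have "t c = v" using assms deriv_in_charts_ident[OF assms] by (simp add: t_def)
  ultimately show thesis by (rule that)
qed

lemma lincomb_tangent_space:
  assumes "smooth_atlas A" "t \<in> tangent_space A x" "u \<in> tangent_space A x"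
  shows "lincomb a t b u \<in> tangent_space A x"
  unfolding tangent_space_iff
proof (intro conjI ballI allI impI)
  fix c d assume cd: "c \<in> charts_at A x" "d \<in> charts_at A x"
  have "linear (deriv_in_charts (\<lambda>x. x) c d x)"
    by (rule linear_deriv_in_charts[OF smooth_map_ident[OF assms(1)] cd])
  then have "deriv_in_charts (\<lambda>x. x) c d x (lincomb a t b u c) =
      a *\<^sub>R deriv_in_charts (\<lambda>x. x) c d x (t c) + b *\<^sub>R deriv_in_charts (\<lambda>x. x) c d x (u c)"
    by (simp only: lincomb_def linear_add linear_cmul)
  moreover have "t d = deriv_in_charts (\<lambda>x. x) c d x (t c)" "u d = deriv_in_charts (\<lambda>x. x) c d x (u c)"
    using assms(2,3) cd unfolding tangent_space_iff by blast+
  ultimately show "lincomb a t b u d = deriv_in_charts (\<lambda>x. x) c d x (lincomb a t b u c)"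
    by (simp only: lincomb_def)
qed (use assms(2,3) in \<open>auto simp: tangent_space_iff lincomb_def\<close>)

text \<open>Replaces the arbitrarily chosen chart in \<open>differential\<close> by any chart at
  hand.\<close>

lemma differential_eq:
  assumes "smooth_atlas A" "smooth_map A B f" "t \<in> tangent_space A x"
    and c: "c \<in> charts_at A x" and d: "d \<in> charts_at B (f x)"
  shows "differential A B f x t d = deriv_in_charts f c d x (t c)"
proof -
  define c0 where "c0 = (SOME c. c \<in> charts_at A x)"
  have c0: "c0 \<in> charts_at A x" unfolding c0_def by (rule someI[of _ c]) (rule c)
  note i = smooth_atlas_inj_charts[OF assms(1)] and s = smooth_map_ident[OF assms(1)]
  have "differential A B f x t d = deriv_in_charts f c0 d x (t c0)"
    using d by (simp add: differential_def Let_def deriv_in_charts_def c0_def)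
  also have "t c0 = deriv_in_charts (\<lambda>x. x) c c0 x (t c)"
    using assms(3) c c0 unfolding tangent_space_iff by blast
  also have "deriv_in_charts f c0 d x \<dots> = deriv_in_charts f c d x (t c)"
    by (rule deriv_in_charts_compose[OF i i s assms(2) c c0 d, symmetric])
  finally show ?thesis .
qed

lemma differential_outside: "d \<notin> charts_at B (f x) \<Longrightarrow> differential A B f x t d = 0"
  by (simp add: differential_def)

lemma differential_tangent_space:
  assumes "smooth_atlas A" "smooth_atlas B" "smooth_map A B f" "t \<in> tangent_space A x" "x \<in> points A"
  shows "differential A B f x t \<in> tangent_space B (f x)"
proof -
  obtain c where c: "c \<in> charts_at A x" using assms(5) by (auto simp: charts_at_points)
  note ia = smooth_atlas_inj_charts[OF assms(1)] and ib = smooth_atlas_inj_charts[OF assms(2)]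
    and sb = smooth_map_ident[OF assms(2)]
  show ?thesis
    unfolding tangent_space_iff
  proof (intro conjI ballI allI impI)
    fix d d' assume d: "d \<in> charts_at B (f x)" "d' \<in> charts_at B (f x)"
    show "differential A B f x t d' = deriv_in_charts (\<lambda>x. x) d d' (f x) (differential A B f x t d)"
      unfolding differential_eq[OF assms(1,3,4) c d(1)] differential_eq[OF assms(1,3,4) c d(2)]
      by (rule deriv_in_charts_compose[OF ia ib assms(3) sb c d])
  qed (rule differential_outside)
qed

lemma linear_plane_eq:
  fixes L :: "real^2 \<Rightarrow> 'f::real_vector"
  assumes "linear L"
  shows "L v = v$1 *\<^sub>R L (axis 1 1) + v$2 *\<^sub>R L (axis 2 1)"
proof -
  have "L v = L (v$1 *\<^sub>R axis 1 1 + v$2 *\<^sub>R axis 2 1)"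
    by (rule arg_cong[of _ _ L]) (simp add: vec_eq_iff forall_2 axis_def)
  then show ?thesis by (simp only: linear_add[OF assms] linear_cmul[OF assms])
qed

lemma det_vector_linear:
  fixes M :: "real^2 \<Rightarrow> real^2"
  assumes "linear M"
  shows "det (vector [M p, M q] :: real^2^2) = det (matrix M) * det (vector [p, q] :: real^2^2)"
  unfolding linear_plane_eq[OF assms, of p] linear_plane_eq[OF assms, of q]
  by (simp add: det_2 matrix_def algebra_simps)

text \<open>The orientation clause of \<open>oriented_surface\<close> by itself, in a form that
  passes to open subsets (\<open>oriented_restrict\<close>).\<close>

definition oriented :: "('a, real^2) chart set \<Rightarrow> bool" where
  "oriented A \<longleftrightarrow> (\<forall>c\<in>A. \<forall>d\<in>A. \<forall>x \<in> fst c \<inter> fst d.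
     det (matrix (frechet_derivative (transition c d) (at (snd c x)))) > 0)"

text \<open>Turns the existential chart of \<open>positive_basis\<close> into an arbitrary one: a
  change of chart multiplies the determinant by the positive Jacobian.\<close>

lemma positive_basis_chart:
  assumes "smooth_atlas A" "oriented A" "positive_basis A x u v" "c \<in> charts_at A x"
  shows "det (vector [u c, v c] :: real^2^2) > 0"
proof -
  obtain c' where c': "c' \<in> charts_at A x" "det (vector [u c', v c'] :: real^2^2) > 0"
    and uv: "u \<in> tangent_space A x" "v \<in> tangent_space A x"
    using assms(3) by (auto simp: positive_basis_def)
  have "det (matrix (deriv_in_charts (\<lambda>x. x) c' c x)) > 0"
    using assms(2,4) c'(1) by (auto simp: oriented_def charts_at_def deriv_in_charts_def in_charts_transition)
  moreover have "u c = deriv_in_charts (\<lambda>x. x) c' c x (u c')" "v c = deriv_in_charts (\<lambda>x. x) c' c x (v c')"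
    using uv c'(1) assms(4) unfolding tangent_space_iff by blast+
  moreover have "linear (deriv_in_charts (\<lambda>x. x) c' c x)"
    by (rule linear_deriv_in_charts[OF smooth_map_ident[OF assms(1)] c'(1) assms(4)])
  ultimately show ?thesis using c'(2) by (simp only: det_vector_linear mult_pos_pos)
qed

section \<open>Pseudoholomorphy as a condition on the derivative in charts\<close>

context hermitian_plane
begin

text \<open>\<open>D\<close> is injective, its image is a complex line, and it preserves the orientation.\<close>

definition hol_at :: "(real^2 \<Rightarrow> 'v) \<Rightarrow> bool" where
  "hol_at D \<longleftrightarrow> (\<exists>\<omega>. 0 < Im \<omega> \<and> D (axis 2 1) = sc \<omega> (D (axis 1 1)) \<and> D (axis 1 1) \<noteq> 0)"

lemma real_combination_sc: "a *\<^sub>R x + b *\<^sub>R sc \<i> x = sc (Complex a b) x"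
proof -
  have "Complex a b = of_real a + of_real b * \<i>" by (simp add: complex_eq_iff)
  then show ?thesis by (simp only: sc_add_left sc_of_real sc_sc[symmetric])
qed

lemma hol_at_eq:
  fixes D :: "real^2 \<Rightarrow> 'v"
  assumes "linear D" "D (axis 2 1) = sc \<omega> (D (axis 1 1))"
  shows "D v = sc (of_real (v$1) + of_real (v$2) * \<omega>) (D (axis 1 1))"
  using linear_plane_eq[OF assms(1), of v]
  by (simp only: assms(2) sc_add_left sc_of_real sc_sc[symmetric])

lemma hol_at_inj:
  assumes "linear D" "hol_at D" "D v = 0"
  shows "v = 0"
proof -
  obtain \<omega> where \<omega>: "0 < Im \<omega>" "D (axis 2 1) = sc \<omega> (D (axis 1 1))" "D (axis 1 1) \<noteq> 0"
    using assms(2) by (auto simp: hol_at_def)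
  then have "of_real (v$1) + of_real (v$2) * \<omega> = 0"
    using assms(3) hol_at_eq[OF assms(1) \<omega>(2), of v] by (simp add: sc_eq_0_iff)
  then have "v$2 = 0" "v$1 = 0" using \<omega>(1) by (auto simp: complex_eq_iff)
  then show ?thesis by (simp add: vec_eq_iff forall_2)
qed

lemma pseudoholomorphic_immersionD:
  fixes A :: "('a, real^2) chart set" and B :: "('b, 'v) chart set"
  assumes "smooth_atlas A" "smooth_atlas B" and ph: "pseudoholomorphic_immersion A B (mult_i sc) f"
    and c: "c \<in> charts_at A x" and d: "d \<in> charts_at B (f x)"
  shows "hol_at (deriv_in_charts f c d x)"
proof -
  define D where "D = deriv_in_charts f c d x"
  have x: "x \<in> points A" using c by (auto simp: charts_at_points)
  have sm: "smooth_map A B f" using ph by (simp add: pseudoholomorphic_immersion_def immersion_def)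
  obtain u where u: "u \<in> tangent_space A x" "u c = axis 1 1" by (rule tangent_space_ex[OF assms(1) c])
  obtain v where v: "v \<in> tangent_space A x" "v c = axis 2 1" by (rule tangent_space_ex[OF assms(1) c])
  have "det (vector [u c, v c] :: real^2^2) > 0" by (simp add: u v det_2 axis_def)
  then have "positive_basis A x u v" using u(1) v(1) c by (auto simp: positive_basis_def)
  then have "complex_positive_basis (mult_i sc) (f x) (differential A B f x ` tangent_space A x)
      (differential A B f x u) (differential A B f x v)"
    using ph x unfolding pseudoholomorphic_immersion_def Let_def by blast
  then obtain e p q r s where e: "e \<in> differential A B f x ` tangent_space A x" "e \<noteq> (\<lambda>_. 0)"
    and du: "differential A B f x u = lincomb p e q (mult_i sc (f x) e)"
    and dv: "differential A B f x v = lincomb r e s (mult_i sc (f x) e)"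
    and pos: "p * s - q * r > 0"
    unfolding complex_positive_basis_def by blast
  have eT: "e \<in> tangent_space B (f x)"
    using e(1) differential_tangent_space[OF assms(1,2) sm _ x] by blast
  have ed: "e d \<noteq> 0"
  proof
    assume 0: "e d = 0"
    have "e = lincomb 0 e 0 e"
      by (rule tangent_space_eqI[OF eT lincomb_tangent_space[OF assms(2) eT eT] d]) (simp add: lincomb_def 0)
    then show False using e(2) by (simp add: lincomb_def)
  qed
  have D1: "D (axis 1 1) = sc (Complex p q) (e d)"
    using differential_eq[OF assms(1) sm u(1) c d] u(2)
    by (simp add: D_def du lincomb_def mult_i_def real_combination_sc)
  have D2: "D (axis 2 1) = sc (Complex r s) (e d)"
    using differential_eq[OF assms(1) sm v(1) c d] v(2)
    by (simp add: D_def dv lincomb_def mult_i_def real_combination_sc)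
  have nz: "Complex p q \<noteq> 0" using pos by (auto simp: complex_eq_iff)
  \<comment> \<open>Dividing the two complex coefficients removes the auxiliary vector
    \<open>e\<close>, and Im \<open>\<omega>\<close> becomes the positive determinant ps - qr over
    |p + iq|^2.\<close>
  define \<omega> where "\<omega> = Complex r s / Complex p q"
  have "Im \<omega> = (p * s - q * r) / (p\<^sup>2 + q\<^sup>2)"
    by (simp add: \<omega>_def Im_divide algebra_simps)
  moreover have "p\<^sup>2 + q\<^sup>2 > 0" using nz by (simp add: complex_eq_iff sum_power2_gt_zero_iff)
  ultimately have "Im \<omega> > 0" using pos by simp
  moreover have "D (axis 2 1) = sc \<omega> (D (axis 1 1))"
    unfolding D1 D2 sc_sc \<omega>_def using nz by simp
  moreover have "D (axis 1 1) \<noteq> 0" using D1 nz ed by (simp add: sc_eq_0_iff)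
  ultimately show ?thesis unfolding hol_at_def D_def by blast
qed

text \<open>One pair of charts per point suffices, because a tangent vector is determined by its
  coordinates in one chart. The hypothesis \<open>holB\<close> makes multiplication by i compatible
  with the transition maps, so that it preserves tangent vectors.\<close>

lemma pseudoholomorphic_immersionI:
  fixes A :: "('a, real^2) chart set" and B :: "('b, 'v) chart set"
  assumes A: "smooth_atlas A" "oriented A" and B: "smooth_atlas B" and sm: "smooth_map A B f"
    and holB: "\<And>p d d' v. d \<in> charts_at B p \<Longrightarrow> d' \<in> charts_at B p \<Longrightarrow>
      deriv_in_charts (\<lambda>x. x) d d' p (sc \<i> v) = sc \<i> (deriv_in_charts (\<lambda>x. x) d d' p v)"
    and hol: "\<And>x. x \<in> points A \<Longrightarrow> \<exists>c\<in>charts_at A x. \<exists>d\<in>charts_at B (f x). hol_at (deriv_in_charts f c d x)"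
  shows "pseudoholomorphic_immersion A B (mult_i sc) f"
proof -
  have main: "inj_on (differential A B f x) (tangent_space A x) \<and>
      complex_line_in B (mult_i sc) (f x) (differential A B f x ` tangent_space A x) \<and>
      (\<forall>u v. positive_basis A x u v \<longrightarrow> complex_positive_basis (mult_i sc) (f x)
         (differential A B f x ` tangent_space A x) (differential A B f x u) (differential A B f x v))"
    if x: "x \<in> points A" for x
  proof -
    obtain c d where c: "c \<in> charts_at A x" and d: "d \<in> charts_at B (f x)"
      and h: "hol_at (deriv_in_charts f c d x)" using hol[OF x] by blast
    define D where "D = deriv_in_charts f c d x"
    have lin: "linear D" unfolding D_def by (rule linear_deriv_in_charts[OF sm c d])
    obtain \<omega> where \<omega>: "0 < Im \<omega>" "D (axis 2 1) = sc \<omega> (D (axis 1 1))" "D (axis 1 1) \<noteq> 0"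
      using h by (auto simp: hol_at_def D_def)
    let ?df = "differential A B f x"
    have df: "?df t d = D (t c)" if "t \<in> tangent_space A x" for t
      unfolding D_def by (rule differential_eq[OF A(1) sm that c d])
    have dfT: "?df t \<in> tangent_space B (f x)" if "t \<in> tangent_space A x" for t
      by (rule differential_tangent_space[OF A(1) B sm that x])
    have inj: "inj_on ?df (tangent_space A x)"
    proof (rule inj_onI)
      fix t t' assume t: "t \<in> tangent_space A x" "t' \<in> tangent_space A x" "?df t = ?df t'"
      then have "D (t c - t' c) = 0" using df by (metis linear_diff[OF lin] right_minus_eq)
      then have "t c - t' c = 0" by (rule hol_at_inj[OF lin h[folded D_def]])
      then have "t c = t' c" by (simp only: right_minus_eq)
      then show "t = t'" by (rule tangent_space_eqI[OF t(1,2) c])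
    qed
    obtain u1 where u1: "u1 \<in> tangent_space A x" "u1 c = axis 1 1" by (rule tangent_space_ex[OF A(1) c])
    define e where "e = ?df u1"
    have eT: "e \<in> tangent_space B (f x)" unfolding e_def by (rule dfT[OF u1(1)])
    have ed: "e d = D (axis 1 1)" by (simp add: e_def df[OF u1(1)] u1(2))
    have e0: "e \<noteq> (\<lambda>_. 0)" using ed \<omega>(3) by auto
    have eL: "e \<in> ?df ` tangent_space A x" using u1(1) by (simp add: e_def)
    have JT: "mult_i sc (f x) e \<in> tangent_space B (f x)"
      unfolding tangent_space_iff mult_i_def
    proof (intro conjI ballI allI impI)
      fix d d' assume d: "d \<in> charts_at B (f x)" "d' \<in> charts_at B (f x)"
      then have "e d' = deriv_in_charts (\<lambda>x. x) d d' (f x) (e d)"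
        using eT unfolding tangent_space_iff by blast
      then show "sc \<i> (e d') = deriv_in_charts (\<lambda>x. x) d d' (f x) (sc \<i> (e d))"
        by (simp only: holB[OF d])
    next
      fix d assume "d \<notin> charts_at B (f x)"
      then have "e d = 0" using eT unfolding tangent_space_iff by blast
      then show "sc \<i> (e d) = 0" by (simp add: sc_0_right)
    qed
    \<comment> \<open>The factor t1 + t2 \<open>\<omega>\<close> of \<open>hol_at_eq\<close>, split
      into real and imaginary parts.\<close>
    have comb: "?df t = lincomb (t c $ 1 + t c $ 2 * Re \<omega>) e (t c $ 2 * Im \<omega>) (mult_i sc (f x) e)"
      if t: "t \<in> tangent_space A x" for t
    proof (rule tangent_space_eqI[OF dfT[OF t] lincomb_tangent_space[OF B eT JT] d])
      show "?df t d = lincomb (t c $ 1 + t c $ 2 * Re \<omega>) e (t c $ 2 * Im \<omega>) (mult_i sc (f x) e) d"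
        unfolding df[OF t] hol_at_eq[OF lin \<omega>(2), of "t c"] lincomb_def mult_i_def real_combination_sc ed
        by (rule arg_cong[of _ _ "\<lambda>z. sc z _"]) (simp add: complex_eq_iff)
    qed
    have "?df ` tangent_space A x = {lincomb a e b (mult_i sc (f x) e) | a b. True}"
    proof (intro equalityI subsetI)
      fix l assume "l \<in> {lincomb a e b (mult_i sc (f x) e) | a b. True}"
      then obtain a b where l: "l = lincomb a e b (mult_i sc (f x) e)" by blast
      \<comment> \<open>Solves t1 + t2 Re \<open>\<omega>\<close> = a and t2 Im
        \<open>\<omega>\<close> = b for the coordinates of \<open>t\<close>.\<close>
      obtain t where t: "t \<in> tangent_space A x" "t c = vector [a - b / Im \<omega> * Re \<omega>, b / Im \<omega>]"
        by (rule tangent_space_ex[OF A(1) c])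
      have "?df t = l" using \<omega>(1) by (simp add: comb[OF t(1)] l t(2))
      then show "l \<in> ?df ` tangent_space A x" using t(1) by blast
    qed (use comb in blast)
    then have cl: "complex_line_in B (mult_i sc) (f x) (?df ` tangent_space A x)"
      unfolding complex_line_in_def using eT e0 by blast
    have "complex_positive_basis (mult_i sc) (f x) (?df ` tangent_space A x) (?df u) (?df v)"
      if uv: "positive_basis A x u v" for u v
    proof -
      have uT: "u \<in> tangent_space A x" and vT: "v \<in> tangent_space A x" using uv by (auto simp: positive_basis_def)
      have "det (vector [u c, v c] :: real^2^2) > 0" by (rule positive_basis_chart[OF A uv c])
      then have "u c $ 1 * v c $ 2 - u c $ 2 * v c $ 1 > 0" by (simp add: det_2)
      \<comment> \<open>The determinant of the coefficients in \<open>comb\<close> is Im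
        \<open>\<omega>\<close> times that of the coordinates; the terms with Re
        \<open>\<omega>\<close> cancel.\<close>
      then have "Im \<omega> * (u c $ 1 * v c $ 2 - u c $ 2 * v c $ 1) > 0" using \<omega>(1) by simp
      then have "(u c $ 1 + u c $ 2 * Re \<omega>) * (v c $ 2 * Im \<omega>) - (u c $ 2 * Im \<omega>) * (v c $ 1 + v c $ 2 * Re \<omega>) > 0"
        by (simp add: algebra_simps)
      then show ?thesis
        unfolding complex_positive_basis_def using comb[OF uT] comb[OF vT] eL e0 by blast
    qed
    then show ?thesis using inj cl by blast
  qed
  show ?thesis
    unfolding pseudoholomorphic_immersion_def immersion_def Let_def using sm main by blast
qed

end

section \<open>Open submanifolds\<close>

lemma restrict_atlas_charts_at:
  "c' \<in> charts_at (restrict_atlas A W) x \<longleftrightarrow>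
     x \<in> W \<and> (\<exists>c\<in>charts_at A x. c' = (fst c \<inter> W, snd c))"
  unfolding restrict_atlas_def charts_at_def by force

lemma inj_charts_restrict: "inj_charts A \<Longrightarrow> inj_charts (restrict_atlas A W)"
  by (auto simp: inj_charts_def restrict_atlas_def intro: inj_on_subset)

text \<open>\<open>chart_inv\<close> depends on the chart domain, so shrinking the domain changes it
  as a function; agreement holds on the image of the smaller domain, which is enough for derivatives
  when that image is open.\<close>

lemma in_charts_restrict:
  assumes "inj_charts A" "c \<in> A" "z \<in> snd c ` (fst c \<inter> W)"
  shows "in_charts f (fst c \<inter> W, snd c) d z = in_charts f c d z"
proof -
  obtain y where y: "z = snd c y" "y \<in> fst c" "y \<in> W" using assms(3) by blast
  have "c \<in> charts_at A y" using y assms(2) by (simp add: charts_at_def)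
  moreover from this have "(fst c \<inter> W, snd c) \<in> charts_at (restrict_atlas A W) y"
    using y unfolding restrict_atlas_charts_at by blast
  ultimately show ?thesis
    using in_charts_chart[OF assms(1)] in_charts_chart[OF inj_charts_restrict[OF assms(1)]] y(1)
    by (metis snd_conv)
qed

lemma deriv_in_charts_restrict:
  assumes "inj_charts A" "c \<in> charts_at A x" "x \<in> W" "open (snd c ` (fst c \<inter> W))"
  shows "deriv_in_charts f (fst c \<inter> W, snd c) d x = deriv_in_charts f c d x"
proof -
  have z: "snd c x \<in> snd c ` (fst c \<inter> W)" using assms by (auto simp: charts_at_def)
  have eq: "in_charts f (fst c \<inter> W, snd c) d z = in_charts f c d z" if "z \<in> snd c ` (fst c \<inter> W)" for z
    using in_charts_restrict[OF assms(1) _ that] assms(2) by (simp add: charts_at_def)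
  have "(in_charts f (fst c \<inter> W, snd c) d has_derivative F) (at (snd c x)) \<longleftrightarrow> (in_charts f c d has_derivative F) (at (snd c x))" for F
    using has_derivative_transform_within_open[OF _ assms(4) z] eq by metis
  then show ?thesis by (simp add: deriv_in_charts_def frechet_derivative_def)
qed

lemma smooth_atlas_restrict:
  assumes A: "smooth_atlas A" and W: "\<And>c. c \<in> A \<Longrightarrow> open (snd c ` (fst c \<inter> W))"
  shows "smooth_atlas (restrict_atlas A W)"
proof -
  note i = smooth_atlas_inj_charts[OF A]
  have 1: "open (snd c ` (fst c \<inter> fst d \<inter> W)) \<and>
      smooth_on (snd c ` (fst c \<inter> fst d \<inter> W)) (transition (fst c \<inter> W, snd c) (fst d \<inter> W, snd d))"
    if cd: "c \<in> A" "d \<in> A" for c d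
  proof -
    have "inj_on (snd c) (fst c)" using i cd by (simp add: inj_charts_def)
    then have "snd c ` (fst c \<inter> fst d \<inter> W) = snd c ` (fst c \<inter> fst d) \<inter> snd c ` (fst c \<inter> W)"
      by (subst inj_on_image_Int[symmetric, of _ "fst c"]) (auto intro!: arg_cong[of _ _ "image (snd c)"])
    then have o: "open (snd c ` (fst c \<inter> fst d \<inter> W))"
      using A W[OF cd(1)] cd by (auto simp: smooth_atlas_def)
    have "smooth_on (snd c ` (fst c \<inter> fst d \<inter> W)) (transition c d)"
    proof (rule smooth_on_subset)
      show "smooth_on (snd c ` (fst c \<inter> fst d)) (transition c d)" using A cd by (simp add: smooth_atlas_def)
    qed blast
    moreover have "transition (fst c \<inter> W, snd c) (fst d \<inter> W, snd d) z = transition c d z"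
      if "z \<in> snd c ` (fst c \<inter> fst d \<inter> W)" for z
    proof -
      have "z \<in> snd c ` (fst c \<inter> W)" using that by blast
      from in_charts_restrict[OF i cd(1) this, of "\<lambda>x. x" "(fst d \<inter> W, snd d)"]
      show ?thesis unfolding in_charts_transition by (simp add: transition_def)
    qed
    ultimately show ?thesis using o smooth_on_cong[OF o] by metis
  qed
  have 2: "fst c \<inter> W \<inter> (fst d \<inter> W) = fst c \<inter> fst d \<inter> W" for c d :: "('a, 'b) chart" by blast
  show ?thesis
    using 1 W i
    by (auto simp: smooth_atlas_def restrict_atlas_def inj_charts_def 2 intro: inj_on_subset)
qed

lemma oriented_restrict:
  assumes A: "smooth_atlas A" "oriented A" and W: "\<And>c. c \<in> A \<Longrightarrow> open (snd c ` (fst c \<inter> W))"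
  shows "oriented (restrict_atlas A W)"
proof -
  note i = smooth_atlas_inj_charts[OF A(1)]
  have "det (matrix (frechet_derivative (transition (fst c \<inter> W, snd c) (fst d \<inter> W, snd d)) (at (snd c x)))) > 0"
    if "c \<in> A" "d \<in> A" "x \<in> fst c" "x \<in> fst d" "x \<in> W" for c d x
  proof -
    have c: "c \<in> charts_at A x" using that by (simp add: charts_at_def)
    have "frechet_derivative (transition (fst c \<inter> W, snd c) (fst d \<inter> W, snd d)) (at (snd c x)) =
       frechet_derivative (transition c d) (at (snd c x))"
      using deriv_in_charts_restrict[OF i c that(5) W[OF that(1)], of "\<lambda>x. x" "(fst d \<inter> W, snd d)"]
      by (simp add: deriv_in_charts_def in_charts_transition) (simp add: transition_def)
    then show ?thesis using A(2) that by (auto simp: oriented_def)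
  qed
  then show ?thesis by (auto simp: oriented_def restrict_atlas_def)
qed

section \<open>Charts of the projective plane\<close>

context hermitian_plane
begin

lemma fst_sc_prod [simp]: "fst (sc_prod sc a w) = sc a (fst w)"
  and snd_sc_prod [simp]: "snd (sc_prod sc a w) = a * snd w"
  by (simp_all add: sc_prod_def)

lemma sc_prod_sc_prod: "sc_prod sc a (sc_prod sc b w) = sc_prod sc (a * b) w"
  by (simp add: prod_eq_iff sc_sc)

lemma sc_prod_1: "sc_prod sc 1 w = w"
  by (simp add: prod_eq_iff sc_1)

lemma sc_prod_of_real: "sc_prod sc (of_real r) w = r *\<^sub>R w"
  by (simp add: prod_eq_iff sc_of_real scaleR_conv_of_real)

lemma sc_prod_eq_0_iff: "sc_prod sc a w = 0 \<longleftrightarrow> a = 0 \<or> w = 0"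
  by (auto simp: prod_eq_iff sc_eq_0_iff)

lemma vector_space_sc_prod: "vector_space (sc_prod sc)"
  by unfold_locales (simp_all add: prod_eq_iff sc_add_right sc_add_left sc_sc sc_1 algebra_simps)

lemma pline_self: "w \<in> pline sc w"
  unfolding pline_def by (metis rangeI sc_prod_1)

lemma pline_sc_prod:
  assumes "a \<noteq> 0"
  shows "pline sc (sc_prod sc a w) = pline sc w"
proof -
  have "range (\<lambda>b. sc_prod sc b (sc_prod sc a w)) \<subseteq> range (\<lambda>b. sc_prod sc b w)"
    unfolding sc_prod_sc_prod by blast
  moreover have "sc_prod sc b w = sc_prod sc (b / a) (sc_prod sc a w)" for b
    using assms by (simp add: sc_prod_sc_prod)
  then have "range (\<lambda>b. sc_prod sc b w) \<subseteq> range (\<lambda>b. sc_prod sc b (sc_prod sc a w))"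
    by (metis (no_types, lifting) image_subsetI rangeI)
  ultimately show ?thesis unfolding pline_def by blast
qed

lemma pline_eqD: "pline sc w = pline sc w' \<Longrightarrow> \<exists>a. w = sc_prod sc a w'"
  using pline_self[of w] by (auto simp: pline_def)

text \<open>\<open>S\<close>, the inverse of \<open>T\<close>, supplies homogeneous coordinates
  adapted to the chart: the chart map is the quotient of the two components of \<open>S w\<close>.
  All properties of a chart that are used later are collected here.\<close>

definition chart_frame :: "(('v \<times> complex) set, 'v) chart \<Rightarrow> ('v \<times> complex \<Rightarrow> 'v \<times> complex) \<Rightarrow>
    ('v \<times> complex \<Rightarrow> 'v \<times> complex) \<Rightarrow> bool" where
  "chart_frame d T S \<longleftrightarrow> d = proj_chart sc T \<and> bounded_linear T \<and> bounded_linear S \<and>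
     (\<forall>a w. S (sc_prod sc a w) = sc_prod sc a (S w)) \<and> (\<forall>w. S (T w) = w) \<and> (\<forall>w. T (S w) = w) \<and>
     (\<forall>w. pline sc w \<in> fst d \<longleftrightarrow> snd (S w) \<noteq> 0) \<and>
     (\<forall>w. snd (S w) \<noteq> 0 \<longrightarrow> snd d (pline sc w) = sc (inverse (snd (S w))) (fst (S w)))"

lemma chart_frameD:
  assumes "chart_frame d T S"
  shows "d = proj_chart sc T" "bounded_linear T" "bounded_linear S"
    "S (sc_prod sc a w) = sc_prod sc a (S w)" "S (T w) = w" "T (S w) = w"
    "pline sc w \<in> fst d \<longleftrightarrow> snd (S w) \<noteq> 0"
    "snd (S w) \<noteq> 0 \<Longrightarrow> snd d (pline sc w) = sc (inverse (snd (S w))) (fst (S w))"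
  using assms unfolding chart_frame_def by blast+

lemma chart_frame_proj_chart:
  assumes T: "Vector_Spaces.linear (sc_prod sc) (sc_prod sc) T" "bij T"
  shows "chart_frame (proj_chart sc T) T (inv T)"
proof -
  define d where d: "d = proj_chart sc T"
  define S where "S = inv T"
  have ST: "S (T w) = w" and TS: "T (S w) = w" for w
    using T(2) by (simp_all add: S_def bij_is_inj bij_is_surj surj_f_inv_f)
  have Tadd: "T (v + w) = T v + T w" and Tsc: "T (sc_prod sc a w) = sc_prod sc a (T w)" for v w a
    using T(1) unfolding Vector_Spaces.linear_iff by blast+
  have Sadd: "S (v + w) = S v + S w" for v w
    by (metis ST TS Tadd)
  have Ssc: "S (sc_prod sc a w) = sc_prod sc a (S w)" for a w
    by (metis ST TS Tsc)
  have bl: "bounded_linear T" "bounded_linear S"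
    unfolding linear_conv_bounded_linear[symmetric]
    by (rule linearI; simp add: Tadd Sadd Tsc Ssc sc_prod_of_real[symmetric])+
  have uniq: "y = y'" if "pline sc (T (y, 1)) = pline sc (T (y', 1))" for y y'
  proof -
    obtain a where "T (y, 1) = sc_prod sc a (T (y', 1))" using pline_eqD \<open>pline sc _ = _\<close> by blast
    then have "(y, 1) = sc_prod sc a (y', 1)" by (metis ST Tsc)
    then show ?thesis by (auto simp: prod_eq_iff sc_1)
  qed
  have rep: "pline sc w = pline sc (T (sc (inverse (snd (S w))) (fst (S w)), 1))" if "snd (S w) \<noteq> 0" for w
  proof -
    have "S w = sc_prod sc (snd (S w)) (sc (inverse (snd (S w))) (fst (S w)), 1)"
      using that by (simp add: prod_eq_iff sc_sc sc_1)
    then have "w = sc_prod sc (snd (S w)) (T (sc (inverse (snd (S w))) (fst (S w)), 1))"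
      by (metis TS Tsc)
    then show ?thesis using pline_sc_prod[OF that] by metis
  qed
  have mem: "pline sc w \<in> fst d \<longleftrightarrow> snd (S w) \<noteq> 0" for w
  proof
    assume "pline sc w \<in> fst d"
    then obtain y where "pline sc w = pline sc (T (y, 1))" by (auto simp: d proj_chart_def)
    then obtain a where "T (y, 1) = sc_prod sc a w" using pline_eqD by metis
    then have "(y, 1) = sc_prod sc a (S w)" by (metis ST Ssc)
    then show "snd (S w) \<noteq> 0" by (auto simp: prod_eq_iff)
  qed (use rep in \<open>auto simp: d proj_chart_def\<close>)
  have val: "snd d (pline sc w) = sc (inverse (snd (S w))) (fst (S w))" if "snd (S w) \<noteq> 0" for w
    unfolding d proj_chart_def snd_conv
    using rep[OF that] uniq by (intro the_equality) auto
  have "chart_frame d T S" unfolding chart_frame_def using d bl Ssc ST TS mem val by blast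
  then show ?thesis by (simp only: d S_def)
qed

lemma proj_atlas_frame: "d \<in> proj_atlas sc \<Longrightarrow> \<exists>T S. chart_frame d T S"
  using chart_frame_proj_chart unfolding proj_atlas_def by blast

text \<open>The differential at \<open>w\<close> of the projection from \<open>V \<times> C\<close>
  to the projective plane, read in the chart \<open>d\<close>. Tangent vectors at the line of
  \<open>w\<close> are thus represented by vectors of \<open>V \<times> C\<close> modulo multiples
  of \<open>w\<close>.\<close>

definition dcoord :: "(('v \<times> complex) set, 'v) chart \<Rightarrow> 'v \<times> complex \<Rightarrow> 'v \<times> complex \<Rightarrow> 'v" where
  "dcoord d w = frechet_derivative (\<lambda>w. snd d (pline sc w)) (at w)"

lemma open_pline_dom:
  assumes "d \<in> proj_atlas sc"
  shows "open {w. pline sc w \<in> fst d}"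
proof -
  obtain T S where F: "chart_frame d T S" using proj_atlas_frame[OF assms] by blast
  note S = chart_frameD(3)[OF F] and mem = chart_frameD(7)[OF F]
  have "continuous_on UNIV (\<lambda>w. snd (S w))"
    by (intro continuous_on_snd linear_continuous_on S)
  then have "open ((\<lambda>w. snd (S w)) -` (- {0}))" by (intro open_vimage) auto
  moreover have "(\<lambda>w. snd (S w)) -` (- {0}) = {w. pline sc w \<in> fst d}" by (auto simp: mem)
  ultimately show ?thesis by simp
qed

lemma pline_dom_nonzero: "d \<in> proj_atlas sc \<Longrightarrow> pline sc w \<in> fst d \<Longrightarrow> w \<noteq> 0"
proof -
  assume a: "d \<in> proj_atlas sc" and w: "pline sc w \<in> fst d"
  obtain T S where F: "chart_frame d T S" using proj_atlas_frame[OF a] by blast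
  note S = chart_frameD(3)[OF F] and mem = chart_frameD(7)[OF F]
  show "w \<noteq> 0" using w mem[of 0] linear_0[OF bounded_linear.linear[OF S]] by auto
qed

lemma smooth_on_coord:
  assumes "d \<in> proj_atlas sc"
  shows "smooth_on {w. pline sc w \<in> fst d} (\<lambda>w. snd d (pline sc w))"
proof -
  obtain T S where F: "chart_frame d T S" using proj_atlas_frame[OF assms] by blast
  note S = chart_frameD(3)[OF F] and mem = chart_frameD(7)[OF F] and val = chart_frameD(8)[OF F]
  note o = open_pline_dom[OF assms]
  have "smooth_on {w. pline sc w \<in> fst d} S"
    by (rule smooth_on_bounded_linear[OF o S smooth_on_id[OF o]])
  then have "smooth_on {w. pline sc w \<in> fst d} (\<lambda>w. sc (inverse (snd (S w))) (fst (S w)))"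
    by (intro smooth_on_sc smooth_on_inverse smooth_on_snd smooth_on_fst o) (simp_all add: mem)
  then show ?thesis
    using smooth_on_cong[OF o, of "\<lambda>w. snd d (pline sc w)" "\<lambda>w. sc (inverse (snd (S w))) (fst (S w))"] val mem
    by simp
qed

lemma has_derivative_coord:
  assumes "d \<in> proj_atlas sc" "pline sc w \<in> fst d"
  shows "((\<lambda>w. snd d (pline sc w)) has_derivative dcoord d w) (at w)"
  unfolding dcoord_def by (rule smooth_on_has_derivative[OF smooth_on_coord[OF assms(1)]]) (simp add: assms(2))

text \<open>Everything follows from the quotient rule for the components of \<open>S w\<close>: up
  to a nonzero factor, the derivative subtracts from \<open>S v\<close> the multiple of
  \<open>S w\<close> that cancels its last component.\<close>

lemma dcoord:
  assumes "d \<in> proj_atlas sc" "pline sc w \<in> fst d"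
  shows linear_dcoord: "linear (dcoord d w)"
    and dcoord_sc_prod: "dcoord d w (sc_prod sc a v) = sc a (dcoord d w v)"
    and dcoord_eq_0_iff: "dcoord d w v = 0 \<longleftrightarrow> (\<exists>a. v = sc_prod sc a w)"
    and dcoord_surj: "\<exists>v. dcoord d w v = y"
proof -
  obtain T S where F: "chart_frame d T S" using proj_atlas_frame[OF assms(1)] by blast
  note T = chart_frameD(2)[OF F] and S = chart_frameD(3)[OF F] and Ssc = chart_frameD(4)[OF F]
    and ST = chart_frameD(5)[OF F] and TS = chart_frameD(6)[OF F] and mem = chart_frameD(7)[OF F]
    and val = chart_frameD(8)[OF F]
  note o = open_pline_dom[OF assms(1)]
  note hd = has_derivative_coord[OF assms]
  define z where "z = snd (S w)"
  have z: "z \<noteq> 0" using assms(2) mem by (simp add: z_def)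
  have dS: "((\<lambda>w. snd (S w)) has_derivative (\<lambda>v. snd (S v))) (at w)"
    "((\<lambda>w. fst (S w)) has_derivative (\<lambda>v. fst (S v))) (at w)"
    by (intro has_derivative_snd has_derivative_fst bounded_linear_imp_has_derivative S)+
  have "((\<lambda>w. sc (inverse (snd (S w))) (fst (S w))) has_derivative
     (\<lambda>v. sc (inverse (snd (S w))) (fst (S v)) + sc (- (inverse (snd (S w)) * snd (S v) * inverse (snd (S w)))) (fst (S w)))) (at w)"
    using z unfolding z_def
    by (intro bounded_bilinear.FDERIV[OF bounded_bilinear_sc] Deriv.has_derivative_inverse dS)
  then have "((\<lambda>w. snd d (pline sc w)) has_derivative
     (\<lambda>v. sc (inverse (snd (S w))) (fst (S v)) + sc (- (inverse (snd (S w)) * snd (S v) * inverse (snd (S w)))) (fst (S w)))) (at w)"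
    by (rule has_derivative_transform_within_open[OF _ o]) (use assms(2) mem val in auto)
  then have D: "dcoord d w v = sc (inverse z) (fst (S v) - sc (snd (S v) * inverse z) (fst (S w)))" for v
    using has_derivative_unique[OF hd] by (simp add: z_def sc_diff_right sc_sc sc_minus_left mult.assoc)
  show "linear (dcoord d w)" using hd has_derivative_linear by blast
  show "dcoord d w (sc_prod sc a v) = sc a (dcoord d w v)"
    by (simp add: D Ssc sc_sc sc_diff_right mult_ac)
  show "dcoord d w v = 0 \<longleftrightarrow> (\<exists>a. v = sc_prod sc a w)"
  proof
    assume "dcoord d w v = 0"
    then have "fst (S v) = sc (snd (S v) * inverse z) (fst (S w))" using z by (simp add: D sc_eq_0_iff)
    then have "S v = sc_prod sc (snd (S v) * inverse z) (S w)" using z by (simp add: prod_eq_iff z_def)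
    then have "S v = S (sc_prod sc (snd (S v) * inverse z) w)" by (simp only: Ssc)
    then show "\<exists>a. v = sc_prod sc a w" using TS by metis
  next
    assume "\<exists>a. v = sc_prod sc a w"
    then obtain a where "v = sc_prod sc a w" by blast
    then show "dcoord d w v = 0" using z by (simp add: D Ssc z_def[symmetric] sc_0_right mult.assoc)
  qed
  \<comment> \<open>A vector whose last adapted coordinate is 0 is merely divided by
    \<open>z\<close>; prescaling by \<open>z\<close> compensates.\<close>
  have "dcoord d w (T (sc z y, 0)) = y"
    using z by (simp add: D ST sc_0_left sc_sc sc_1)
  then show "\<exists>v. dcoord d w v = y" by blast
qed

text \<open>An affine section of the projection over the chart domain. Composed with a map into the
  projective plane, it produces local lifts.\<close>

definition chart_section :: "(('v \<times> complex) set, 'v) chart \<Rightarrow> ('v \<Rightarrow> 'v \<times> complex) \<Rightarrow>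
    ('v \<Rightarrow> 'v \<times> complex) \<Rightarrow> bool" where
  "chart_section d L DL \<longleftrightarrow> smooth_on UNIV L \<and> (\<forall>y. (L has_derivative DL) (at y)) \<and>
     (\<forall>y. pline sc (L y) \<in> fst d) \<and> (\<forall>y. snd d (pline sc (L y)) = y) \<and>
     (\<forall>l\<in>fst d. pline sc (L (snd d l)) = l) \<and> (\<forall>y v. dcoord d (L y) (DL v) = v)"

lemma chart_sectionD:
  assumes "chart_section d L DL"
  shows "smooth_on UNIV L" "(L has_derivative DL) (at y)" "pline sc (L y) \<in> fst d"
    "snd d (pline sc (L y)) = y" "l \<in> fst d \<Longrightarrow> pline sc (L (snd d l)) = l" "dcoord d (L y) (DL v) = v"
  using assms unfolding chart_section_def by blast+

lemma proj_chart_section: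
  assumes "d \<in> proj_atlas sc"
  shows "\<exists>L DL. chart_section d L DL"
proof -
  obtain T S where F: "chart_frame d T S" using proj_atlas_frame[OF assms] by blast
  note d = chart_frameD(1)[OF F] and T = chart_frameD(2)[OF F] and ST = chart_frameD(5)[OF F]
    and mem = chart_frameD(7)[OF F] and val = chart_frameD(8)[OF F]
  define L where "L y = T (y, 1)" for y
  define DL where "DL v = T (v, 0)" for v
  have 1: "smooth_on UNIV L"
    unfolding L_def by (intro smooth_on_bounded_linear[OF _ T] smooth_on_Pair smooth_on_id smooth_on_const open_UNIV)
  have 2: "(L has_derivative DL) (at y)" for y
    unfolding L_def DL_def
    by (intro bounded_linear.has_derivative[OF T] has_derivative_Pair has_derivative_ident has_derivative_const)
  have 3: "pline sc (L y) \<in> fst d" for y by (simp add: mem L_def ST)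
  have 4: "snd d (pline sc (L y)) = y" for y by (simp add: val L_def ST sc_1)
  have 5: "pline sc (L (snd d l)) = l" if l: "l \<in> fst d" for l
  proof -
    obtain y where "l = pline sc (L y)" using l by (auto simp: d proj_chart_def L_def)
    then show ?thesis by (simp add: 4)
  qed
  have 6: "dcoord d (L y) (DL v) = v" for y v
  proof -
    have "((\<lambda>y. snd d (pline sc (L y))) has_derivative (\<lambda>v. dcoord d (L y) (DL v))) (at y)"
      by (rule has_derivative_compose[OF 2 has_derivative_coord[OF assms 3]])
    then have "((\<lambda>y. y) has_derivative (\<lambda>v. dcoord d (L y) (DL v))) (at y)" by (simp only: 4)
    from has_derivative_unique[OF this has_derivative_ident] show ?thesis by metis
  qed
  show ?thesis unfolding chart_section_def using 1 2 3 4 5 6 by blast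
qed

lemma inj_charts_proj: "inj_charts (proj_atlas sc)"
  unfolding inj_charts_def
proof
  fix d assume d: "d \<in> proj_atlas sc"
  obtain L DL where L: "chart_section d L DL" using proj_chart_section[OF d] by blast
  note L3 = chart_sectionD(5)[OF L]
  show "inj_on (snd d) (fst d)" by (rule inj_on_inverseI[where g="\<lambda>y. pline sc (L y)"]) (rule L3)
qed

text \<open>A transition map is the second coordinate map after the section over the first chart, so
  the linear fractional formulas need not be written out.\<close>

lemma smooth_atlas_proj: "smooth_atlas (proj_atlas sc)"
  unfolding smooth_atlas_def
proof (intro conjI ballI)
  fix c assume c: "c \<in> proj_atlas sc"
  show "inj_on (snd c) (fst c)" using inj_charts_proj c by (simp add: inj_charts_def)
  obtain L DL where L: "chart_section c L DL" using proj_chart_section[OF c] by blast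
  note smL = chart_sectionD(1)[OF L] and L1 = chart_sectionD(3)[OF L] and L2 = chart_sectionD(4)[OF L]
    and L3 = chart_sectionD(5)[OF L]
  have "snd c ` fst c = UNIV" using L1 L2 by (metis UNIV_eq_I imageI)
  then show "open (snd c ` fst c)" by simp
  fix d assume d: "d \<in> proj_atlas sc"
  have im: "snd c ` (fst c \<inter> fst d) = L -` {w. pline sc w \<in> fst d}"
  proof (intro equalityI subsetI)
    fix y assume "y \<in> L -` {w. pline sc w \<in> fst d}"
    then have "pline sc (L y) \<in> fst c \<inter> fst d" using L1 by simp
    then show "y \<in> snd c ` (fst c \<inter> fst d)" using L2 by (metis imageI)
  qed (use L3 in auto)
  have "continuous_on UNIV L" by (rule smooth_on_imp_continuous_on[OF smL])
  then have o: "open (L -` {w. pline sc w \<in> fst d})" by (rule open_vimage[OF open_pline_dom[OF d]])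
  then show "open (snd c ` (fst c \<inter> fst d))" by (simp only: im)
  have "smooth_on (L -` {w. pline sc w \<in> fst d}) (\<lambda>y. snd d (pline sc (L y)))"
    by (rule smooth_on_compose[OF o open_pline_dom[OF d] smooth_on_coord[OF d] smooth_on_subset[OF smL]]) auto
  moreover have "transition c d = (\<lambda>y. snd d (pline sc (L y)))"
  proof
    fix y
    have "chart_inv c (snd c (pline sc (L y))) = pline sc (L y)"
      by (rule chart_inv_chart[OF inj_charts_proj]) (simp add: charts_at_def c L1)
    then show "transition c d y = snd d (pline sc (L y))" by (simp add: transition_def L2)
  qed
  ultimately show "smooth_on (snd c ` (fst c \<inter> fst d)) (transition c d)"
    by (simp only: im)
qed

text \<open>The chain rule for the coordinate maps as functions of \<open>w\<close>. Hence one
  vector of \<open>V \<times> C\<close> represents the same tangent vector in every chart, as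
  exploited in \<open>tangent_space_proj\<close> and \<open>tangent_space_projE\<close>.\<close>

lemma transition_dcoord:
  assumes d: "d \<in> charts_at (proj_atlas sc) (pline sc w)" and d': "d' \<in> charts_at (proj_atlas sc) (pline sc w)"
  shows "deriv_in_charts (\<lambda>x. x) d d' (pline sc w) (dcoord d w v) = dcoord d' w v"
proof -
  have mem: "d \<in> proj_atlas sc" "pline sc w \<in> fst d" "d' \<in> proj_atlas sc" "pline sc w \<in> fst d'"
    using d d' by (auto simp: charts_at_def)
  have "((\<lambda>w. in_charts (\<lambda>x. x) d d' (snd d (pline sc w))) has_derivative
      (\<lambda>v. deriv_in_charts (\<lambda>x. x) d d' (pline sc w) (dcoord d w v))) (at w)"
    by (rule has_derivative_compose[OF has_derivative_coord[OF mem(1,2)]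
       has_derivative_in_charts[OF smooth_map_ident[OF smooth_atlas_proj] d d']])
  then have "((\<lambda>w. snd d' (pline sc w)) has_derivative
      (\<lambda>v. deriv_in_charts (\<lambda>x. x) d d' (pline sc w) (dcoord d w v))) (at w)"
  proof (rule has_derivative_transform_within_open[OF _ open_pline_dom[OF mem(1)]])
    fix w assume "w \<in> {w. pline sc w \<in> fst d}"
    then show "in_charts (\<lambda>x. x) d d' (snd d (pline sc w)) = snd d' (pline sc w)"
      using mem(1) by (intro in_charts_chart[OF inj_charts_proj]) (simp add: charts_at_def)
  qed (simp add: mem)
  from has_derivative_unique[OF this has_derivative_coord[OF mem(3,4)]] show ?thesis by metis
qed

lemma pline_in_points_cases:
  assumes "l \<in> points (proj_atlas sc)"
  obtains w where "w \<noteq> 0" "l = pline sc w"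
proof -
  obtain d where d: "d \<in> proj_atlas sc" "l \<in> fst d" using assms by (auto simp: points_def)
  obtain L DL where L: "chart_section d L DL" using proj_chart_section[OF d(1)] by blast
  note L3 = chart_sectionD(5)[OF L]
  have "pline sc (L (snd d l)) = l" by (rule L3[OF d(2)])
  then show thesis using pline_dom_nonzero[OF d(1)] d(2) that by metis
qed

text \<open>Holomorphy of the transition maps without computing them: the vector is represented in
  \<open>V \<times> C\<close>, where \<open>dcoord\<close> is complex linear for both
  charts.\<close>

lemma transition_proj_sc:
  assumes d: "d \<in> charts_at (proj_atlas sc) p" and d': "d' \<in> charts_at (proj_atlas sc) p"
  shows "deriv_in_charts (\<lambda>x. x) d d' p (sc \<i> y) = sc \<i> (deriv_in_charts (\<lambda>x. x) d d' p y)"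
proof -
  obtain w where w: "p = pline sc w"
    using pline_in_points_cases d by (metis charts_at_points empty_iff)
  have mem: "d \<in> proj_atlas sc" "pline sc w \<in> fst d" "d' \<in> proj_atlas sc" "pline sc w \<in> fst d'"
    using d d' by (auto simp: charts_at_def w)
  obtain v where v: "dcoord d w v = y" using dcoord_surj[OF mem(1,2)] by blast
  show ?thesis
    unfolding v[symmetric] dcoord_sc_prod[OF mem(1,2), symmetric]
    unfolding w transition_dcoord[OF d[unfolded w] d'[unfolded w]] dcoord_sc_prod[OF mem(3,4)] ..
qed

lemma tangent_space_proj:
  assumes "\<And>d. d \<in> charts_at (proj_atlas sc) (pline sc w) \<Longrightarrow> t d = dcoord d w v"
    and "\<And>d. d \<notin> charts_at (proj_atlas sc) (pline sc w) \<Longrightarrow> t d = 0"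
  shows "t \<in> tangent_space (proj_atlas sc) (pline sc w)"
  unfolding tangent_space_iff using assms transition_dcoord by simp

lemma tangent_space_projE:
  assumes t: "t \<in> tangent_space (proj_atlas sc) (pline sc w)" and d: "d \<in> charts_at (proj_atlas sc) (pline sc w)"
  obtains v where "\<And>d. d \<in> charts_at (proj_atlas sc) (pline sc w) \<Longrightarrow> t d = dcoord d w v"
proof -
  have mem: "d \<in> proj_atlas sc" "pline sc w \<in> fst d" using d by (auto simp: charts_at_def)
  obtain v where v: "dcoord d w v = t d" using dcoord_surj[OF mem] by blast
  show thesis
  proof (rule that[of v])
    fix d' assume d': "d' \<in> charts_at (proj_atlas sc) (pline sc w)"
    have "t d' = deriv_in_charts (\<lambda>x. x) d d' (pline sc w) (t d)"
      using t d d' unfolding tangent_space_iff by blast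
    then show "t d' = dcoord d' w v" unfolding v[symmetric] transition_dcoord[OF d d'] .
  qed
qed

section \<open>The projection, the line at infinity and the points of the plane\<close>

lemma pr_pline:
  assumes "w \<noteq> 0"
  shows "pr sc (pline sc w) = (if snd w \<noteq> 0 then Pt (sc (1 / snd w) (fst w)) else Infty)"
  unfolding pr_def
proof (rule the_equality)
  show "\<exists>y z. (y, z) \<noteq> 0 \<and> pline sc w = pline sc (y, z) \<and>
      (if snd w \<noteq> 0 then Pt (sc (1 / snd w) (fst w)) else Infty) = (if z \<noteq> 0 then Pt (sc (1 / z) y) else Infty)"
    using assms by (intro exI[of _ "fst w"] exI[of _ "snd w"]) simp
  fix s assume "\<exists>y z. (y, z) \<noteq> 0 \<and> pline sc w = pline sc (y, z) \<and> s = (if z \<noteq> 0 then Pt (sc (1 / z) y) else Infty)"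
  then obtain y z where yz: "(y, z) \<noteq> 0" "pline sc w = pline sc (y, z)" and s: "s = (if z \<noteq> 0 then Pt (sc (1 / z) y) else Infty)"
    by blast
  obtain a where a: "w = sc_prod sc a (y, z)" using pline_eqD[OF yz(2)] by blast
  then have "a \<noteq> 0" using assms by (auto simp: sc_prod_eq_0_iff)
  then show "s = (if snd w \<noteq> 0 then Pt (sc (1 / snd w) (fst w)) else Infty)"
    by (simp add: a s sc_sc)
qed

lemma line_at_infinity_iff:
  assumes "w \<noteq> 0"
  shows "pline sc w \<in> line_at_infinity sc \<longleftrightarrow> snd w = 0"
proof
  assume "pline sc w \<in> line_at_infinity sc"
  then obtain y where "pline sc w = pline sc (y, 0)" by (auto simp: line_at_infinity_def)
  then obtain a where "w = sc_prod sc a (y, 0)" using pline_eqD by blast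
  then show "snd w = 0" by simp
next
  assume "snd w = 0"
  then have "w = (fst w, 0)" "fst w \<noteq> 0" using assms by (auto simp: prod_eq_iff)
  then show "pline sc w \<in> line_at_infinity sc"
    unfolding line_at_infinity_def by (metis (mono_tags, lifting) mem_Collect_eq)
qed

lemma proj_chart_in_atlas:
  assumes "\<And>v w. T (v + w) = T v + T w" "\<And>a w. T (sc_prod sc a w) = sc_prod sc a (T w)" "bij T"
  shows "proj_chart sc T \<in> proj_atlas sc"
  using assms vector_space_sc_prod unfolding proj_atlas_def Vector_Spaces.linear_iff by blast

definition plane_chart :: "(('v \<times> complex) set, 'v) chart" where
  "plane_chart = proj_chart sc id"

lemma plane_chart_in_atlas: "plane_chart \<in> proj_atlas sc"
  unfolding plane_chart_def by (rule proj_chart_in_atlas) auto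

lemma plane_chart_pline:
  shows "pline sc w \<in> fst plane_chart \<longleftrightarrow> snd w \<noteq> 0"
    and "snd w \<noteq> 0 \<Longrightarrow> snd plane_chart (pline sc w) = sc (1 / snd w) (fst w)"
proof -
  have "Vector_Spaces.linear (sc_prod sc) (sc_prod sc) id"
    unfolding Vector_Spaces.linear_iff using vector_space_sc_prod by simp
  then have F: "chart_frame plane_chart id id"
    unfolding plane_chart_def using chart_frame_proj_chart[of id] by simp
  show "pline sc w \<in> fst plane_chart \<longleftrightarrow> snd w \<noteq> 0" using chart_frameD(7)[OF F] by simp
  show "snd w \<noteq> 0 \<Longrightarrow> snd plane_chart (pline sc w) = sc (1 / snd w) (fst w)"
    using chart_frameD(8)[OF F] by (simp add: divide_inverse)
qed

text \<open>The complex linear involution that exchanges the unit vector \<open>e\<close> of \<open>V\<close> and the basis vector of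
  \<open>C\<close>, and fixes the orthogonal complement of \<open>e\<close>.\<close>

definition swap_map :: "'v \<Rightarrow> 'v \<times> complex \<Rightarrow> 'v \<times> complex" where
  "swap_map e w = (fst w - sc (herm (fst w) e) e + sc (snd w) e, herm (fst w) e)"

text \<open>Lines outside infinity lie in the chart \<open>plane_chart\<close>. A line [y, 0] is the
  centre of the chart of \<open>swap_map e\<close> with e = y/|y|, since \<open>swap_map e\<close>
  sends (0, 1) to (e, 0).\<close>

lemma pline_in_points:
  assumes "w \<noteq> 0"
  shows "pline sc w \<in> points (proj_atlas sc)"
proof (cases "snd w = 0")
  case False
  then show ?thesis using plane_chart_in_atlas plane_chart_pline(1) unfolding points_def by blast
next
  case True
  then have fw: "fst w \<noteq> 0" using assms by (auto simp: prod_eq_iff)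
  define e where "e = fst w /\<^sub>R norm (fst w)"
  have ne: "norm e = 1" using fw by (simp add: e_def)
  have ee: "herm e e = 1" by (simp add: herm_norm ne)
  have inv: "swap_map e (swap_map e v) = v" for v
    by (simp add: swap_map_def prod_eq_iff herm_add herm_diff herm_sc ee sc_add_left sc_diff_left)
  then have "bij (swap_map e)" by (metis involuntory_imp_bij)
  moreover have "swap_map e (u + v) = swap_map e u + swap_map e v" for u v
    by (simp add: swap_map_def prod_eq_iff herm_add sc_add_left)
  moreover have "swap_map e (sc_prod sc a v) = sc_prod sc a (swap_map e v)" for a v
    by (simp add: swap_map_def prod_eq_iff herm_sc sc_add_right sc_diff_right sc_sc)
  ultimately have A: "proj_chart sc (swap_map e) \<in> proj_atlas sc" by (intro proj_chart_in_atlas)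
  have "w = norm (fst w) *\<^sub>R (e, 0)" using True fw by (simp add: prod_eq_iff e_def)
  then have "w = sc_prod sc (of_real (norm (fst w))) (e, 0)" by (simp only: sc_prod_of_real)
  then have "pline sc w = pline sc (e, 0)" using fw pline_sc_prod by (metis norm_eq_zero of_real_eq_0_iff)
  also have "(e, 0) = swap_map e (0, 1)"
    by (simp add: swap_map_def sc_1 herm_0_left sc_0_left)
  finally have "pline sc w \<in> fst (proj_chart sc (swap_map e))" by (auto simp: proj_chart_def)
  then show ?thesis using A unfolding points_def by blast
qed

section \<open>Local lifts of maps into the projective plane\<close>

definition lift_at :: "('a \<Rightarrow> ('v \<times> complex) set) \<Rightarrow> ('a, 'e::euclidean_space) chart \<Rightarrow> 'a \<Rightarrow> 'e set \<Rightarrow>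
    ('e \<Rightarrow> 'v \<times> complex) \<Rightarrow> bool" where
  "lift_at f c x N w \<longleftrightarrow> open N \<and> snd c x \<in> N \<and> N \<subseteq> snd c ` fst c \<and> smooth_on N w \<and>
     (\<forall>z\<in>N. w z \<noteq> 0 \<and> f (chart_inv c z) = pline sc (w z))"

text \<open>Lifts are constructed in one chosen chart at each point, while \<open>smooth_map\<close>
  quantifies over all charts.\<close>

lemma lift_at_transport:
  assumes A: "smooth_atlas A" and c: "c \<in> charts_at A x" and c': "c' \<in> charts_at A x" and l: "lift_at f c x N w"
  shows "\<exists>N' w'. lift_at f c' x N' w'"
proof -
  note i = smooth_atlas_inj_charts[OF A]
  let ?O = "snd c' ` (fst c' \<inter> fst c)"
  have O: "open ?O" "smooth_on ?O (transition c' c)" "snd c' x \<in> ?O"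
    using A c c' by (auto simp: smooth_atlas_def charts_at_def)
  have tr: "transition c' c z = snd c y \<and> chart_inv c' z = y \<and> chart_inv c (snd c y) = y"
    if "z = snd c' y" "y \<in> fst c'" "y \<in> fst c" for z y
  proof -
    have "c' \<in> charts_at A y" "c \<in> charts_at A y" using that c c' by (auto simp: charts_at_def)
    then show ?thesis using chart_inv_chart[OF i] that(1) by (simp add: transition_def)
  qed
  define N' where "N' = ?O \<inter> transition c' c -` N"
  have N: "open N" "snd c x \<in> N" "smooth_on N w" and lw: "\<And>z. z \<in> N \<Longrightarrow> w z \<noteq> 0 \<and> f (chart_inv c z) = pline sc (w z)"
    using l by (auto simp: lift_at_def)
  have o: "open N'"
    unfolding N'_def using smooth_on_imp_continuous_on[OF O(2)] O(1) N(1) by (rule continuous_open_preimage)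
  have "lift_at f c' x N' (\<lambda>z. w (transition c' c z))"
    unfolding lift_at_def
  proof (intro conjI ballI)
    have "transition c' c (snd c' x) = snd c x" using tr[of "snd c' x" x] c c' by (auto simp: charts_at_def)
    then show "snd c' x \<in> N'" using O(3) N(2) by (simp add: N'_def)
    show "smooth_on N' (\<lambda>z. w (transition c' c z))"
      by (rule smooth_on_compose[OF o N(1,3) smooth_on_subset[OF O(2)]]) (auto simp: N'_def)
    fix z assume z: "z \<in> N'"
    then obtain y where y: "z = snd c' y" "y \<in> fst c'" "y \<in> fst c" by (auto simp: N'_def)
    have "transition c' c z \<in> N" using z by (simp add: N'_def)
    then show "w (transition c' c z) \<noteq> 0" "f (chart_inv c' z) = pline sc (w (transition c' c z))"
      using lw[of "transition c' c z"] tr[OF y] by auto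
  qed (use o in \<open>auto simp: N'_def\<close>)
  then show ?thesis by blast
qed

lemma smooth_map_projI:
  assumes A: "inj_charts A" and l: "\<And>x c. c \<in> charts_at A x \<Longrightarrow> \<exists>N w. lift_at f c x N w"
  shows "smooth_map A (proj_atlas sc) f"
proof (rule smooth_mapI[OF A])
  fix x assume "x \<in> points A"
  then obtain c where c: "c \<in> charts_at A x" by (auto simp: charts_at_points)
  obtain N w where "lift_at f c x N w" using l[OF c] by blast
  then show "f x \<in> points (proj_atlas sc)"
    using pline_in_points chart_inv_chart[OF A c] unfolding lift_at_def by metis
next
  fix x c d assume c: "c \<in> charts_at A x" and d: "d \<in> charts_at (proj_atlas sc) (f x)"
  obtain N w where N: "open N" "snd c x \<in> N" "N \<subseteq> snd c ` fst c" "smooth_on N w"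
    and w: "\<And>z. z \<in> N \<Longrightarrow> w z \<noteq> 0 \<and> f (chart_inv c z) = pline sc (w z)"
    using l[OF c] unfolding lift_at_def by blast
  have dA: "d \<in> proj_atlas sc" using d by (simp add: charts_at_def)
  define N' where "N' = N \<inter> w -` {w. pline sc w \<in> fst d}"
  have o: "open N'"
    unfolding N'_def using smooth_on_imp_continuous_on[OF N(4)] N(1) open_pline_dom[OF dA] by (rule continuous_open_preimage)
  have sm: "smooth_on N' (\<lambda>z. snd d (pline sc (w z)))"
    by (rule smooth_on_compose[OF o open_pline_dom[OF dA] smooth_on_coord[OF dA] smooth_on_subset[OF N(4)]]) (auto simp: N'_def)
  have x: "snd c x \<in> N'"
    using N(2) w[OF N(2)] d chart_inv_chart[OF A c] by (simp add: N'_def charts_at_def)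
  have sub: "N' \<subseteq> snd c ` {y \<in> fst c. f y \<in> fst d}"
  proof
    fix z assume z: "z \<in> N'"
    then obtain y where y: "z = snd c y" "y \<in> fst c" using N(3) by (auto simp: N'_def)
    have "chart_inv c z = y"
      unfolding y(1) by (rule chart_inv_chart[OF A]) (use y(2) c in \<open>auto simp: charts_at_def\<close>)
    then show "z \<in> snd c ` {y \<in> fst c. f y \<in> fst d}" using w[of z] z y by (auto simp: N'_def)
  qed
  show "\<exists>N g. open N \<and> snd c x \<in> N \<and> N \<subseteq> snd c ` {y \<in> fst c. f y \<in> fst d} \<and> smooth_on N g \<and>
        (\<forall>z\<in>N. snd d (f (chart_inv c z)) = g z)"
    using o x sub sm w by (intro exI[of _ N'] exI[of _ "\<lambda>z. snd d (pline sc (w z))"]) (simp add: N'_def)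
qed

lemma deriv_in_charts_lift:
  assumes l: "lift_at f c x N w" and d: "d \<in> charts_at (proj_atlas sc) (f x)" and x: "chart_inv c (snd c x) = x"
    and dw: "(w has_derivative Dw) (at (snd c x))"
  shows "deriv_in_charts f c d x = (\<lambda>v. dcoord d (w (snd c x)) (Dw v))"
proof (rule deriv_in_charts_eq)
  show "open N" "snd c x \<in> N" using l by (auto simp: lift_at_def)
  show "in_charts f c d z = snd d (pline sc (w z))" if "z \<in> N" for z
    using l that by (simp add: lift_at_def in_charts_def)
  have "f x = pline sc (w (snd c x))" using l x by (auto simp: lift_at_def)
  then have "d \<in> proj_atlas sc" "pline sc (w (snd c x)) \<in> fst d" using d by (auto simp: charts_at_def)
  then show "((\<lambda>z. snd d (pline sc (w z))) has_derivative (\<lambda>v. dcoord d (w (snd c x)) (Dw v))) (at (snd c x))"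
    by (intro has_derivative_compose[OF dw] has_derivative_coord)
qed

text \<open>The last hypothesis keeps the derivative of the lift out of the kernel of
  \<open>dcoord\<close>, the multiples of \<open>w\<close>; the rest follows because
  \<open>dcoord\<close> is complex linear.\<close>

lemma hol_at_lift:
  assumes l: "lift_at f c x N w" and d: "d \<in> charts_at (proj_atlas sc) (f x)" and x: "chart_inv c (snd c x) = x"
    and dw: "(w has_derivative Dw) (at (snd c x))"
    and h: "0 < Im \<omega>" "Dw (axis 2 1) = sc_prod sc \<omega> (Dw (axis 1 1))"
      "\<And>a. Dw (axis 1 1) \<noteq> sc_prod sc a (w (snd c x))"
  shows "hol_at (deriv_in_charts f c d x)"
proof -
  have "f x = pline sc (w (snd c x))" using l x by (auto simp: lift_at_def)
  then have mem: "d \<in> proj_atlas sc" "pline sc (w (snd c x)) \<in> fst d" using d by (auto simp: charts_at_def)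
  show ?thesis
    unfolding deriv_in_charts_lift[OF assms(1-4)] hol_at_def
    using h dcoord_sc_prod[OF mem] dcoord_eq_0_iff[OF mem] by metis
qed

text \<open>The required curve is s to [y + s a, 0]; \<open>\<epsilon>\<close> is chosen so that y +
  s a does not vanish.\<close>

lemma sub_tangent_space_infinity:
  assumes "y \<noteq> 0"
    and t: "\<And>d. d \<in> charts_at (proj_atlas sc) (pline sc (y, 0)) \<Longrightarrow> t d = dcoord d (y, 0) (a, 0)"
    and t0: "\<And>d. d \<notin> charts_at (proj_atlas sc) (pline sc (y, 0)) \<Longrightarrow> t d = 0"
  shows "t \<in> sub_tangent_space (proj_atlas sc) (line_at_infinity sc) (pline sc (y, 0))"
proof -
  define w :: "real \<Rightarrow> 'v \<times> complex" where "w s = (y + s *\<^sub>R a, 0)" for s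
  have "open ((\<lambda>s. y + s *\<^sub>R a) -` (- {0}))"
    by (intro open_vimage continuous_intros)
  moreover have "0 \<in> (\<lambda>s. y + s *\<^sub>R a) -` (- {0})" using assms(1) by simp
  ultimately obtain \<epsilon> where \<epsilon>: "\<epsilon> > 0" "ball 0 \<epsilon> \<subseteq> (\<lambda>s. y + s *\<^sub>R a) -` (- {0})"
    using open_contains_ball by blast
  let ?I = "{- \<epsilon><..<\<epsilon>}"
  have w0: "w s \<noteq> 0" if "s \<in> ?I" for s using \<epsilon>(2) that by (auto simp: w_def prod_eq_iff subset_iff)
  have ci: "chart_inv (?I, \<lambda>s. s) s = s" if s: "s \<in> ?I" for s
    using chart_inv_chart[of "{(?I, \<lambda>s. s)}" "(?I, \<lambda>s. s)" s] s by (simp add: inj_charts_def charts_at_def)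
  have smw: "smooth_on ?I w"
    unfolding w_def by (intro smooth_intros open_greaterThanLessThan)
  have "smooth_map {(?I, \<lambda>s. s)} (proj_atlas sc) (\<lambda>s. pline sc (w s))"
  proof (rule smooth_map_projI)
    show "inj_charts {(?I, \<lambda>s. s)}" by (simp add: inj_charts_def)
    fix x c assume c: "c \<in> charts_at {(?I, \<lambda>s. s)} x"
    have "lift_at (\<lambda>s. pline sc (w s)) c x ?I w"
    proof -
      have "c = (?I, \<lambda>s. s)" "x \<in> ?I" using c by (auto simp: charts_at_def)
      then show ?thesis using smw w0 ci by (simp add: lift_at_def)
    qed
    then show "\<exists>N w'. lift_at (\<lambda>s. pline sc (w s)) c x N w'" by blast
  qed
  moreover have "(\<lambda>s. pline sc (w s)) ` ?I \<subseteq> line_at_infinity sc"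
    using w0 line_at_infinity_iff by (auto simp: w_def)
  moreover have "((snd d \<circ> (\<lambda>s. pline sc (w s))) has_vector_derivative t d) (at 0)"
    if d: "d \<in> charts_at (proj_atlas sc) (pline sc (y, 0))" for d
  proof -
    have mem: "d \<in> proj_atlas sc" "pline sc (y, 0) \<in> fst d" using d by (auto simp: charts_at_def)
    have "(w has_derivative (\<lambda>s. s *\<^sub>R (a, 0))) (at 0)"
      unfolding w_def by (auto intro!: derivative_eq_intros)
    moreover have "((\<lambda>w. snd d (pline sc w)) has_derivative dcoord d (y, 0)) (at (w 0))"
      using has_derivative_coord[OF mem] by (simp add: w_def)
    ultimately have "((\<lambda>s. snd d (pline sc (w s))) has_derivative (\<lambda>s. dcoord d (y, 0) (s *\<^sub>R (a, 0)))) (at 0)"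
      by (rule has_derivative_compose)
    then show ?thesis
      by (simp only: has_vector_derivative_def o_def t[OF d] linear_cmul[OF linear_dcoord[OF mem]])
  qed
  moreover have "t \<in> tangent_space (proj_atlas sc) (pline sc (y, 0))"
    by (rule tangent_space_proj[OF t t0])
  moreover have "pline sc (w 0) = pline sc (y, 0)" by (simp add: w_def)
  ultimately show ?thesis
    unfolding sub_tangent_space_def mem_Collect_eq using \<epsilon>(1) by blast
qed

end

lemma smooth_atlas_plane: "smooth_atlas (plane_atlas :: ('v::euclidean_space one_point, 'v) chart set)"
proof -
  have inj: "inj_on the_pt (UNIV - {Infty :: 'v one_point})"
    by (rule inj_onI) (auto intro: one_point.expand)
  have im: "the_pt ` (UNIV - {Infty :: 'v one_point}) = UNIV"
  proof -
    have "y \<in> the_pt ` (UNIV - {Infty :: 'v one_point})" for y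
      by (rule image_eqI[of _ _ "Pt y"]) auto
    then show ?thesis by blast
  qed
  have "transition (UNIV - {Infty :: 'v one_point}, the_pt) (UNIV - {Infty}, the_pt) y = y" for y
    unfolding transition_def chart_inv_def using f_inv_into_f[of y the_pt "UNIV - {Infty :: 'v one_point}"] im by simp
  then have "transition (UNIV - {Infty :: 'v one_point}, the_pt) (UNIV - {Infty}, the_pt) = (\<lambda>y. y)" by auto
  then show ?thesis
    using inj im by (simp add: smooth_atlas_def plane_atlas_def smooth_on_id)
qed

section \<open>Lifting maps from the sphere to the projective plane\<close>

definition affine_chart :: "('v::euclidean_space one_point, 'v) chart" where
  "affine_chart = (UNIV - {Infty}, the_pt)"

definition infinity_chart :: "('v::euclidean_space one_point, 'v) chart" where
  "infinity_chart = (UNIV - {Pt 0}, inversion_chart)"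

lemma affine_chart_simps [simp]:
  "s \<in> fst affine_chart \<longleftrightarrow> s \<noteq> Infty" "snd affine_chart = the_pt"
  by (simp_all add: affine_chart_def)

lemma infinity_chart_simps [simp]:
  "s \<in> fst infinity_chart \<longleftrightarrow> s \<noteq> Pt 0" "snd infinity_chart = inversion_chart"
  by (simp_all add: infinity_chart_def)

lemma charts_at_sphere:
  "d \<in> charts_at sphere_atlas s \<longleftrightarrow> d = affine_chart \<and> s \<noteq> Infty \<or> d = infinity_chart \<and> s \<noteq> Pt 0"
  unfolding sphere_atlas_def charts_at_def affine_chart_def infinity_chart_def by auto

lemma charts_at_plane: "d \<in> charts_at plane_atlas s \<longleftrightarrow> d = affine_chart \<and> s \<noteq> Infty"
  unfolding plane_atlas_def charts_at_def affine_chart_def by auto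

lemma atlas_members: "affine_chart \<in> sphere_atlas" "infinity_chart \<in> sphere_atlas" "plane_atlas = {affine_chart}"
  by (auto simp: sphere_atlas_def plane_atlas_def affine_chart_def infinity_chart_def)

lemma points_sphere: "s \<in> points sphere_atlas"
proof -
  have "affine_chart \<in> charts_at sphere_atlas s \<or> infinity_chart \<in> charts_at sphere_atlas s"
    unfolding charts_at_sphere by (cases s) auto
  then show ?thesis unfolding charts_at_points by blast
qed

lemma inversion_chart_involution:
  assumes "inversion_chart s \<noteq> 0"
  shows "s \<noteq> Infty" "inversion_chart s /\<^sub>R (norm (inversion_chart s))\<^sup>2 = the_pt s"
proof -
  show "s \<noteq> Infty" using assms by (auto simp: inversion_chart_def)
  then obtain p where p: "s = Pt p" by (cases s) auto
  then have p0: "norm p \<noteq> 0" using assms by (auto simp: inversion_chart_def)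
  then have "norm (inversion_chart s) = inverse (norm p)"
    by (simp add: p inversion_chart_def power2_eq_square)
  moreover have "inverse ((inverse (norm p))\<^sup>2) * inverse ((norm p)\<^sup>2) = 1"
    using p0 by (simp add: field_simps)
  ultimately show "inversion_chart s /\<^sub>R (norm (inversion_chart s))\<^sup>2 = the_pt s"
    by (simp only: p inversion_chart_def one_point.case one_point.sel scaleR_scaleR scaleR_one)
qed

lemma open_finite_part:
  fixes f :: "'a \<Rightarrow> 'b::euclidean_space one_point"
  assumes "smooth_map A sphere_atlas f" "c \<in> A"
  shows "open (snd c ` (fst c \<inter> {x. f x \<noteq> Infty}))"
proof -
  have "{x \<in> fst c. f x \<in> fst (affine_chart :: ('b one_point, 'b) chart)} = fst c \<inter> {x. f x \<noteq> Infty}" by auto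
  then show ?thesis using smooth_map_chart_open[OF assms atlas_members(1)] by simp
qed

lemma smooth_map_finite_part:
  fixes A :: "('a, 'c::euclidean_space) chart set" and f :: "'a \<Rightarrow> 'b::euclidean_space one_point"
  assumes A: "inj_charts A" and sm: "smooth_map A sphere_atlas f"
  shows "smooth_map (restrict_atlas A {x. f x \<noteq> Infty}) plane_atlas f"
proof -
  let ?W = "{x. f x \<noteq> Infty}"
  have "open (snd c ` (fst c \<inter> ?W)) \<and> smooth_on (snd c ` (fst c \<inter> ?W)) (in_charts f (fst c \<inter> ?W, snd c) affine_chart)"
    if c: "c \<in> A" for c
  proof -
    have eq: "{x \<in> fst c. f x \<in> fst (affine_chart :: ('b one_point, 'b) chart)} = fst c \<inter> ?W" by auto
    have o: "open (snd c ` (fst c \<inter> ?W))" by (rule open_finite_part[OF sm c])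
    have "smooth_on (snd c ` (fst c \<inter> ?W)) (in_charts f c affine_chart)"
      using smooth_map_chart_smooth[OF sm c atlas_members(1)] by (simp only: eq)
    moreover have "in_charts f (fst c \<inter> ?W, snd c) affine_chart z = in_charts f c affine_chart z"
      if "z \<in> snd c ` (fst c \<inter> ?W)" for z
      using that by (rule in_charts_restrict[OF A c])
    ultimately show ?thesis using o smooth_on_cong[OF o] by blast
  qed
  moreover have "{x \<in> fst c \<inter> ?W. f x \<in> fst (affine_chart :: ('b one_point, 'b) chart)} = fst c \<inter> ?W" for c :: "('a, 'c) chart" by auto
  moreover have "f ` points (restrict_atlas A ?W) \<subseteq> points plane_atlas"
    by (auto simp: points_def restrict_atlas_def atlas_members(3))
  ultimately show ?thesis
    unfolding smooth_map_def atlas_members(3) by (simp add: restrict_atlas_def)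
qed

text \<open>Surfaces are modelled on \<open>real^2\<close>, whereas the complex analysis at a pole
  takes place on the type \<open>complex\<close>.\<close>

definition vec_of_complex :: "complex \<Rightarrow> real^2" where
  "vec_of_complex z = vector [Re z, Im z]"

definition complex_of_vec :: "real^2 \<Rightarrow> complex" where
  "complex_of_vec v = Complex (v$1) (v$2)"

lemma vec_complex_inverse [simp]:
  "vec_of_complex (complex_of_vec v) = v" "complex_of_vec (vec_of_complex z) = z"
  by (simp_all add: vec_of_complex_def complex_of_vec_def vec_eq_iff forall_2)

lemma vec_of_complex_basis: "vec_of_complex 1 = axis 1 1" "vec_of_complex \<i> = axis 2 1"
  by (simp_all add: vec_of_complex_def vec_eq_iff forall_2 axis_def)

lemma complex_of_vec_basis: "complex_of_vec (axis 1 1) = 1" "complex_of_vec (axis 2 1) = \<i>"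
  by (simp_all add: complex_of_vec_def axis_def complex_eq_iff)

lemma bounded_linear_vec_of_complex: "bounded_linear vec_of_complex"
  unfolding linear_conv_bounded_linear[symmetric]
  by (rule linearI) (simp_all add: vec_of_complex_def vec_eq_iff forall_2)

lemma bounded_linear_complex_of_vec: "bounded_linear complex_of_vec"
  unfolding linear_conv_bounded_linear[symmetric]
  by (rule linearI) (simp_all add: complex_of_vec_def complex_eq_iff)

context hermitian_plane
begin

lemma plane_transition_sc:
  assumes "d \<in> charts_at plane_atlas p" "d' \<in> charts_at plane_atlas p"
  shows "deriv_in_charts (\<lambda>x. x) d d' p (sc \<i> y) = sc \<i> (deriv_in_charts (\<lambda>x. x) d d' p y)"
proof -
  have "d' = d" using assms by (simp add: charts_at_plane)
  then show ?thesis using deriv_in_charts_ident[OF smooth_atlas_plane assms(1)] by simp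
qed

lemma hol_at_finite_part:
  assumes A: "smooth_atlas A" and ph: "pseudoholomorphic_immersion_sphere sc A f"
    and c: "c \<in> charts_at A x" and fx: "f x \<noteq> Infty"
  shows "hol_at (deriv_in_charts f c affine_chart x)"
proof -
  define W where "W = {x. f x \<noteq> Infty}"
  have sm: "smooth_map A sphere_atlas f" using ph by (simp add: pseudoholomorphic_immersion_sphere_def immersion_def)
  have phW: "pseudoholomorphic_immersion (restrict_atlas A W) plane_atlas (mult_i sc) f"
    using ph by (simp add: pseudoholomorphic_immersion_sphere_def W_def)
  have oW: "open (snd c ` (fst c \<inter> W))" if "c \<in> A" for c
    unfolding W_def by (rule open_finite_part[OF sm that])
  have xW: "x \<in> W" and cA: "c \<in> A" using fx c by (simp_all add: W_def charts_at_def)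
  have "hol_at (deriv_in_charts f (fst c \<inter> W, snd c) affine_chart x)"
  proof (rule pseudoholomorphic_immersionD[OF smooth_atlas_restrict[OF A oW] smooth_atlas_plane phW])
    show "(fst c \<inter> W, snd c) \<in> charts_at (restrict_atlas A W) x"
      unfolding restrict_atlas_charts_at using xW c by blast
    show "affine_chart \<in> charts_at plane_atlas (f x)" using fx by (simp add: charts_at_plane)
  qed
  then show ?thesis
    by (simp only: deriv_in_charts_restrict[OF smooth_atlas_inj_charts[OF A] c xW oW[OF cA]])
qed

text \<open>At infinity the only chart is \<open>infinity_chart\<close>, so a vector killed by the
  derivative in that chart has the same differential as the zero vector.\<close>

lemma sphere_immersion_injective:
  fixes f :: "'a \<Rightarrow> 'v one_point"
  assumes A: "smooth_atlas A" and imm: "immersion A sphere_atlas f" and c: "c \<in> charts_at A x" and fx: "f x = Infty"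
    and r: "deriv_in_charts f c infinity_chart x r = 0"
  shows "r = 0"
proof -
  have sm: "smooth_map A sphere_atlas f" using imm by (simp add: immersion_def)
  have x: "x \<in> points A" using c by (auto simp: charts_at_points)
  have I: "infinity_chart \<in> charts_at sphere_atlas (f x)" by (simp add: charts_at_sphere fx)
  obtain t where t: "t \<in> tangent_space A x" "t c = r" by (rule tangent_space_ex[OF A c])
  \<comment> \<open>The zero tangent vector, written as a combination so that
    \<open>lincomb_tangent_space\<close> applies.\<close>
  define t0 where "t0 = lincomb 0 t 0 t"
  have t0: "t0 \<in> tangent_space A x" "t0 c = 0"
    unfolding t0_def by (rule lincomb_tangent_space[OF A t(1) t(1)]) (simp add: lincomb_def)
  have "differential A sphere_atlas f x t = differential A sphere_atlas f x t0"
  proof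
    fix d :: "('v one_point, 'v) chart"
    show "differential A sphere_atlas f x t d = differential A sphere_atlas f x t0 d"
    proof (cases "d \<in> charts_at sphere_atlas (f x)")
      case True
      then have d: "d = infinity_chart" by (auto simp: charts_at_sphere fx)
      show ?thesis
        unfolding d differential_eq[OF A sm t(1) c I] differential_eq[OF A sm t0(1) c I] t(2) t0(2) r
        by (rule linear_0[OF linear_deriv_in_charts[OF sm c I], symmetric])
    qed (simp add: differential_outside)
  qed
  then have "t = t0" using imm x t(1) t0(1) unfolding immersion_def by (meson inj_onD)
  then show ?thesis using t(2) t0(2) by simp
qed

text \<open>The norm condition keeps the lift nonzero at the pole, where its last component
  vanishes. The condition on \<open>snd (Dw (axis 1 1))\<close> gives both the immersion property
  and transversality.\<close>

definition pole_lift :: "('a \<Rightarrow> 'v one_point) \<Rightarrow> ('a, real^2) chart \<Rightarrow> 'a \<Rightarrow> (real^2) set \<Rightarrow>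
    (real^2 \<Rightarrow> 'v \<times> complex) \<Rightarrow> (real^2 \<Rightarrow> 'v \<times> complex) \<Rightarrow> complex \<Rightarrow> bool" where
  "pole_lift f c x N w Dw \<omega> \<longleftrightarrow> open N \<and> snd c x \<in> N \<and> N \<subseteq> snd c ` fst c \<and> smooth_on N w \<and>
    (\<forall>z\<in>N. z \<noteq> snd c x \<longrightarrow> (\<exists>y. f (chart_inv c z) = Pt y \<and> snd (w z) \<noteq> 0 \<and> w z = sc_prod sc (snd (w z)) (y, 1))) \<and>
    snd (w (snd c x)) = 0 \<and> norm (fst (w (snd c x))) = 1 \<and> (w has_derivative Dw) (at (snd c x)) \<and>
    0 < Im \<omega> \<and> Dw (axis 2 1) = sc_prod sc \<omega> (Dw (axis 1 1)) \<and> snd (Dw (axis 1 1)) \<noteq> 0"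

text \<open>\<open>lift_at_infinity\<close> is applied to \<open>f\<close> in the chart at infinity.
  As the inversion is an involution, u/|u|^2 is \<open>f\<close> in the affine chart, where it is
  pseudoholomorphic by assumption.\<close>

lemma lift_near_infinity:
  assumes A: "smooth_atlas A" and ph: "pseudoholomorphic_immersion_sphere sc A f"
    and c: "c \<in> charts_at A x" and fx: "f x = Infty"
  shows "\<exists>N w Dw \<omega>. pole_lift f c x N w Dw \<omega>"
proof -
  note i = smooth_atlas_inj_charts[OF A]
  have imm: "immersion A sphere_atlas f" using ph by (simp add: pseudoholomorphic_immersion_sphere_def)
  have sm: "smooth_map A sphere_atlas f" using imm by (simp add: immersion_def)
  have cA: "c \<in> A" "x \<in> fst c" using c by (auto simp: charts_at_def)
  let ?I = "infinity_chart :: ('v one_point, 'v) chart"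
  let ?P = "affine_chart :: ('v one_point, 'v) chart"
  have I: "?I \<in> charts_at sphere_atlas (f x)" by (simp add: charts_at_sphere fx)
  define Od where "Od = snd c ` {y \<in> fst c. f y \<in> fst ?I}"
  have Od: "open Od" "snd c x \<in> Od"
    unfolding Od_def using smooth_map_chart_open[OF sm cA(1) atlas_members(2)] cA(2) fx by auto
  define u where "u z = in_charts f c ?I (vec_of_complex z)" for z
  define U where "U = vec_of_complex -` Od"
  define x0 where "x0 = complex_of_vec (snd c x)"
  note blv = bounded_linear_vec_of_complex and blc = bounded_linear_complex_of_vec
  have U: "open U" unfolding U_def using Od(1) linear_continuous_on[OF blv] by (rule open_vimage)
  have x0U: "x0 \<in> U" using Od(2) by (simp add: U_def x0_def)
  have smu: "smooth_on U u"
    unfolding u_def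
  proof (rule smooth_on_compose[OF U Od(1)])
    show "smooth_on Od (in_charts f c ?I)"
      unfolding Od_def by (rule smooth_map_chart_smooth[OF sm cA(1) atlas_members(2)])
    show "smooth_on U vec_of_complex" by (rule smooth_on_bounded_linear[OF U blv smooth_on_id[OF U]])
    show "vec_of_complex ` U \<subseteq> Od" by (auto simp: U_def)
  qed
  have pre: "\<exists>y. vec_of_complex z = snd c y \<and> c \<in> charts_at A y \<and> u z = inversion_chart (f y) \<and> in_charts f c ?P (vec_of_complex z) = the_pt (f y)"
    if "z \<in> U" for z
  proof -
    have "vec_of_complex z \<in> Od" using that by (simp add: U_def)
    then obtain y where y: "vec_of_complex z = snd c y" "y \<in> fst c" by (auto simp: Od_def)
    have cy: "c \<in> charts_at A y" using y cA by (simp add: charts_at_def)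
    then show ?thesis
      by (intro exI[of _ y]) (simp add: u_def y(1) in_charts_chart[OF i cy])
  qed
  have ux0: "u x0 = 0"
    using in_charts_chart[OF i c, of f ?I] by (simp add: u_def x0_def fx inversion_chart_def)
  have dvec: "(vec_of_complex has_derivative vec_of_complex) (at z)" for z
    by (rule bounded_linear_imp_has_derivative[OF blv])
  have "(in_charts f c ?I has_derivative deriv_in_charts f c ?I x) (at (vec_of_complex x0))"
    using has_derivative_in_charts[OF sm c I] by (simp add: x0_def)
  then have "(u has_derivative (\<lambda>v. deriv_in_charts f c ?I x (vec_of_complex v))) (at x0)"
    unfolding u_def by (rule has_derivative_compose[OF dvec])
  then have fu: "frechet_derivative u (at x0) = (\<lambda>v. deriv_in_charts f c ?I x (vec_of_complex v))"
    by (rule frechet_derivative_at[symmetric])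
  have inj: "v = 0" if v: "frechet_derivative u (at x0) v = 0" for v
  proof -
    have "vec_of_complex v = 0"
      by (rule sphere_immersion_injective[OF A imm c fx]) (use v fu in simp)
    then have "complex_of_vec (vec_of_complex v) = 0" by (simp add: complex_of_vec_def complex_eq_iff del: vec_complex_inverse)
    then show ?thesis by simp
  qed
  have hol: "\<exists>D \<omega>. ((\<lambda>x. u x /\<^sub>R (norm (u x))\<^sup>2) has_derivative D) (at z) \<and> 0 < Im \<omega> \<and> D \<i> = sc \<omega> (D 1)"
    if z: "z \<in> U" "u z \<noteq> 0" for z
  proof -
    obtain y where y: "vec_of_complex z = snd c y" "c \<in> charts_at A y" "u z = inversion_chart (f y)"
      using pre[OF z(1)] by blast
    have fy: "f y \<noteq> Infty" using inversion_chart_involution(1) y(3) z(2) by metis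
    define E where "E = deriv_in_charts f c ?P y"
    have "hol_at E" unfolding E_def by (rule hol_at_finite_part[OF A ph y(2) fy])
    then obtain \<omega> where \<omega>: "0 < Im \<omega>" "E (axis 2 1) = sc \<omega> (E (axis 1 1))" by (auto simp: hol_at_def)
    have "?P \<in> charts_at sphere_atlas (f y)" using fy by (simp add: charts_at_sphere)
    then have "(in_charts f c ?P has_derivative E) (at (vec_of_complex z))"
      unfolding E_def y(1) by (rule has_derivative_in_charts[OF sm y(2)])
    then have D: "((\<lambda>z. in_charts f c ?P (vec_of_complex z)) has_derivative (\<lambda>v. E (vec_of_complex v))) (at z)"
      by (rule has_derivative_compose[OF dvec])
    have o: "open (U \<inter> u -` (- {0}))"
      using smooth_on_imp_continuous_on[OF smu] U by (rule continuous_open_preimage) auto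
    have "((\<lambda>x. u x /\<^sub>R (norm (u x))\<^sup>2) has_derivative (\<lambda>v. E (vec_of_complex v))) (at z)"
    proof (rule has_derivative_transform_within_open[OF D o])
      show "z \<in> U \<inter> u -` (- {0})" using z by simp
      fix z' assume z': "z' \<in> U \<inter> u -` (- {0})"
      then obtain y' where y': "u z' = inversion_chart (f y')" "in_charts f c ?P (vec_of_complex z') = the_pt (f y')"
        using pre by blast
      then show "in_charts f c ?P (vec_of_complex z') = u z' /\<^sub>R (norm (u z'))\<^sup>2"
        using inversion_chart_involution(2)[of "f y'"] z' by simp
    qed
    then show ?thesis using \<omega> vec_of_complex_basis by metis
  qed
  obtain N w Dw \<omega> where N: "open N" "x0 \<in> N" "N \<subseteq> U" "smooth_on N w"
    and w: "\<And>x. x \<in> N \<Longrightarrow> x \<noteq> x0 \<Longrightarrow> u x \<noteq> 0 \<and> snd (w x) \<noteq> 0 \<and> w x = sc_prod sc (snd (w x)) (u x /\<^sub>R (norm (u x))\<^sup>2, 1)"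
    and w0: "snd (w x0) = 0" "norm (fst (w x0)) = 1"
    and Dw: "(w has_derivative Dw) (at x0)" "0 < Im \<omega>" "Dw \<i> = sc_prod sc \<omega> (Dw 1)" "snd (Dw 1) \<noteq> 0"
    using lift_at_infinity[OF U x0U smu ux0 inj hol] by metis
  define N' where "N' = complex_of_vec -` N"
  have N': "open N'" unfolding N'_def using N(1) linear_continuous_on[OF blc] by (rule open_vimage)
  show ?thesis
  proof (rule exI[of _ N'], rule exI[of _ "\<lambda>z. w (complex_of_vec z)"],
      rule exI[of _ "\<lambda>v. Dw (complex_of_vec v)"], rule exI[of _ \<omega>],
      unfold pole_lift_def, intro conjI ballI impI)
    show "open N'" by (rule N')
    show "snd c x \<in> N'" using N(2) by (simp add: N'_def x0_def)
    show sub: "N' \<subseteq> snd c ` fst c"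
    proof
      fix z assume "z \<in> N'"
      then have "vec_of_complex (complex_of_vec z) \<in> Od" using N(3) by (auto simp: N'_def U_def)
      then show "z \<in> snd c ` fst c" by (auto simp: Od_def)
    qed
    show "smooth_on N' (\<lambda>z. w (complex_of_vec z))"
      by (rule smooth_on_compose[OF N' N(1,4) smooth_on_bounded_linear[OF N' blc smooth_on_id[OF N']]])
        (auto simp: N'_def)
    show "snd (w (complex_of_vec (snd c x))) = 0" "norm (fst (w (complex_of_vec (snd c x)))) = 1"
      using w0 by (simp_all add: x0_def)
    show "((\<lambda>z. w (complex_of_vec z)) has_derivative (\<lambda>v. Dw (complex_of_vec v))) (at (snd c x))"
      by (rule has_derivative_compose[OF bounded_linear_imp_has_derivative[OF blc]]) (use Dw(1) in \<open>simp add: x0_def\<close>)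
    show "0 < Im \<omega>" by (rule Dw(2))
    show "Dw (complex_of_vec (axis 2 1)) = sc_prod sc \<omega> (Dw (complex_of_vec (axis 1 1)))"
      "snd (Dw (complex_of_vec (axis 1 1))) \<noteq> 0"
      using Dw(3,4) by (simp_all add: complex_of_vec_basis)
    fix z assume z: "z \<in> N'" "z \<noteq> snd c x"
    have zN: "complex_of_vec z \<in> N" "complex_of_vec z \<noteq> x0"
      using z by (auto simp: N'_def x0_def) (metis vec_complex_inverse(1))
    note wz = w[OF zN]
    obtain y where y: "z = snd c y" "c \<in> charts_at A y" "u (complex_of_vec z) = inversion_chart (f y)"
      using pre[of "complex_of_vec z"] zN N(3) by auto
    have nz: "inversion_chart (f y) \<noteq> 0" using wz y(3) by simp
    obtain p where p: "f y = Pt p" using inversion_chart_involution(1)[OF nz] by (cases "f y") auto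
    have "u (complex_of_vec z) /\<^sub>R (norm (u (complex_of_vec z)))\<^sup>2 = p"
      using inversion_chart_involution(2)[OF nz] by (simp add: y(3) p)
    moreover have "f (chart_inv c z) = Pt p" using chart_inv_chart[OF i y(2)] y(1) p by simp
    ultimately show "\<exists>y. f (chart_inv c z) = Pt y \<and> snd (w (complex_of_vec z)) \<noteq> 0 \<and>
        w (complex_of_vec z) = sc_prod sc (snd (w (complex_of_vec z))) (y, 1)"
      using wz by auto
  qed
qed

lemma lift_to_projective:
  fixes A :: "('a, real^2) chart set"
  assumes A: "smooth_atlas A" "oriented A" and ph: "pseudoholomorphic_immersion_sphere sc A f"
  shows "\<exists>f'. pseudoholomorphic_immersion A (proj_atlas sc) (mult_i sc) f' \<and>
       transverse A (proj_atlas sc) f' (line_at_infinity sc) \<and>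
       (\<forall>x\<in>points A. f x = pr sc (f' x))"
proof -
  note i = smooth_atlas_inj_charts[OF A(1)]
  have imm: "immersion A sphere_atlas f" using ph by (simp add: pseudoholomorphic_immersion_sphere_def)
  have sm: "smooth_map A sphere_atlas f" using imm by (simp add: immersion_def)
  let ?P = "affine_chart :: ('v one_point, 'v) chart"

  define ch where "ch x = (SOME c. c \<in> charts_at A x)" for x
  have ch: "ch x \<in> charts_at A x" if "x \<in> points A" for x
    unfolding ch_def using that charts_at_points[of x A] by (simp add: some_in_eq)
  have "\<exists>N w Dw \<omega>. x \<in> points A \<longrightarrow> f x = Infty \<longrightarrow> pole_lift f (ch x) x N w Dw \<omega>" for x
    using lift_near_infinity[OF A(1) ph ch] by blast
  then obtain N w Dw \<omega> where "\<And>x. x \<in> points A \<Longrightarrow> f x = Infty \<Longrightarrow>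
      pole_lift f (ch x) x (N x) (w x) (Dw x) (\<omega> x)"
    by metis
  note infl = this[unfolded pole_lift_def]

  \<comment> \<open>At a pole only the value of its own local lift at that very point is used; at
    other points the line is dictated by \<open>f\<close>. The local lift nevertheless represents
    \<open>f'\<close> on a whole neighbourhood, since it spans [y, 1] off the pole.\<close>
  define f' where "f' x = (case f x of Pt y \<Rightarrow> pline sc (y, 1) | Infty \<Rightarrow> pline sc (w x (snd (ch x) x)))" for x
  have local: "\<exists>N w Dw \<omega>. lift_at f' (ch x) x N w \<and> (w has_derivative Dw) (at (snd (ch x) x)) \<and> 0 < Im \<omega> \<and>
      Dw (axis 2 1) = sc_prod sc \<omega> (Dw (axis 1 1)) \<and> (\<forall>a. Dw (axis 1 1) \<noteq> sc_prod sc a (w (snd (ch x) x))) \<and>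
      (f x = Infty \<longrightarrow> snd (w (snd (ch x) x)) = 0 \<and> snd (Dw (axis 1 1)) \<noteq> 0)"
    if x: "x \<in> points A" for x
  proof (cases "f x")
    case Infty
    note L = infl[OF x Infty]
    have "lift_at f' (ch x) x (N x) (w x)"
      unfolding lift_at_def
    proof (intro conjI ballI)
      fix z assume z: "z \<in> N x"
      have "w x z \<noteq> 0 \<and> f' (chart_inv (ch x) z) = pline sc (w x z)"
      proof (cases "z = snd (ch x) x")
        case True
        then have "chart_inv (ch x) z = x" using chart_inv_chart[OF i ch[OF x]] by simp
        then show ?thesis using L by (auto simp: f'_def Infty True)
      next
        case False
        then obtain y where y: "f (chart_inv (ch x) z) = Pt y" "snd (w x z) \<noteq> 0" "w x z = sc_prod sc (snd (w x z)) (y, 1)"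
          using L z by blast
        have "pline sc (w x z) = pline sc (y, 1)" using pline_sc_prod[OF y(2)] y(3) by metis
        then show ?thesis using y(1,2) by (auto simp: f'_def)
      qed
      then show "w x z \<noteq> 0" "f' (chart_inv (ch x) z) = pline sc (w x z)" by auto
    qed (use L in blast)+
    moreover have "Dw x (axis 1 1) \<noteq> sc_prod sc a (w x (snd (ch x) x))" for a
    proof
      assume "Dw x (axis 1 1) = sc_prod sc a (w x (snd (ch x) x))"
      then have "snd (Dw x (axis 1 1)) = 0" using L by simp
      then show False using L by blast
    qed
    ultimately show ?thesis using L by blast
  next
    case (Pt p)
    define c where "c = ch x"
    have c: "c \<in> charts_at A x" "c \<in> A" using ch[OF x] by (auto simp: c_def charts_at_def)
    define M where "M = snd c ` {y \<in> fst c. f y \<in> fst ?P}"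
    have M: "open M" "snd c x \<in> M"
      unfolding M_def using smooth_map_chart_open[OF sm c(2) atlas_members(1)] c(1) Pt by (auto simp: charts_at_def)
    define E where "E = deriv_in_charts f c ?P x"
    have "hol_at E" unfolding E_def by (rule hol_at_finite_part[OF A(1) ph c(1)]) (simp add: Pt)
    then obtain \<omega> where \<omega>: "0 < Im \<omega>" "E (axis 2 1) = sc \<omega> (E (axis 1 1))" "E (axis 1 1) \<noteq> 0"
      by (auto simp: hol_at_def)
    \<comment> \<open>Off the poles the lift is (f, 1). Its derivative has last component 0, so it
      can be a multiple of the lift only if it vanishes.\<close>
    define v where "v z = (in_charts f c ?P z, 1 :: complex)" for z
    have "lift_at f' c x M v"
      unfolding lift_at_def
    proof (intro conjI ballI)
      show "M \<subseteq> snd c ` fst c" by (auto simp: M_def)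
      have "smooth_on M (in_charts f c ?P)"
        unfolding M_def by (rule smooth_map_chart_smooth[OF sm c(2) atlas_members(1)])
      then show "smooth_on M v" unfolding v_def by (intro smooth_on_Pair M smooth_on_const)
      fix z assume "z \<in> M"
      then obtain y where y: "z = snd c y" "y \<in> fst c" "f y \<noteq> Infty" by (auto simp: M_def)
      have cy: "c \<in> charts_at A y" using y(2) c(2) by (simp add: charts_at_def)
      obtain q where q: "f y = Pt q" using y(3) by (cases "f y") auto
      have "v z = (q, 1)" by (simp add: v_def y(1) in_charts_chart[OF i cy] q)
      moreover have "f' (chart_inv c z) = pline sc (q, 1)"
        using chart_inv_chart[OF i cy] by (simp add: y(1) f'_def q)
      ultimately show "v z \<noteq> 0" "f' (chart_inv c z) = pline sc (v z)" by (simp_all add: zero_prod_def)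
    qed (use M in auto)
    moreover have "(v has_derivative (\<lambda>r. (E r, 0))) (at (snd c x))"
    proof -
      have "?P \<in> charts_at sphere_atlas (f x)" using Pt by (simp add: charts_at_sphere)
      then show ?thesis
        unfolding v_def E_def
        by (intro has_derivative_Pair has_derivative_const has_derivative_in_charts[OF sm c(1)])
    qed
    moreover have "(E (axis 2 1), 0) = sc_prod sc \<omega> (E (axis 1 1), 0)" using \<omega>(2) by (simp add: prod_eq_iff)
    moreover have "(E (axis 1 1), 0) \<noteq> sc_prod sc a (v (snd c x))" for a
      using \<omega>(3) by (auto simp: prod_eq_iff v_def sc_0_left)
    ultimately have "\<exists>Dw \<omega>. lift_at f' c x M v \<and> (v has_derivative Dw) (at (snd c x)) \<and> 0 < Im \<omega> \<and>
      Dw (axis 2 1) = sc_prod sc \<omega> (Dw (axis 1 1)) \<and> (\<forall>a. Dw (axis 1 1) \<noteq> sc_prod sc a (v (snd c x)))"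
      using \<omega>(1) by (intro exI[of _ "\<lambda>r. (E r, 0)"] exI[of _ \<omega>]) simp
    then show ?thesis unfolding c_def using Pt by auto
  qed
  have sm': "smooth_map A (proj_atlas sc) f'"
  proof (rule smooth_map_projI[OF i])
    fix x c assume c: "c \<in> charts_at A x"
    then have x: "x \<in> points A" by (auto simp: charts_at_points)
    show "\<exists>N w. lift_at f' c x N w"
      using local[OF x] lift_at_transport[OF A(1) ch[OF x] c] by blast
  qed
  have charts': "charts_at (proj_atlas sc) (f' x) \<noteq> {}" if "x \<in> points A" for x
    using sm' that unfolding smooth_map_def charts_at_points[symmetric] by blast
  have "pseudoholomorphic_immersion A (proj_atlas sc) (mult_i sc) f'"
  proof (rule pseudoholomorphic_immersionI[OF A smooth_atlas_proj sm' transition_proj_sc])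
    fix x assume x: "x \<in> points A"
    obtain d where d: "d \<in> charts_at (proj_atlas sc) (f' x)" using charts'[OF x] by blast
    obtain N w Dw \<omega> where *: "lift_at f' (ch x) x N w" "(w has_derivative Dw) (at (snd (ch x) x))" "0 < Im \<omega>"
      "Dw (axis 2 1) = sc_prod sc \<omega> (Dw (axis 1 1))" "\<And>a. Dw (axis 1 1) \<noteq> sc_prod sc a (w (snd (ch x) x))"
      using local[OF x] by blast
    have "hol_at (deriv_in_charts f' (ch x) d x)"
      by (rule hol_at_lift[OF *(1) d chart_inv_chart[OF i ch[OF x]] *(2-5)])
    then show "\<exists>c\<in>charts_at A x. \<exists>d\<in>charts_at (proj_atlas sc) (f' x). hol_at (deriv_in_charts f' c d x)"
      using ch[OF x] d by blast
  qed
  moreover have "f x = pr sc (f' x)" if x: "x \<in> points A" for x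
  proof (cases "f x")
    case Infty
    have "w x (snd (ch x) x) \<noteq> 0" "snd (w x (snd (ch x) x)) = 0" using infl[OF x Infty] by auto
    then show ?thesis by (simp add: f'_def Infty pr_pline)
  next
    case (Pt y)
    then show ?thesis using pr_pline[of "(y, 1)"] by (simp add: f'_def sc_1 zero_prod_def)
  qed
  moreover have "transverse A (proj_atlas sc) f' (line_at_infinity sc)"
    unfolding transverse_def
  proof (intro ballI impI)
    fix x assume x: "x \<in> points A" and fx: "f' x \<in> line_at_infinity sc"
    have fxI: "f x = Infty"
    proof (cases "f x")
      case (Pt y)
      then show ?thesis using fx line_at_infinity_iff[of "(y, 1)"] by (simp add: f'_def zero_prod_def)
    qed
    define c where "c = ch x"
    have c: "c \<in> charts_at A x" using ch[OF x] by (simp add: c_def)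
    obtain N w Dw \<omega> where lift: "lift_at f' c x N w" and Dw: "(w has_derivative Dw) (at (snd c x))" and \<omega>: "0 < Im \<omega>"
      "Dw (axis 2 1) = sc_prod sc \<omega> (Dw (axis 1 1))" and w0: "snd (w (snd c x)) = 0" and D1: "snd (Dw (axis 1 1)) \<noteq> 0"
      using local[OF x] fxI unfolding c_def by blast
    define y where "y = fst (w (snd c x))"
    have wy: "w (snd c x) = (y, 0)" using w0 by (simp add: y_def prod_eq_iff)
    have lx: "chart_inv c (snd c x) = x" by (rule chart_inv_chart[OF i c])
    have f'x: "f' x = pline sc (y, 0)" and y0: "y \<noteq> 0"
      using lift lx wy unfolding lift_at_def by (metis, metis zero_prod_def)
    have Dlin: "linear Dw" using Dw has_derivative_linear by blast
    show "tangent_space (proj_atlas sc) (f' x) = {lincomb 1 (differential A (proj_atlas sc) f' x u) 1 h |u h.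
        u \<in> tangent_space A x \<and> h \<in> sub_tangent_space (proj_atlas sc) (line_at_infinity sc) (f' x)}" (is "_ = ?R")
    proof (intro equalityI subsetI)
      fix t assume "t \<in> ?R"
      then obtain u h where "t = lincomb 1 (differential A (proj_atlas sc) f' x u) 1 h"
        "u \<in> tangent_space A x" "h \<in> tangent_space (proj_atlas sc) (f' x)"
        unfolding sub_tangent_space_def by blast
      then show "t \<in> tangent_space (proj_atlas sc) (f' x)"
        using lincomb_tangent_space[OF smooth_atlas_proj differential_tangent_space[OF A(1) smooth_atlas_proj sm' _ x]] by blast
    next
      fix t assume t: "t \<in> tangent_space (proj_atlas sc) (f' x)"
      obtain d0 where d0: "d0 \<in> charts_at (proj_atlas sc) (f' x)" using charts'[OF x] by blast
      obtain v where v: "\<And>d. d \<in> charts_at (proj_atlas sc) (pline sc (y, 0)) \<Longrightarrow> t d = dcoord d (y, 0) v"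
        using tangent_space_projE[OF t[unfolded f'x] d0[unfolded f'x]] by blast
      \<comment> \<open>The real vector \<open>r\<close> is chosen so that \<open>Dw r\<close> has
        the same last component as \<open>v\<close>. The difference then has the form (a, 0) and is
        tangent to the line at infinity.\<close>
      define q where "q = snd v / snd (Dw (axis 1 1))"
      define r :: "real^2" where "r = vector [Re q - Im q / Im \<omega> * Re \<omega>, Im q / Im \<omega>]"
      have "snd (Dw r) = (complex_of_real (r$1) + complex_of_real (r$2) * \<omega>) * snd (Dw (axis 1 1))"
        using linear_plane_eq[OF Dlin, of r] by (simp add: \<omega>(2) scaleR_conv_of_real algebra_simps)
      also have "complex_of_real (r$1) + complex_of_real (r$2) * \<omega> = q"
        using \<omega>(1) by (simp add: r_def complex_eq_iff)
      finally have Dr: "snd (Dw r) = snd v" using D1 by (simp add: q_def)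
      obtain u where u: "u \<in> tangent_space A x" "u c = r" by (rule tangent_space_ex[OF A(1) c])
      define a where "a = fst (v - Dw r)"
      have va: "v - Dw r = (a, 0)" using Dr by (simp add: a_def prod_eq_iff)
      define h where "h d = (if d \<in> charts_at (proj_atlas sc) (pline sc (y, 0)) then dcoord d (y, 0) (a, 0) else 0)" for d
      have h: "h \<in> sub_tangent_space (proj_atlas sc) (line_at_infinity sc) (f' x)"
        unfolding f'x by (rule sub_tangent_space_infinity[OF y0]) (simp_all add: h_def)
      have "t = lincomb 1 (differential A (proj_atlas sc) f' x u) 1 h"
      proof
        fix d
        show "t d = lincomb 1 (differential A (proj_atlas sc) f' x u) 1 h d"
        proof (cases "d \<in> charts_at (proj_atlas sc) (f' x)")
          case True
          then have d: "d \<in> charts_at (proj_atlas sc) (pline sc (y, 0))" by (simp add: f'x)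
          then have mem: "d \<in> proj_atlas sc" "pline sc (y, 0) \<in> fst d" by (auto simp: charts_at_def)
          have "differential A (proj_atlas sc) f' x u d = dcoord d (y, 0) (Dw r)"
            using differential_eq[OF A(1) sm' u(1) c True] deriv_in_charts_lift[OF lift True lx Dw]
            by (simp add: u(2) wy)
          moreover have "h d = dcoord d (y, 0) v - dcoord d (y, 0) (Dw r)"
            using d by (simp add: h_def va[symmetric] linear_diff[OF linear_dcoord[OF mem]])
          ultimately show ?thesis by (simp add: lincomb_def v[OF d])
        next
          case False
          then have "t d = 0" using t unfolding tangent_space_iff by blast
          then show ?thesis using False by (simp add: lincomb_def differential_outside h_def f'x[symmetric])
        qed
      qed
      then show "t \<in> ?R" using u(1) h by blast
    qed
  qed
  ultimately show ?thesis by blast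
qed

end

section \<open>Projecting maps to the sphere\<close>

context hermitian_plane
begin

lemma lift_at_section:
  assumes A: "inj_charts A" and sm: "smooth_map A (proj_atlas sc) f" and c: "c \<in> charts_at A x"
    and d: "d \<in> charts_at (proj_atlas sc) (f x)" and L: "chart_section d L DL"
  shows "lift_at f c x (snd c ` {y \<in> fst c. f y \<in> fst d}) (\<lambda>z. L (in_charts f c d z))"
proof -
  have cd: "c \<in> A" "x \<in> fst c" "d \<in> proj_atlas sc" "f x \<in> fst d" using c d by (auto simp: charts_at_def)
  let ?N = "snd c ` {y \<in> fst c. f y \<in> fst d}"
  have o: "open ?N" by (rule smooth_map_chart_open[OF sm cd(1,3)])
  show ?thesis
    unfolding lift_at_def
  proof (intro conjI ballI)
    show "smooth_on ?N (\<lambda>z. L (in_charts f c d z))"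
      by (rule smooth_on_compose[OF o open_UNIV chart_sectionD(1)[OF L] smooth_map_chart_smooth[OF sm cd(1,3)]]) auto
    fix z assume "z \<in> ?N"
    then obtain y where y: "z = snd c y" "y \<in> fst c" "f y \<in> fst d" by blast
    have cy: "c \<in> charts_at A y" using y(2) cd(1) by (simp add: charts_at_def)
    have "pline sc (L (in_charts f c d z)) = f y"
      unfolding y(1) in_charts_chart[OF A cy] by (rule chart_sectionD(5)[OF L y(3)])
    then show "f (chart_inv c z) = pline sc (L (in_charts f c d z))"
      using chart_inv_chart[OF A cy] y(1) by simp
    show "L (in_charts f c d z) \<noteq> 0"
      by (rule pline_dom_nonzero[OF cd(3) chart_sectionD(3)[OF L]])
  qed (use o cd in auto)
qed

lemma project_to_sphere:
  fixes A :: "('a, real^2) chart set"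
  assumes A: "smooth_atlas A" "oriented A"
    and ph: "pseudoholomorphic_immersion A (proj_atlas sc) (mult_i sc) f'"
    and tr: "transverse A (proj_atlas sc) f' (line_at_infinity sc)"
    and f: "\<And>x. x \<in> points A \<Longrightarrow> f x = pr sc (f' x)"
  shows "pseudoholomorphic_immersion_sphere sc A f"
proof -
  note i = smooth_atlas_inj_charts[OF A(1)]
  let ?I = "infinity_chart :: ('v one_point, 'v) chart"
  let ?P = "affine_chart :: ('v one_point, 'v) chart"
  have sm': "smooth_map A (proj_atlas sc) f'"
    using ph by (simp add: pseudoholomorphic_immersion_def immersion_def)
  have charts': "charts_at (proj_atlas sc) (f' x) \<noteq> {}" if "x \<in> points A" for x
    using sm' that unfolding smooth_map_def charts_at_points[symmetric] by blast
  \<comment> \<open>Any lift determines \<open>f\<close> through \<open>pr_pline\<close>, so both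
    charts of the sphere can be computed from \<open>w\<close>.\<close>
  have f_lift: "\<exists>y. z = snd c y \<and> c \<in> charts_at A y \<and> chart_inv c z = y \<and> w z \<noteq> 0 \<and>
      f' y = pline sc (w z) \<and> f y = (if snd (w z) \<noteq> 0 then Pt (sc (1 / snd (w z)) (fst (w z))) else Infty)"
    if l: "lift_at f' c x N w" and c: "c \<in> charts_at A x" and z: "z \<in> N" for c x N w z
  proof -
    obtain y where y: "z = snd c y" "y \<in> fst c" using l z by (auto simp: lift_at_def)
    have cy: "c \<in> charts_at A y" using y c by (simp add: charts_at_def)
    then have yp: "y \<in> points A" by (auto simp: charts_at_points)
    have iy: "chart_inv c z = y" using chart_inv_chart[OF i cy] y(1) by simp
    have w: "w z \<noteq> 0" "f' y = pline sc (w z)" using l z iy by (auto simp: lift_at_def)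
    have "f y = pr sc (pline sc (w z))" using f[OF yp] w(2) by simp
    then show ?thesis using y(1) cy iy w pr_pline[OF w(1)] by metis
  qed
  have affine: "\<exists>M. open M \<and> snd c x \<in> M \<and> M \<subseteq> N \<inter> snd c ` {y \<in> fst c. f y \<in> fst ?P} \<and>
      smooth_on M (\<lambda>z. sc (1 / snd (w z)) (fst (w z))) \<and>
      (\<forall>z\<in>M. snd (w z) \<noteq> 0 \<and> the_pt (f (chart_inv c z)) = sc (1 / snd (w z)) (fst (w z)))"
    if l: "lift_at f' c x N w" and c: "c \<in> charts_at A x" and fx: "f x \<noteq> Infty" for c x N w
  proof -
    have N: "open N" "snd c x \<in> N" "smooth_on N w" using l by (auto simp: lift_at_def)
    define M where "M = N \<inter> (\<lambda>z. snd (w z)) -` (- {0})"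
    have "continuous_on N (\<lambda>z. snd (w z))" by (intro continuous_on_snd smooth_on_imp_continuous_on N)
    then have o: "open M" unfolding M_def using N(1) by (rule continuous_open_preimage) auto
    have smw: "smooth_on M w" by (rule smooth_on_subset[OF N(3)]) (auto simp: M_def)
    show ?thesis
    proof (rule exI[of _ M], intro conjI ballI)
      show "open M" by (rule o)
      show "snd c x \<in> M"
        using f_lift[OF l c N(2)] chart_inv_chart[OF i c] fx N(2) by (auto simp: M_def)
      show "smooth_on M (\<lambda>z. sc (1 / snd (w z)) (fst (w z)))"
        by (intro smooth_on_sc smooth_on_divide smooth_on_const smooth_on_snd smooth_on_fst o smw) (auto simp: M_def)
      show "M \<subseteq> N \<inter> snd c ` {y \<in> fst c. f y \<in> fst ?P}"
      proof
        fix z assume z: "z \<in> M"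
        then have zN: "z \<in> N" "snd (w z) \<noteq> 0" by (auto simp: M_def)
        show "z \<in> N \<inter> snd c ` {y \<in> fst c. f y \<in> fst ?P}"
          using f_lift[OF l c zN(1)] zN by (auto simp: charts_at_def)
      qed
      fix z assume z: "z \<in> M"
      then have zN: "z \<in> N" "snd (w z) \<noteq> 0" by (auto simp: M_def)
      then show "snd (w z) \<noteq> 0" by simp
      show "the_pt (f (chart_inv c z)) = sc (1 / snd (w z)) (fst (w z))"
        using f_lift[OF l c zN(1)] zN(2) by auto
    qed
  qed
  \<comment> \<open>With 1/\<open>\<zeta>\<close> rewritten as cnj
    \<open>\<zeta>\<close>/|\<open>\<zeta>\<close>|^2, inverting y/\<open>\<zeta>\<close> cancels
    the denominator |\<open>\<zeta>\<close>|^2. What remains requires only y to be nonzero, so it is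
    smooth across the poles.\<close>
  have infinite: "\<exists>M. open M \<and> snd c x \<in> M \<and> M \<subseteq> N \<inter> snd c ` {y \<in> fst c. f y \<in> fst ?I} \<and>
      smooth_on M (\<lambda>z. inverse ((norm (fst (w z)))\<^sup>2)) \<and>
      smooth_on M (\<lambda>z. inverse ((norm (fst (w z)))\<^sup>2) *\<^sub>R sc (cnj (snd (w z))) (fst (w z))) \<and>
      (\<forall>z\<in>M. fst (w z) \<noteq> 0 \<and>
        inversion_chart (f (chart_inv c z)) = inverse ((norm (fst (w z)))\<^sup>2) *\<^sub>R sc (cnj (snd (w z))) (fst (w z)))"
    if l: "lift_at f' c x N w" and c: "c \<in> charts_at A x" and fx: "f x \<noteq> Pt 0" for c x N w
  proof -
    have N: "open N" "snd c x \<in> N" "smooth_on N w" using l by (auto simp: lift_at_def)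
    define M where "M = N \<inter> (\<lambda>z. fst (w z)) -` (- {0})"
    have "continuous_on N (\<lambda>z. fst (w z))" by (intro continuous_on_fst smooth_on_imp_continuous_on N)
    then have o: "open M" unfolding M_def using N(1) by (rule continuous_open_preimage) auto
    have smw: "smooth_on M w" by (rule smooth_on_subset[OF N(3)]) (auto simp: M_def)
    have smn: "smooth_on M (\<lambda>z. inverse ((norm (fst (w z)))\<^sup>2))"
      by (intro smooth_on_inverse smooth_on_norm_sq smooth_on_fst o smw) (auto simp: M_def)
    have nz: "f y \<noteq> Pt 0 \<longleftrightarrow> fst (w z) \<noteq> 0"
      if "w z \<noteq> 0" "f y = (if snd (w z) \<noteq> 0 then Pt (sc (1 / snd (w z)) (fst (w z))) else Infty)" for z y
      using that by (auto simp: sc_eq_0_iff prod_eq_iff)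
    show ?thesis
    proof (rule exI[of _ M], intro conjI ballI)
      show "open M" by (rule o)
      have "fst (w (snd c x)) \<noteq> 0"
        using f_lift[OF l c N(2)] chart_inv_chart[OF i c] fx nz by metis
      then show "snd c x \<in> M" using N(2) by (simp add: M_def)
      show "smooth_on M (\<lambda>z. inverse ((norm (fst (w z)))\<^sup>2))" by (rule smn)
      show "smooth_on M (\<lambda>z. inverse ((norm (fst (w z)))\<^sup>2) *\<^sub>R sc (cnj (snd (w z))) (fst (w z)))"
        by (intro smooth_on_scaleR smn smooth_on_sc smooth_on_cnj smooth_on_snd smooth_on_fst o smw)
      show "M \<subseteq> N \<inter> snd c ` {y \<in> fst c. f y \<in> fst ?I}"
      proof
        fix z assume z: "z \<in> M"
        then have zN: "z \<in> N" "fst (w z) \<noteq> 0" by (auto simp: M_def)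
        obtain y where y: "z = snd c y" "c \<in> charts_at A y" "f y \<noteq> Pt 0"
          using f_lift[OF l c zN(1)] nz zN(2) by metis
        then show "z \<in> N \<inter> snd c ` {y \<in> fst c. f y \<in> fst ?I}" using zN by (auto simp: charts_at_def)
      qed
      fix z assume z: "z \<in> M"
      then have zN: "z \<in> N" "fst (w z) \<noteq> 0" by (auto simp: M_def)
      then show "fst (w z) \<noteq> 0" by simp
      have fz: "f (chart_inv c z) = (if snd (w z) \<noteq> 0 then Pt (sc (1 / snd (w z)) (fst (w z))) else Infty)"
        using f_lift[OF l c zN(1)] by metis
      show "inversion_chart (f (chart_inv c z)) = inverse ((norm (fst (w z)))\<^sup>2) *\<^sub>R sc (cnj (snd (w z))) (fst (w z))"
      proof (cases "snd (w z) = 0")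
        case True
        then show ?thesis by (simp add: fz inversion_chart_def sc_0_left)
      next
        case False
        define s where "s = snd (w z)"
        define p where "p = fst (w z)"
        have s: "s \<noteq> 0" using False by (simp add: s_def)
        have "of_real ((norm s)\<^sup>2) * (1 / s) = cnj s"
          using s by (simp add: complex_norm_square del: of_real_power)
        then have "sc (cnj s) p = (norm s)\<^sup>2 *\<^sub>R sc (1 / s) p"
          by (simp only: sc_of_real[symmetric] sc_sc)
        then have "inverse ((norm p)\<^sup>2) *\<^sub>R sc (cnj s) p = (inverse ((norm p)\<^sup>2) * (norm s)\<^sup>2) *\<^sub>R sc (1 / s) p"
          by simp
        also have "inverse ((norm p)\<^sup>2) * (norm s)\<^sup>2 = inverse ((norm (sc (1 / s) p))\<^sup>2)"
          by (simp add: norm_sc norm_divide power_mult_distrib power_divide field_simps)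
        finally show ?thesis using False by (simp add: fz inversion_chart_def s_def p_def)
      qed
    qed
  qed
  have ex_lift: "\<exists>N w. lift_at f' c x N w" if c: "c \<in> charts_at A x" for c x
  proof -
    have "x \<in> points A" using c by (auto simp: charts_at_points)
    then obtain d where d: "d \<in> charts_at (proj_atlas sc) (f' x)" using charts' by blast
    then have "d \<in> proj_atlas sc" by (simp add: charts_at_def)
    then obtain L DL where "chart_section d L DL" using proj_chart_section by blast
    then show ?thesis using lift_at_section[OF i sm' c d] by blast
  qed
  have sm: "smooth_map A sphere_atlas f"
  proof (rule smooth_mapI[OF i points_sphere])
    fix x c d assume c: "c \<in> charts_at A x" and d: "d \<in> charts_at sphere_atlas (f x)"
    obtain N w where l: "lift_at f' c x N w" using ex_lift[OF c] by blast
    consider "d = ?P" "f x \<noteq> Infty" | "d = ?I" "f x \<noteq> Pt 0" using d unfolding charts_at_sphere by blast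
    then show "\<exists>N g. open N \<and> snd c x \<in> N \<and> N \<subseteq> snd c ` {y \<in> fst c. f y \<in> fst d} \<and> smooth_on N g \<and>
        (\<forall>z\<in>N. snd d (f (chart_inv c z)) = g z)"
    proof cases
      case 1
      show ?thesis unfolding 1(1) affine_chart_simps(2) using affine[OF l c 1(2)] by blast
    next
      case 2
      show ?thesis unfolding 2(1) infinity_chart_simps(2) using infinite[OF l c 2(2)] by blast
    qed
  qed
  \<comment> \<open>Off the poles, \<open>f\<close> in \<open>affine_chart\<close> and
    \<open>f'\<close> in \<open>plane_chart\<close> have the same coordinate expression, so the
    condition on \<open>f'\<close> is inherited directly.\<close>
  have hol: "hol_at (deriv_in_charts f c ?P x)" if c: "c \<in> charts_at A x" and fx: "f x \<noteq> Infty" for c x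
  proof -
    obtain N w where l: "lift_at f' c x N w" using ex_lift[OF c] by blast
    obtain M where M: "open M" "snd c x \<in> M" "M \<subseteq> N" and Mz: "\<And>z. z \<in> M \<Longrightarrow> snd (w z) \<noteq> 0"
      "\<And>z. z \<in> M \<Longrightarrow> the_pt (f (chart_inv c z)) = sc (1 / snd (w z)) (fst (w z))"
      using affine[OF l c fx] by blast
    have eq: "in_charts f c ?P z = in_charts f' c plane_chart z" if z: "z \<in> M" for z
    proof -
      have "f' (chart_inv c z) = pline sc (w z)" using f_lift[OF l c] M(3) z by (metis subsetD)
      then show ?thesis using Mz[OF z] plane_chart_pline(2)[OF Mz(1)[OF z]] by (simp add: in_charts_def)
    qed
    have "f' x = pline sc (w (snd c x))" using f_lift[OF l c] M(2,3) chart_inv_chart[OF i c] by (metis subsetD)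
    then have d: "plane_chart \<in> charts_at (proj_atlas sc) (f' x)"
      using plane_chart_in_atlas plane_chart_pline(1) Mz(1)[OF M(2)] by (simp add: charts_at_def)
    have "deriv_in_charts f c ?P x = deriv_in_charts f' c plane_chart x"
      by (rule deriv_in_charts_eq[OF M(1,2) eq has_derivative_in_charts[OF sm' c d]])
    then show ?thesis using pseudoholomorphic_immersionD[OF A(1) smooth_atlas_proj ph c d] by simp
  qed
  have inf_inj: "r = 0" if c: "c \<in> charts_at A x" and fx: "f x = Infty" and r: "deriv_in_charts f c ?I x r = 0" for c x r
  proof -
    have x: "x \<in> points A" using c by (auto simp: charts_at_points)
    obtain d where d: "d \<in> charts_at (proj_atlas sc) (f' x)" using charts'[OF x] by blast
    then have dA: "d \<in> proj_atlas sc" "f' x \<in> fst d" by (auto simp: charts_at_def)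
    obtain L DL where L: "chart_section d L DL" using proj_chart_section[OF dA(1)] by blast
    define N where "N = snd c ` {y \<in> fst c. f' y \<in> fst d}"
    define w where "w z = L (in_charts f' c d z)" for z
    define w0 where "w0 = w (snd c x)"
    have l: "lift_at f' c x N w" unfolding N_def w_def by (rule lift_at_section[OF i sm' c d L])
    have xN: "snd c x \<in> N" using l by (simp add: lift_at_def)
    have lx: "chart_inv c (snd c x) = x" by (rule chart_inv_chart[OF i c])
    have w0: "w0 \<noteq> 0" "f' x = pline sc w0" "snd w0 = 0"
      using f_lift[OF l c xN] lx fx by (auto simp: w0_def split: if_splits)
    have fw0: "fst w0 \<noteq> 0" using w0(1,3) by (auto simp: prod_eq_iff)
    have w0L: "w0 = L (snd d (f' x))" by (simp add: w0_def w_def in_charts_chart[OF i c])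
    have mem: "d \<in> proj_atlas sc" "pline sc w0 \<in> fst d" using dA w0(2) by auto
    define Dw where "Dw r = DL (deriv_in_charts f' c d x r)" for r
    have Dw: "(w has_derivative Dw) (at (snd c x))"
      unfolding w_def Dw_def by (rule has_derivative_compose[OF has_derivative_in_charts[OF sm' c d] chart_sectionD(2)[OF L]])
    have Dlin: "linear Dw" using Dw has_derivative_linear by blast
    have fH: "f' x \<in> line_at_infinity sc" unfolding w0(2) using line_at_infinity_iff[OF w0(1)] w0(3) by simp

    \<comment> \<open>Transversality is tested on the vector represented by (0, b). Representatives
      are unique only up to multiples of \<open>w0\<close>, but these have last component 0, so the
      last component is well defined.\<close>
    have surj: "\<exists>r. snd (Dw r) = b" for b
    proof -
      define t where "t d = (if d \<in> charts_at (proj_atlas sc) (pline sc w0) then dcoord d w0 (0, b) else 0)" for d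
      have "t \<in> tangent_space (proj_atlas sc) (f' x)"
        unfolding w0(2) by (rule tangent_space_proj[where v="(0, b)"]) (simp_all add: t_def)
      then obtain u h where th: "t = lincomb 1 (differential A (proj_atlas sc) f' x u) 1 h"
        and u: "u \<in> tangent_space A x" and h: "h \<in> sub_tangent_space (proj_atlas sc) (line_at_infinity sc) (f' x)"
        using tr x fH unfolding transverse_def by blast
      obtain \<epsilon> and \<gamma> :: "real \<Rightarrow> ('v \<times> complex) set" where \<epsilon>: "\<epsilon> > 0"
        and g: "smooth_map {({-\<epsilon><..<\<epsilon>}, \<lambda>s. s)} (proj_atlas sc) \<gamma>" "\<gamma> ` {-\<epsilon><..<\<epsilon>} \<subseteq> line_at_infinity sc" "\<gamma> 0 = f' x"
        and dg: "((snd d \<circ> \<gamma>) has_vector_derivative h d) (at 0)"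
        using h d unfolding sub_tangent_space_def by blast
      \<comment> \<open>The times at which the curve lies in the chart. There its lift by
        \<open>L\<close> has last component identically 0, because the curve runs in the line at
        infinity; hence its velocity contributes nothing to the last component.\<close>
      define O0 where "O0 = {s \<in> {-\<epsilon><..<\<epsilon>}. \<gamma> s \<in> fst d}"
      have "open ((\<lambda>s. s) ` O0)"
        using smooth_map_chart_open[OF g(1) _ dA(1), of "({-\<epsilon><..<\<epsilon>}, \<lambda>s. s)"] by (simp add: O0_def)
      then have O0: "open O0" "0 \<in> O0" using \<epsilon> g(3) dA(2) by (auto simp: O0_def)
      have "(snd d \<circ> \<gamma> has_derivative (\<lambda>s. s *\<^sub>R h d)) (at 0)" using dg by (simp add: has_vector_derivative_def)
      then have "((\<lambda>s. snd (L ((snd d \<circ> \<gamma>) s))) has_derivative (\<lambda>s. snd (DL (s *\<^sub>R h d)))) (at 0)"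
        by (intro has_derivative_snd has_derivative_compose[OF _ chart_sectionD(2)[OF L]])
      then have "((\<lambda>s. 0) has_derivative (\<lambda>s. snd (DL (s *\<^sub>R h d)))) (at (0::real))"
      proof (rule has_derivative_transform_within_open[OF _ O0])
        fix s assume s: "s \<in> O0"
        have pl: "pline sc (L (snd d (\<gamma> s))) = \<gamma> s" by (rule chart_sectionD(5)[OF L]) (use s in \<open>simp add: O0_def\<close>)
        have "\<gamma> s \<in> line_at_infinity sc" using s g(2) by (auto simp: O0_def)
        then have "pline sc (L (snd d (\<gamma> s))) \<in> line_at_infinity sc" by (simp only: pl)
        moreover have "L (snd d (\<gamma> s)) \<noteq> 0" by (rule pline_dom_nonzero[OF dA(1) chart_sectionD(3)[OF L]])
        ultimately show "snd (L ((snd d \<circ> \<gamma>) s)) = 0" using line_at_infinity_iff by simp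
      qed
      then have "snd (DL (1 *\<^sub>R h d)) = 0" using has_derivative_unique[OF _ has_derivative_const] by metis
      then have sh: "snd (DL (h d)) = 0" by simp
      have hd: "h d = dcoord d w0 (DL (h d))" unfolding w0L by (rule chart_sectionD(6)[OF L, symmetric])
      have "dcoord d w0 (0, b) = t d" using d by (simp add: t_def w0(2)[symmetric])
      also have "\<dots> = differential A (proj_atlas sc) f' x u d + h d" by (simp add: th lincomb_def)
      also have "differential A (proj_atlas sc) f' x u d = dcoord d w0 (Dw (u c))"
        using differential_eq[OF A(1) sm' u c d] deriv_in_charts_lift[OF l d lx Dw] by (simp add: w0_def)
      also have "dcoord d w0 (Dw (u c)) + h d = dcoord d w0 (Dw (u c) + DL (h d))"
        by (subst hd) (simp only: linear_add[OF linear_dcoord[OF mem]])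
      finally have "dcoord d w0 ((0, b) - (Dw (u c) + DL (h d))) = 0"
        by (simp only: linear_diff[OF linear_dcoord[OF mem]] diff_self)
      then obtain a where "(0, b) - (Dw (u c) + DL (h d)) = sc_prod sc a w0"
        unfolding dcoord_eq_0_iff[OF mem] by blast
      then have "snd ((0, b) - (Dw (u c) + DL (h d))) = a * snd w0" by (simp only: snd_sc_prod)
      then have "snd (Dw (u c)) = b" using sh w0(3) by simp
      then show ?thesis by blast
    qed
    \<comment> \<open>Composing with \<open>vec_of_complex\<close> gives a real-linear endomorphism
      of \<open>complex\<close>, for which surjectivity implies injectivity.\<close>
    define F where "F z = snd (Dw (vec_of_complex z))" for z
    have Flin: "linear F"
      unfolding F_def using linear_compose[OF bounded_linear.linear[OF bounded_linear_vec_of_complex] Dlin]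
        linear_compose[OF _ bounded_linear.linear[OF bounded_linear_snd]] by (metis (no_types, lifting) ext o_apply)
    have "surj F"
    proof (rule surjI)
      fix b show "F (complex_of_vec (SOME r. snd (Dw r) = b)) = b"
        using someI_ex[OF surj[of b]] by (simp add: F_def)
    qed
    then have Finj: "inj F" using linear_surjective_imp_injective[OF Flin] by blast

    have "f x \<noteq> Pt 0" using fx by simp
    from infinite[OF l c this]
    obtain M where M: "open M" "snd c x \<in> M" and smn: "smooth_on M (\<lambda>z. inverse ((norm (fst (w z)))\<^sup>2))"
      and Mz: "\<And>z. z \<in> M \<Longrightarrow> inversion_chart (f (chart_inv c z)) = inverse ((norm (fst (w z)))\<^sup>2) *\<^sub>R sc (cnj (snd (w z))) (fst (w z))"
      by blast
    obtain m where m: "((\<lambda>z. inverse ((norm (fst (w z)))\<^sup>2)) has_derivative m) (at (snd c x))"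
      using smooth_on_has_derivative[OF smn M(2)] by blast
    have dsw: "((\<lambda>z. snd (w z)) has_derivative (\<lambda>r. snd (Dw r))) (at (snd c x))"
      and dfw: "((\<lambda>z. fst (w z)) has_derivative (\<lambda>r. fst (Dw r))) (at (snd c x))"
      by (intro has_derivative_snd has_derivative_fst Dw)+
    have dsc: "((\<lambda>z. sc (cnj (snd (w z))) (fst (w z))) has_derivative
        (\<lambda>r. sc (cnj (snd w0)) (fst (Dw r)) + sc (cnj (snd (Dw r))) (fst w0))) (at (snd c x))"
      unfolding w0_def
      by (rule bounded_bilinear.FDERIV[OF bounded_bilinear_sc bounded_linear.has_derivative[OF bounded_linear_cnj dsw] dfw])
    have D: "((\<lambda>z. inverse ((norm (fst (w z)))\<^sup>2) *\<^sub>R sc (cnj (snd (w z))) (fst (w z))) has_derivative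
       (\<lambda>r. inverse ((norm (fst (w (snd c x))))\<^sup>2) *\<^sub>R (sc (cnj (snd w0)) (fst (Dw r)) + sc (cnj (snd (Dw r))) (fst w0))
          + m r *\<^sub>R sc (cnj (snd (w (snd c x)))) (fst (w (snd c x))))) (at (snd c x))"
      by (rule has_derivative_scaleR[OF m dsc])
    have eq: "in_charts f c ?I z = inverse ((norm (fst (w z)))\<^sup>2) *\<^sub>R sc (cnj (snd (w z))) (fst (w z))" if "z \<in> M" for z
      using Mz[OF that] by (simp add: in_charts_def)
    \<comment> \<open>As \<open>snd w0 = 0\<close>, only the term that differentiates the conjugated
      last component survives the product rule.\<close>
    have "deriv_in_charts f c ?I x r = inverse ((norm (fst w0))\<^sup>2) *\<^sub>R sc (cnj (snd (Dw r))) (fst w0)"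
      by (subst deriv_in_charts_eq[OF M eq D]) (simp_all add: w0_def[symmetric] w0(3) sc_0_left)
    then have "inverse ((norm (fst w0))\<^sup>2) *\<^sub>R sc (cnj (snd (Dw r))) (fst w0) = 0" by (simp only: r)
    then have "snd (Dw r) = 0" using fw0 by (simp add: sc_eq_0_iff)
    then have "F (complex_of_vec r) = F 0"
      using linear_0[OF Flin] by (simp add: F_def)
    then have "complex_of_vec r = 0" using Finj by (meson injD)
    then have "vec_of_complex (complex_of_vec r) = 0" by (simp add: vec_of_complex_def vec_eq_iff forall_2 del: vec_complex_inverse)
    then show ?thesis by simp
  qed
  have imm: "immersion A sphere_atlas f"
    unfolding immersion_def
  proof (intro conjI ballI)
    fix x assume "x \<in> points A"
    then obtain c where c: "c \<in> charts_at A x" by (auto simp: charts_at_points)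
    have "\<exists>d\<in>charts_at sphere_atlas (f x). \<forall>r. deriv_in_charts f c d x r = 0 \<longrightarrow> r = 0"
    proof (cases "f x = Infty")
      case True
      have "?I \<in> charts_at sphere_atlas (f x)" by (simp add: charts_at_sphere True)
      then show ?thesis using inf_inj[OF c True] by blast
    next
      case False
      have P: "?P \<in> charts_at sphere_atlas (f x)" by (simp add: charts_at_sphere False)
      show ?thesis using P hol_at_inj[OF linear_deriv_in_charts[OF sm c P] hol[OF c False]] by blast
    qed
    then obtain d where d: "d \<in> charts_at sphere_atlas (f x)" and inj: "\<And>r. deriv_in_charts f c d x r = 0 \<Longrightarrow> r = 0"
      by blast
    show "inj_on (differential A sphere_atlas f x) (tangent_space A x)"
    proof (rule inj_onI)
      fix t t' assume t: "t \<in> tangent_space A x" "t' \<in> tangent_space A x"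
        and eq: "differential A sphere_atlas f x t = differential A sphere_atlas f x t'"
      have "deriv_in_charts f c d x (t c) = deriv_in_charts f c d x (t' c)"
        using eq differential_eq[OF A(1) sm t(1) c d] differential_eq[OF A(1) sm t(2) c d] by simp
      then have "deriv_in_charts f c d x (t c - t' c) = 0"
        by (simp only: linear_diff[OF linear_deriv_in_charts[OF sm c d]] diff_self)
      then have "t c = t' c" using inj right_minus_eq by blast
      then show "t = t'" by (rule tangent_space_eqI[OF t c])
    qed
  qed (rule sm)
  define W where "W = {x. f x \<noteq> Infty}"
  have oW: "open (snd c ` (fst c \<inter> W))" if "c \<in> A" for c
    unfolding W_def by (rule open_finite_part[OF sm that])
  have smW: "smooth_map (restrict_atlas A W) plane_atlas f"
    unfolding W_def by (rule smooth_map_finite_part[OF i sm])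
  have "pseudoholomorphic_immersion (restrict_atlas A W) plane_atlas (mult_i sc) f"
  proof (rule pseudoholomorphic_immersionI[OF smooth_atlas_restrict[OF A(1) oW] oriented_restrict[OF A oW]
        smooth_atlas_plane smW plane_transition_sc])
    fix x assume "x \<in> points (restrict_atlas A W)"
    then obtain c' where c': "c' \<in> charts_at (restrict_atlas A W) x" by (auto simp: charts_at_points)
    then obtain c where c: "x \<in> W" "c \<in> charts_at A x" "c' = (fst c \<inter> W, snd c)"
      unfolding restrict_atlas_charts_at by blast
    have fx: "f x \<noteq> Infty" using c(1) by (simp add: W_def)
    have "c \<in> A" using c(2) by (simp add: charts_at_def)
    then have "deriv_in_charts f c' ?P x = deriv_in_charts f c ?P x"
      unfolding c(3) by (intro deriv_in_charts_restrict[OF i c(2,1) oW])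
    then have "hol_at (deriv_in_charts f c' ?P x)" using hol[OF c(2) fx] by simp
    moreover have "?P \<in> charts_at plane_atlas (f x)" using fx by (simp add: charts_at_plane)
    ultimately show "\<exists>c\<in>charts_at (restrict_atlas A W) x. \<exists>d\<in>charts_at plane_atlas (f x). hol_at (deriv_in_charts f c d x)"
      using c' by blast
  qed
  then show ?thesis
    using imm by (simp add: pseudoholomorphic_immersion_sphere_def W_def)
qed

end

theorem theorem20p2:
  fixes sc :: "complex \<Rightarrow> 'v::euclidean_space \<Rightarrow> 'v"
    and herm :: "'v \<Rightarrow> 'v \<Rightarrow> complex"
    and \<Sigma> :: "('a, real^2) chart set"
    and f :: "'a \<Rightarrow> 'v one_point"
  assumes "hermitian_plane sc herm"
    and "oriented_surface \<Sigma>"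
  shows "pseudoholomorphic_immersion_sphere sc \<Sigma> f \<longleftrightarrow>
    (\<exists>f' :: 'a \<Rightarrow> ('v \<times> complex) set.
       pseudoholomorphic_immersion \<Sigma> (proj_atlas sc) (mult_i sc) f' \<and>
       transverse \<Sigma> (proj_atlas sc) f' (line_at_infinity sc) \<and>
       (\<forall>x\<in>points \<Sigma>. f x = pr sc (f' x)))"
proof -
  interpret hermitian_plane sc herm by fact
  have A: "smooth_atlas \<Sigma>" "oriented \<Sigma>"
    using assms(2) by (auto simp: oriented_surface_def smooth_manifold_def oriented_def)
  show ?thesis
    using lift_to_projective[OF A] project_to_sphere[OF A] by blast
qed

end
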